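(* Let $n\ge 1$, let $m:\mathbb R^n\to\mathbb R$ be a bounded measurable function, let $1\le p<\infty$ and $0<\varphi<\pi/2$. The following assertions are equivalent: (i) $m\in\mathcal M_p$. (ii) There exist constants $c>0$ and $C>0$ such that for every $z\in\mathbb C$ with $|\arg(z)|=\varphi$ we have $e^{zm}\in\mathcal M_p$, $e^{-zm}\in\mathcal M_p$ and $\|e^{\pm zm}\|_{\mathcal M_p}\le C e^{c|z|}$.
   Context: For a bounded measurable function $m:\mathbb R^n\to\mathbb C$, $T_m$ is the operator defined initially on test functions by $T_mf(x)=\int_{\mathbb R^n}m(\xi)\hat f(\xi)e^{ix\cdot\xi}\,d\xi$, where $\hat f$ is the Fourier transform of $f$ (normalized so that $T_1$ is the identity). For $1\le p<\infty$, $\mathcal M_p=\mathcal M_p(\mathbb R^n)$ is the space of those $m$ for which $T_m$ extends to a bounded operator on $L^p(\mathbb R^n)$, with norm $\|m\|_{\mathcal M_p}=\|T_m\|_{L^p\to L^p}$. The principal argument $\arg$ takes values in $(-\pi,\pi]$. *)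

theory Defs
  imports "HOL-Analysis.Analysis"
begin

primrec iter_partial ::
    "'n list \<Rightarrow> (real ^ 'n \<Rightarrow> complex) \<Rightarrow> real ^ 'n \<Rightarrow> complex" where
  "iter_partial [] f = f"
| "iter_partial (i # is) f =
     (\<lambda>x. frechet_derivative (iter_partial is f) (at x) (axis i 1))"

text \<open>Differentiability of every iterated partial derivative already gives continuity of all of
  them, so \<^term>\<open>test_functions\<close> is the space of smooth functions with compact support.\<close>

definition test_functions :: "(real ^ 'n \<Rightarrow> complex) set" where
  "test_functions =
     {f. (\<forall>is. iter_partial is f differentiable_on UNIV) \<and> compact (closure {x. f x \<noteq> 0})}"

text \<open>The factor \<open>(2 * pi)\<close> to the power \<open>-n\<close> is placed here, so that inversion holds without
  a constant, i.e. the multiplier \<open>1\<close> gives the identity.\<close>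

definition fourier :: "(real ^ 'n \<Rightarrow> complex) \<Rightarrow> real ^ 'n \<Rightarrow> complex" where
  "fourier f \<xi> =
     (LINT x|lebesgue. f x * exp (- (\<i> * complex_of_real (x \<bullet> \<xi>))))
       / complex_of_real ((2 * pi) ^ CARD('n))"

definition multiplier_op ::
    "(real ^ 'n \<Rightarrow> complex) \<Rightarrow> (real ^ 'n \<Rightarrow> complex) \<Rightarrow> real ^ 'n \<Rightarrow> complex" where
  "multiplier_op m f x =
     (LINT \<xi>|lebesgue. m \<xi> * fourier f \<xi> * exp (\<i> * complex_of_real (x \<bullet> \<xi>)))"

text \<open>Elements of \<open>Lp p\<close> are functions rather than classes of functions; equality in the Lebesgue
  space is equality almost everywhere. Intended for \<open>1 \<le> p\<close>.\<close>

definition Lp :: "real \<Rightarrow> (real ^ 'n \<Rightarrow> complex) set" where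
  "Lp p = {f. f \<in> borel_measurable lebesgue \<and> integrable lebesgue (\<lambda>x. norm (f x) powr p)}"

definition Lp_norm :: "real \<Rightarrow> (real ^ 'n \<Rightarrow> complex) \<Rightarrow> real" where
  "Lp_norm p f = (LINT x|lebesgue. norm (f x) powr p) powr (1 / p)"

text \<open>Linearity and boundedness together make such an \<open>S\<close> respect equality almost everywhere, so
  it induces a bounded linear operator on the classes.\<close>

definition bounded_op_Lp ::
    "real \<Rightarrow> ((real ^ 'n \<Rightarrow> complex) \<Rightarrow> real ^ 'n \<Rightarrow> complex) \<Rightarrow> bool" where
  "bounded_op_Lp p S \<longleftrightarrow>
     (\<forall>f\<in>Lp p. S f \<in> Lp p) \<and>
     (\<forall>f\<in>Lp p. \<forall>g\<in>Lp p. AE x in lebesgue. S (\<lambda>y. f y + g y) x = S f x + S g x) \<and>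
     (\<forall>c. \<forall>f\<in>Lp p. AE x in lebesgue. S (\<lambda>y. c * f y) x = c * S f x) \<and>
     (\<exists>B. \<forall>f\<in>Lp p. Lp_norm p (S f) \<le> B * Lp_norm p f)"

definition Lp_op_norm ::
    "real \<Rightarrow> ((real ^ 'n \<Rightarrow> complex) \<Rightarrow> real ^ 'n \<Rightarrow> complex) \<Rightarrow> real" where
  "Lp_op_norm p S = Inf {B. 0 \<le> B \<and> (\<forall>f\<in>Lp p. Lp_norm p (S f) \<le> B * Lp_norm p f)}"

definition extends_multiplier_op ::
    "real \<Rightarrow> (real ^ 'n \<Rightarrow> complex) \<Rightarrow>
     ((real ^ 'n \<Rightarrow> complex) \<Rightarrow> real ^ 'n \<Rightarrow> complex) \<Rightarrow> bool" where
  "extends_multiplier_op p m S \<longleftrightarrow>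
     bounded_op_Lp p S \<and>
     (\<forall>f\<in>test_functions. AE x in lebesgue. S f x = multiplier_op m f x)"

definition Mp :: "real \<Rightarrow> (real ^ 'n \<Rightarrow> complex) set" where
  "Mp p = {m. m \<in> borel_measurable lebesgue \<and> bounded (range m) \<and>
              (\<exists>S. extends_multiplier_op p m S)}"

text \<open>For \<open>1 \<le> p\<close> the test functions are dense, so any two extensions agree almost everywhere on
  each element of \<open>Lp p\<close> and the choice below is immaterial. The value is meaningful only for
  \<^term>\<open>m \<in> Mp p\<close>.\<close>

definition Mp_norm :: "real \<Rightarrow> (real ^ 'n \<Rightarrow> complex) \<Rightarrow> real" where
  "Mp_norm p m = Lp_op_norm p (SOME S. extends_multiplier_op p m S)"

end

theory Submission
  imports Defs "HOL-Probability.Probability"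
begin

text \<open>Call \<open>m\<close> bounded by \<open>B\<close> if \<open>T\<^sub>m\<close> maps test functions into \<open>L\<^sup>p\<close> with norm at most \<open>B\<close>; by
  density and completeness this is equivalent to membership in \<open>M\<^sub>p\<close> with norm at most \<open>B\<close>. Such
  multipliers form a normed algebra closed under bounded pointwise limits (Fatou), so the
  exponential series gives (i) \<open>\<Longrightarrow>\<close> (ii). Conversely, every unimodular \<open>w\<close> is a real combination
  \<open>a * z\<^sub>1 + b * z\<^sub>2\<close> of points on the two rays, so \<open>exp (w * m)\<close> is a product of two admissible
  exponentials and is bounded uniformly in \<open>w\<close>; Cauchy's formula on the unit circle, in the
  discrete form of averages over roots of unity, then recovers \<open>m\<close> as a limit of such averages.\<close>

section \<open>Smooth functions\<close>

text \<open>\<open>Mp\<close> speaks of some linear extension to \<open>Lp p\<close>, determined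
  only up to null sets, and \<open>Mp_norm\<close> picks one by \<open>SOME\<close>. The algebra is
  therefore done with \<open>mult_bound\<close>, which involves only absolutely convergent integrals
  attached to test functions; the translation to and from \<open>Mp\<close> is confined to
  \<open>mult_bound_imp_Mp\<close>, \<open>Mp_norm_le\<close> and \<open>Mp_mult_bound\<close>. The
  obstacle is the bound for products. \<open>multiplier_op m2 f\<close> is smooth but need not have
  compact support, and its frequency side \<open>m2 \<xi> * fourier f \<xi>\<close> is no more
  regular than a bounded measurable symbol, so the bound for \<open>m1\<close> does not apply to it
  directly. This point dictates the analytic groundwork: integrable transforms, Fourier inversion,
  smooth inverse transforms, and continuity of translations in the integral norm. Averages over
  roots of unity stand in for the contour integral because finite sums, products and bounded
  pointwise limits are the operations under which \<open>mult_bound\<close> is shown to be stable;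
  no operator-valued integral has to be defined.\<close>

definition partial :: "'n::finite \<Rightarrow> (real ^ 'n \<Rightarrow> complex) \<Rightarrow> real ^ 'n \<Rightarrow> complex" where
  "partial i f = (\<lambda>x. frechet_derivative f (at x) (axis i 1))"

definition smooth :: "(real ^ 'n \<Rightarrow> complex) \<Rightarrow> bool" where
  "smooth f \<longleftrightarrow> (\<forall>is. iter_partial is f differentiable_on UNIV)"

text \<open>Smoothness has no induction parameter. Counting the order and peeling off the first
  derivative supplies one, so that the product rule can be handled at each fixed order.\<close>

primrec diff_upto :: "nat \<Rightarrow> (real ^ 'n \<Rightarrow> complex) \<Rightarrow> bool" where
  "diff_upto 0 f \<longleftrightarrow> f differentiable_on UNIV"
| "diff_upto (Suc k) f \<longleftrightarrow> f differentiable_on UNIV \<and> (\<forall>i. diff_upto k (partial i f))"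

text \<open>\<open>iter_partial\<close> adds new derivatives on the outside; this exposes the
  innermost one, so that an induction generalised over \<open>f\<close> can pass from
  \<open>f\<close> to a first partial derivative.\<close>

lemma iter_partial_snoc: "iter_partial (is @ [i]) f = iter_partial is (partial i f)"
  by (induction "is") (simp_all add: partial_def)

lemma partialI:
  "(f has_derivative D) (at x) \<Longrightarrow> partial i f x = D (axis i 1)"
  unfolding partial_def using frechet_derivative_at by metis

lemma differentiable_on_UNIV_D:
  "f differentiable_on UNIV \<Longrightarrow> (f has_derivative frechet_derivative f (at x)) (at x)"
  by (simp add: differentiable_on_def frechet_derivative_works)

lemma differentiable_on_UNIV_I:
  "(\<And>x. (f has_derivative D x) (at x)) \<Longrightarrow> f differentiable_on UNIV"
  by (auto simp: differentiable_on_def differentiable_def)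

lemma diff_upto_SucD: "diff_upto (Suc k) f \<Longrightarrow> diff_upto k f"
proof (induction k arbitrary: f)
  case (Suc k)
  then show ?case by (metis diff_upto.simps(2))
qed simp

lemma diff_upto_iter_partial:
  "diff_upto (length is) f \<Longrightarrow> iter_partial is f differentiable_on UNIV"
proof (induction "is" arbitrary: f rule: rev_induct)
  case (snoc i "is")
  then show ?case by (simp add: iter_partial_snoc)
qed simp

lemma smooth_imp_diff_upto: "smooth f \<Longrightarrow> diff_upto k f"
proof (induction k arbitrary: f)
  case 0
  then have "iter_partial [] f differentiable_on UNIV" unfolding smooth_def by blast
  then show ?case by simp
next
  case (Suc k)
  have "iter_partial [] f differentiable_on UNIV" using Suc.prems unfolding smooth_def by blast
  moreover have "smooth (partial i f)" for i
    using Suc.prems unfolding smooth_def iter_partial_snoc[symmetric] by blast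
  ultimately show ?case using Suc.IH by simp
qed

lemma smooth_iff_diff_upto: "smooth f \<longleftrightarrow> (\<forall>k. diff_upto k f)"
  using smooth_imp_diff_upto diff_upto_iter_partial unfolding smooth_def by blast

lemma smooth_differentiable: "smooth f \<Longrightarrow> f differentiable_on UNIV"
  using smooth_imp_diff_upto[of f 0] by simp

lemma smooth_partial: "smooth f \<Longrightarrow> smooth (partial i f)"
  by (meson diff_upto.simps(2) smooth_iff_diff_upto)

lemma smooth_continuous: "smooth f \<Longrightarrow> continuous_on UNIV f"
  using smooth_differentiable differentiable_imp_continuous_on by blast

lemma smooth_has_derivative:
  "smooth f \<Longrightarrow> (f has_derivative frechet_derivative f (at x)) (at x)"
  using smooth_differentiable differentiable_on_UNIV_D by blast

text \<open>Smoothness as a greatest fixed point. It suits families given by a formula with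
  parameters (constants, affine substitutions, inverse Fourier integrals), where differentiation
  only changes the parameters.\<close>

lemma smooth_coinduct:
  assumes "P f"
    and "\<And>f. P f \<Longrightarrow> f differentiable_on UNIV"
    and "\<And>f i. P f \<Longrightarrow> P (partial i f)"
  shows "smooth f"
proof -
  have "P f \<Longrightarrow> diff_upto k f" for k f
    by (induction k arbitrary: f) (use assms(2,3) in auto)
  then show ?thesis using assms(1) smooth_iff_diff_upto by blast
qed

lemma smooth_const: "smooth (\<lambda>x. c)"
proof (rule smooth_coinduct[where P="\<lambda>f. \<exists>c. f = (\<lambda>x. c)"])
  fix f :: "real ^ 'n \<Rightarrow> complex" and i assume "\<exists>c. f = (\<lambda>x. c)"
  then show "\<exists>c. partial i f = (\<lambda>x. c)" by (auto simp: partial_def)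
qed auto

lemma diff_upto_add: "diff_upto k f \<Longrightarrow> diff_upto k g \<Longrightarrow> diff_upto k (\<lambda>x. f x + g x)"
proof (induction k arbitrary: f g)
  case 0
  then show ?case by (auto intro!: derivative_intros)
next
  case (Suc k)
  have "partial i (\<lambda>x. f x + g x) = (\<lambda>x. partial i f x + partial i g x)" for i
  proof
    fix x
    have "((\<lambda>x. f x + g x) has_derivative (\<lambda>h. frechet_derivative f (at x) h + frechet_derivative g (at x) h)) (at x)"
      using Suc.prems by (intro has_derivative_add differentiable_on_UNIV_D) auto
    from partialI[OF this]
    show "partial i (\<lambda>x. f x + g x) x = partial i f x + partial i g x"
      by (simp add: partial_def)
  qed
  then show ?case using Suc by (auto intro!: derivative_intros)
qed

lemma partial_mult:
  assumes "f differentiable_on UNIV" "g differentiable_on UNIV"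
  shows "partial i (\<lambda>x. f x * g x) = (\<lambda>x. f x * partial i g x + partial i f x * g x)"
proof
  fix x
  have "((\<lambda>x. f x * g x) has_derivative (\<lambda>h. f x * frechet_derivative g (at x) h + frechet_derivative f (at x) h * g x)) (at x)"
    using assms by (intro has_derivative_mult differentiable_on_UNIV_D) auto
  from partialI[OF this]
  show "partial i (\<lambda>x. f x * g x) x = f x * partial i g x + partial i f x * g x"
    by (simp add: partial_def)
qed

lemma differentiable_on_mult_complex:
  fixes f g :: "real ^ 'n \<Rightarrow> complex"
  assumes "f differentiable_on UNIV" "g differentiable_on UNIV"
  shows "(\<lambda>x. f x * g x) differentiable_on UNIV"
  by (rule differentiable_on_UNIV_I, rule has_derivative_mult)
     (use assms differentiable_on_UNIV_D in blast)+

lemma diff_upto_mult: "diff_upto k f \<Longrightarrow> diff_upto k g \<Longrightarrow> diff_upto k (\<lambda>x. f x * g x)"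
proof (induction k arbitrary: f g)
  case 0
  then show ?case by (auto intro!: differentiable_on_mult_complex)
next
  case (Suc k)
  then have "f differentiable_on UNIV" "g differentiable_on UNIV" by auto
  \<comment> \<open>The undifferentiated factors of the product rule are needed at the lower order
    too.\<close>
  moreover from Suc.prems have "diff_upto k f" "diff_upto k g"
    using diff_upto_SucD by blast+
  ultimately show ?case using Suc
    by (auto simp: partial_mult intro!: differentiable_on_mult_complex diff_upto_add)
qed

lemma smooth_add: "smooth f \<Longrightarrow> smooth g \<Longrightarrow> smooth (\<lambda>x. f x + g x)"
  by (simp add: smooth_iff_diff_upto diff_upto_add)

lemma smooth_mult: "smooth f \<Longrightarrow> smooth g \<Longrightarrow> smooth (\<lambda>x. f x * g x)"
  by (simp add: smooth_iff_diff_upto diff_upto_mult)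

lemma smooth_cmult: "smooth f \<Longrightarrow> smooth (\<lambda>x. c * f x)"
  by (intro smooth_mult smooth_const)

lemma smooth_diff: "smooth f \<Longrightarrow> smooth g \<Longrightarrow> smooth (\<lambda>x. f x - g x)"
  using smooth_add[of f "\<lambda>x. -1 * g x"] smooth_cmult[of g "-1"] by simp

lemma smooth_prod: "(\<And>i. i \<in> I \<Longrightarrow> smooth (f i)) \<Longrightarrow> smooth (\<lambda>x. \<Prod>i\<in>I. f i x)"
  by (induction I rule: infinite_finite_induct) (auto intro: smooth_const smooth_mult)

lemma smooth_power: "smooth f \<Longrightarrow> smooth (\<lambda>x. f x ^ k)"
  by (induction k) (auto intro: smooth_const smooth_mult)

text \<open>Each derivative brings out a factor \<open>a\<close>, so the coinductive class carries a
  scalar \<open>c\<close>.\<close>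

lemma smooth_affine:
  assumes "smooth f"
  shows "smooth (\<lambda>x. f (a *\<^sub>R x + b))"
proof (rule smooth_coinduct[where P="\<lambda>f. \<exists>c g. smooth g \<and> f = (\<lambda>x. c * g (a *\<^sub>R x + b))"])
  show "\<exists>c g. smooth g \<and> (\<lambda>x. f (a *\<^sub>R x + b)) = (\<lambda>x. c * g (a *\<^sub>R x + b))"
    using assms by (intro exI[of _ 1] exI[of _ f]) auto
next
  fix f assume "\<exists>c g. smooth g \<and> f = (\<lambda>x. c * g (a *\<^sub>R x + b))"
  then obtain c g where g: "smooth g" "f = (\<lambda>x. c * g (a *\<^sub>R x + b))" by blast
  have aff: "((\<lambda>x. a *\<^sub>R x + b) has_derivative (\<lambda>h. a *\<^sub>R h)) (at x)" for x
    by (auto intro!: derivative_eq_intros)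
  have D: "(f has_derivative (\<lambda>h. c * frechet_derivative g (at (a *\<^sub>R x + b)) (a *\<^sub>R h))) (at x)" for x
    unfolding g(2)
    by (intro has_derivative_mult_right has_derivative_compose[OF aff]
        smooth_has_derivative g(1))
  then show "f differentiable_on UNIV" by (rule differentiable_on_UNIV_I)
  fix i
  have "partial i f x = (c * of_real a) * partial i g (a *\<^sub>R x + b)" for x
  proof -
    have "linear (frechet_derivative g (at (a *\<^sub>R x + b)))"
      by (meson g(1) has_derivative_linear smooth_has_derivative)
    then show ?thesis
      using partialI[OF D, of i x]
      by (simp add: partial_def linear_scale scaleR_conv_of_real[where 'a=complex] mult.assoc)
  qed
  then show "\<exists>c g. smooth g \<and> partial i f = (\<lambda>x. c * g (a *\<^sub>R x + b))"
    using smooth_partial[OF g(1), of i] by blast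
qed

text \<open>The one-sided profiles \<open>t\<close> to the power \<open>-k\<close> times \<open>exp (-1/t)\<close> are closed under
  differentiation up to linear combinations, which makes smoothness of bumps an induction.\<close>

definition exp_profile :: "nat \<Rightarrow> real \<Rightarrow> real" where
  "exp_profile k t = (if t > 0 then exp (- inverse t) * inverse t ^ k else 0)"

lemma exp_profile_tendsto_0: "(exp_profile k \<longlongrightarrow> 0) (at 0)"
proof -
  have "((\<lambda>s::real. s ^ k / exp s) \<longlongrightarrow> 0) at_top" by (rule tendsto_power_div_exp_0)
  then have "((\<lambda>t::real. inverse t ^ k / exp (inverse t)) \<longlongrightarrow> 0) (at_right 0)"
    by (rule filterlim_compose[OF _ filterlim_inverse_at_top_right])
  then have "(exp_profile k \<longlongrightarrow> 0) (at_right 0)"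
    by (rule Lim_transform_eventually)
       (auto simp: eventually_at_filter exp_profile_def exp_minus field_simps)
  moreover have "(exp_profile k \<longlongrightarrow> 0) (at_left 0)"
    by (rule tendsto_eventually) (auto simp: eventually_at_filter exp_profile_def)
  ultimately show ?thesis by (simp add: filterlim_split_at)
qed

text \<open>For \<open>t > 0\<close> this is the product rule. At 0 the difference quotient of
  \<open>exp_profile k\<close> is \<open>exp_profile (k+1)\<close>, whose limit there is 0.\<close>

lemma exp_profile_deriv:
  "(exp_profile k has_real_derivative (exp_profile (k+2) t - real k * exp_profile (k+1) t)) (at t)"
proof -
  consider "t > 0" | "t = 0" | "t < 0" by linarith
  then show ?thesis
  proof cases
    case 1
    have "((\<lambda>t. exp (- inverse t) * inverse t ^ k) has_real_derivative
       (exp_profile (k+2) t - real k * exp_profile (k+1) t)) (at t)"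
      using 1
    proof (cases k)
      case 0
      then show ?thesis using 1
        by (auto intro!: derivative_eq_intros simp: exp_profile_def power2_eq_square)
    next
      case (Suc j)
      have "((\<lambda>t. inverse t ^ k) has_real_derivative real k * (- (inverse t * inverse t)) * inverse t ^ j) (at t)"
        using DERIV_power[OF DERIV_inverse[of t UNIV], of k] 1 Suc
        by (simp add: numeral_2_eq_2 mult.assoc)
      moreover have "((\<lambda>t. exp (- inverse t)) has_real_derivative exp (- inverse t) * (inverse t * inverse t)) (at t)"
        using 1 by (auto intro!: derivative_eq_intros)
      ultimately have "((\<lambda>t. exp (- inverse t) * inverse t ^ k) has_real_derivative
          exp (- inverse t) * (inverse t * inverse t) * inverse t ^ k +
          real k * (- (inverse t * inverse t)) * inverse t ^ j * exp (- inverse t)) (at t)"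
        by (rule DERIV_mult[rotated])
      then show ?thesis using 1 Suc
        by (simp add: exp_profile_def algebra_simps)
    qed
    then show ?thesis
      by (rule has_field_derivative_transform_within_open[of _ _ _ "{0<..}"])
         (use 1 in \<open>auto simp: exp_profile_def\<close>)
  next
    case 2
    have "(\<lambda>h. exp_profile k (0 + h) / h) = exp_profile (k+1)"
      by (auto simp: exp_profile_def field_simps)
    then have "(exp_profile k has_real_derivative 0) (at 0)"
      using exp_profile_tendsto_0[of "k+1"] unfolding DERIV_def
      by (simp add: exp_profile_def[of _ 0])
    then show ?thesis using 2 by (simp add: exp_profile_def[of _ 0])
  next
    case 3
    have "((\<lambda>t. 0) has_real_derivative
       (exp_profile (k+2) t - real k * exp_profile (k+1) t)) (at t)"
      using 3 by (auto simp: exp_profile_def)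
    then show ?thesis
      by (rule has_field_derivative_transform_within_open[of _ _ _ "{..<0}"])
         (use 3 in \<open>auto simp: exp_profile_def\<close>)
  qed
qed

text \<open>The squared distance is used in place of the norm because it is polynomial in the
  coordinates, hence smooth at the centre as well.\<close>

definition ball_bump :: "real ^ 'n \<Rightarrow> real \<Rightarrow> nat \<Rightarrow> real ^ 'n \<Rightarrow> complex" where
  "ball_bump a r k x = complex_of_real (exp_profile k (r\<^sup>2 - (x - a) \<bullet> (x - a)))"

lemma ball_bump_has_derivative:
  "(ball_bump a r k has_derivative (\<lambda>h. of_real
     ((exp_profile (k+2) (r\<^sup>2 - (x - a) \<bullet> (x - a)) - real k * exp_profile (k+1) (r\<^sup>2 - (x - a) \<bullet> (x - a)))
       * (- 2 * ((x - a) \<bullet> h))))) (at x)"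
proof -
  have "((\<lambda>x. r\<^sup>2 - (x - a) \<bullet> (x - a)) has_derivative (\<lambda>h. - 2 * ((x - a) \<bullet> h))) (at x)"
    by (auto intro!: derivative_eq_intros simp: inner_commute)
  from has_derivative_compose[OF this exp_profile_deriv[unfolded has_field_derivative_def]]
  show ?thesis unfolding ball_bump_def by (intro has_derivative_of_real) 
qed

lemma smooth_coord: "smooth (\<lambda>x::real^'n. complex_of_real (x $ i))"
proof -
  have D: "((\<lambda>x::real^'n. complex_of_real (x $ i)) has_derivative (\<lambda>h. complex_of_real (h $ i))) (at x)" for x
    by (intro has_derivative_of_real bounded_linear.has_derivative[OF bounded_linear_vec_nth] has_derivative_ident)
  have "partial j (\<lambda>x::real^'n. complex_of_real (x $ i)) = (\<lambda>x. complex_of_real (axis j 1 $ i))" for j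
    using partialI[OF D] by blast
  then have "diff_upto (Suc k) (\<lambda>x::real^'n. complex_of_real (x $ i))" for k
    using differentiable_on_UNIV_I[OF D] smooth_imp_diff_upto[OF smooth_const] by auto
  then show ?thesis using diff_upto_SucD smooth_iff_diff_upto by blast
qed

text \<open>A derivative raises \<open>k\<close> by 1 or 2 and multiplies by a coordinate
  polynomial, so the induction on the order must leave \<open>k\<close> arbitrary.\<close>

lemma diff_upto_ball_bump: "diff_upto j (ball_bump a r k)"
proof (induction j arbitrary: k)
  case 0
  show ?case using differentiable_on_UNIV_I[OF ball_bump_has_derivative] by simp
next
  case (Suc j)
  have eq: "partial i (ball_bump a r k) = (\<lambda>x. (ball_bump a r (k+2) x + (- of_nat k) * ball_bump a r (k+1) x)
      * (- 2 * (complex_of_real (x $ i) + (- complex_of_real (a $ i)))))" for i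
  proof
    fix x
    show "partial i (ball_bump a r k) x = (ball_bump a r (k+2) x + (- of_nat k) * ball_bump a r (k+1) x)
      * (- 2 * (complex_of_real (x $ i) + (- complex_of_real (a $ i))))"
      using partialI[OF ball_bump_has_derivative, of i a r k x]
      by (simp add: ball_bump_def inner_axis algebra_simps)
  qed
  have "diff_upto j (partial i (ball_bump a r k))" for i
    unfolding eq by (intro diff_upto_mult diff_upto_add Suc.IH smooth_imp_diff_upto[OF smooth_const]
        smooth_imp_diff_upto[OF smooth_coord])
  then show ?case using differentiable_on_UNIV_I[OF ball_bump_has_derivative, of a r k] by auto
qed

lemma smooth_ball_bump: "smooth (ball_bump a r k)"
  by (simp add: diff_upto_ball_bump smooth_iff_diff_upto)

section \<open>Test functions\<close>

lemma test_functions_iff: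
  "f \<in> test_functions \<longleftrightarrow> smooth f \<and> bounded {x. f x \<noteq> 0}"
proof -
  have "compact (closure {x. f x \<noteq> 0}) \<longleftrightarrow> bounded {x. f x \<noteq> 0}"
    by (meson bounded_closure bounded_subset closed_closure closure_subset compact_eq_bounded_closed)
  then show ?thesis by (simp add: test_functions_def smooth_def)
qed

lemma test_smooth: "f \<in> test_functions \<Longrightarrow> smooth f"
  by (simp add: test_functions_iff)

lemma test_continuous: "f \<in> test_functions \<Longrightarrow> continuous_on UNIV f"
  by (simp add: test_functions_iff smooth_continuous)

lemma test_cmult: "f \<in> test_functions \<Longrightarrow> (\<lambda>x. c * f x) \<in> test_functions"
  by (auto simp: test_functions_iff intro: smooth_cmult elim!: bounded_subset)

lemma test_zero: "(\<lambda>x. 0) \<in> test_functions"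
  by (auto simp: test_functions_iff intro: smooth_const)

lemma test_add:
  assumes "f \<in> test_functions" "g \<in> test_functions"
  shows "(\<lambda>x. f x + g x) \<in> test_functions"
proof -
  have "bounded ({x. f x \<noteq> 0} \<union> {x. g x \<noteq> 0})" using assms by (simp add: test_functions_iff)
  then have "bounded {x. f x + g x \<noteq> 0}" by (rule bounded_subset) auto
  then show ?thesis using assms by (auto simp: test_functions_iff intro: smooth_add)
qed

lemma test_diff:
  "f \<in> test_functions \<Longrightarrow> g \<in> test_functions \<Longrightarrow> (\<lambda>x. f x - g x) \<in> test_functions"
  using test_add[of f "\<lambda>x. -1 * g x"] test_cmult[of g "-1"] by simp

text \<open>Off the closure of its support \<open>f\<close> vanishes on an open set, so the
  derivative vanishes there too and the support stays bounded.\<close>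

lemma test_partial:
  assumes "f \<in> test_functions"
  shows "partial i f \<in> test_functions"
proof -
  have "partial i f x = 0" if x: "x \<notin> closure {x. f x \<noteq> 0}" for x
  proof -
    have "((\<lambda>x. 0) has_derivative (\<lambda>h. 0)) (at x)" by simp
    then have "(f has_derivative (\<lambda>h. 0)) (at x)"
      by (rule has_derivative_transform_within_open[of _ _ _ _ "- closure {x. f x \<noteq> 0}"])
         (use x closure_subset[of "{x. f x \<noteq> 0}"] in auto)
    then show ?thesis using partialI by metis
  qed
  then have "{x. partial i f x \<noteq> 0} \<subseteq> closure {x. f x \<noteq> 0}" by auto
  moreover have "bounded (closure {x. f x \<noteq> 0})"
    using assms by (simp add: test_functions_iff bounded_closure)
  ultimately show ?thesis
    using assms by (auto simp: test_functions_iff intro: smooth_partial bounded_subset)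
qed

lemma test_bounded:
  assumes "f \<in> test_functions"
  shows "\<exists>R B. 0 \<le> R \<and> 0 \<le> B \<and> (\<forall>x. norm (f x) \<le> B * indicator (cball 0 R) x)"
proof -
  from assms obtain R where R: "R > 0" "\<And>x. f x \<noteq> 0 \<Longrightarrow> norm x \<le> R"
    unfolding test_functions_iff bounded_pos by blast
  have "compact (f ` cball 0 R)"
    using assms by (intro compact_continuous_image continuous_on_subset[OF test_continuous]) auto
  then have "bounded (f ` cball 0 R)" by (rule compact_imp_bounded)
  then obtain B where B: "0 < B" "\<And>x. x \<in> cball 0 R \<Longrightarrow> norm (f x) \<le> B"
    by (metis bounded_pos image_eqI)
  have "norm (f x) \<le> B * indicator (cball 0 R) x" for x
    using R(2)[of x] B(2)[of x] by (cases "x \<in> cball 0 R") auto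
  then show ?thesis using R(1) B(1) by (intro exI[of _ R] exI[of _ B]) simp
qed

lemma test_measurable: "f \<in> test_functions \<Longrightarrow> f \<in> borel_measurable borel"
  by (simp add: test_continuous borel_measurable_continuous_onI)

lemma integrable_indicator_cball: "integrable lborel (\<lambda>x::real^'n. B * indicator (cball 0 R) x :: real)"
  using emeasure_lborel_cball_finite[of "0::real^'n" R] by (auto simp: integrable_mult_right)

lemma test_integrable: 
  assumes "f \<in> test_functions"
  shows "integrable lborel f"
proof -
  obtain R B where "0 \<le> R" "0 \<le> B" and le: "\<And>x. norm (f x) \<le> B * indicator (cball 0 R) x"
    using test_bounded[OF assms] by blast
  have "AE x in lborel. norm (f x) \<le> norm (B * indicator (cball 0 R) x :: real)"
    by (intro AE_I2 order_trans[OF le]) simp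
  then show ?thesis using test_measurable[OF assms]
    by (intro Bochner_Integration.integrable_bound[OF integrable_indicator_cball[of B R]]) auto
qed

lemma ball_bump_test: "ball_bump a r k \<in> test_functions"
proof -
  have "x \<in> cball a \<bar>r\<bar>" if "ball_bump a r k x \<noteq> 0" for x
  proof -
    have "(x - a) \<bullet> (x - a) \<le> r\<^sup>2"
      using that by (auto simp: ball_bump_def exp_profile_def split: if_splits)
    then have "(norm (x - a))\<^sup>2 \<le> \<bar>r\<bar>\<^sup>2" by (simp add: power2_norm_eq_inner)
    then show ?thesis
      by (metis abs_ge_zero dist_commute dist_norm mem_cball power2_le_imp_le)
  qed
  then have "bounded {x. ball_bump a r k x \<noteq> 0}"
    by (intro bounded_subset[OF bounded_cball[of a "\<bar>r\<bar>"]]) auto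
  then show ?thesis by (simp add: test_functions_iff smooth_ball_bump)
qed

section \<open>Lebesgue spaces\<close>

text \<open>Convexity of the power: \<open>(x + y) / (a + b)\<close> is the mean of
  \<open>x / a\<close> and \<open>y / b\<close> with weights proportional to \<open>a\<close> and
  \<open>b\<close>. Integrated with \<open>a\<close>, \<open>b\<close> bounding two norms it becomes
  Minkowski's inequality.\<close>

lemma powr_add_le_weighted:
  fixes x y :: real
  assumes "0 < a" "0 < b" "0 \<le> x" "0 \<le> y" "1 \<le> p"
  shows "(x + y) powr p \<le> (a + b) powr p * (a / (a + b) * (x powr p / a powr p) + b / (a + b) * (y powr p / b powr p))"
proof -
  \<comment> \<open>Covers a zero argument of the convexity estimate, where only
    \<open>t powr p \<le> t\<close> for \<open>t \<le> 1\<close> is at stake.\<close>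
  have le: "(t * s) powr p \<le> t * s powr p" if "0 \<le> s" "0 < t" "t \<le> 1" for s t :: real
  proof -
    have "t powr p \<le> t powr 1" using that assms by (intro powr_mono') auto
    then have "t powr p * s powr p \<le> t powr 1 * s powr p" by (rule mult_right_mono) simp
    then show ?thesis using that by (simp add: powr_mult)
  qed
  define t where "t = a / (a + b)"
  have t: "0 < t" "t < 1" "1 - t = b / (a + b)" using assms by (auto simp: t_def field_simps)
  have conv: "(t * u + (1 - t) * v) powr p \<le> t * u powr p + (1 - t) * v powr p"
    if "0 \<le> u" "0 \<le> v" for u v
  proof (cases "u = 0 \<or> v = 0")
    case True
    then show ?thesis using le[of u t] le[of v "1 - t"] that t assms by auto
  next
    case False
    then show ?thesis
      using convex_onD[OF powr_convex[OF assms(5)], of t v u] that t(1,2) by (simp add: algebra_simps)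
  qed
  have "x + y = (a + b) * (t * (x / a) + (1 - t) * (y / b))"
    using assms t by (simp add: t_def distrib_left)
  then have "(x + y) powr p = (a + b) powr p * (t * (x / a) + (1 - t) * (y / b)) powr p"
    using assms t by (simp add: powr_mult)
  also have "\<dots> \<le> (a + b) powr p * (t * (x / a) powr p + (1 - t) * (y / b) powr p)"
    using assms by (intro mult_left_mono conv) auto
  finally show ?thesis using assms t by (simp add: t_def powr_divide)
qed

lemma Lp_norm_nonneg [simp]: "0 \<le> Lp_norm p f"
  by (simp add: Lp_norm_def)

lemma Lp_measurable: "f \<in> Lp p \<Longrightarrow> f \<in> borel_measurable lebesgue"
  by (simp add: Lp_def)

lemma Lp_cmult: "f \<in> Lp p \<Longrightarrow> (\<lambda>x. c * f x) \<in> Lp p"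
  by (auto simp: Lp_def norm_mult powr_mult)

lemma Lp_cong_AE:
  assumes "f \<in> Lp p" "AE x in lebesgue. f x = g x" "g \<in> borel_measurable lebesgue"
  shows "g \<in> Lp p"
proof -
  have "integrable lebesgue (\<lambda>x. norm (f x) powr p) = integrable lebesgue (\<lambda>x. norm (g x) powr p)"
    using assms by (intro integrable_cong_AE) (auto simp: Lp_def)
  then show ?thesis using assms by (simp add: Lp_def)
qed

lemma Lp_norm_cong_AE:
  assumes "f \<in> borel_measurable lebesgue" "g \<in> borel_measurable lebesgue" "AE x in lebesgue. f x = g x"
  shows "Lp_norm p f = Lp_norm p g"
  unfolding Lp_norm_def
  using assms by (intro arg_cong[where f="\<lambda>x. x powr (1 / p)"] integral_cong_AE) auto

lemma Lp_norm_minus_commute: "Lp_norm p (\<lambda>x. f x - g x) = Lp_norm p (\<lambda>x. g x - f x)"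
  by (simp add: Lp_norm_def norm_minus_commute)

section \<open>Minkowski's inequality, Fatou's lemma and completeness of \<open>Lp p\<close>\<close>

context
  fixes p :: real
  assumes p: "1 \<le> p"
begin

lemma Lp_norm_powr: "Lp_norm p f powr p = (LINT x|lebesgue. norm (f x) powr p)"
  using p by (simp add: Lp_norm_def powr_powr)

lemma Lp_norm_le_iff_integral:
  assumes "0 \<le> B"
  shows "Lp_norm p f \<le> B \<longleftrightarrow> (LINT x|lebesgue. norm (f x) powr p) \<le> B powr p"
  unfolding Lp_norm_powr[symmetric]
proof
  show "Lp_norm p f \<le> B" if "Lp_norm p f powr p \<le> B powr p"
    using powr_less_mono2[of p B "Lp_norm p f"] that assms p by linarith
qed (use p in \<open>simp add: powr_mono2\<close>)

text \<open>Non-integrable functions have Bochner integral 0, so a bound on \<open>Lp_norm\<close>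
  says nothing without membership. The nonnegative integral carries both facts in one inequality,
  the form that survives limits.\<close>

lemma Lp_norm_le_iff_nn_integral:
  assumes "0 \<le> B"
  shows "f \<in> Lp p \<and> Lp_norm p f \<le> B \<longleftrightarrow> f \<in> borel_measurable lebesgue \<and>
    (\<integral>\<^sup>+ x. ennreal (norm (f x) powr p) \<partial>lebesgue) \<le> ennreal (B powr p)"
proof (intro iffI conjI; elim conjE)
  assume f: "f \<in> Lp p" "Lp_norm p f \<le> B"
  then show "f \<in> borel_measurable lebesgue" by (simp add: Lp_def)
  show "(\<integral>\<^sup>+ x. ennreal (norm (f x) powr p) \<partial>lebesgue) \<le> ennreal (B powr p)"
    using f assms by (subst nn_integral_eq_integral) (auto simp: Lp_def Lp_norm_le_iff_integral)
next
  assume f: "f \<in> borel_measurable lebesgue"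
    "(\<integral>\<^sup>+ x. ennreal (norm (f x) powr p) \<partial>lebesgue) \<le> ennreal (B powr p)"
  have "integrable lebesgue (\<lambda>x. norm (f x) powr p)"
    using f by (intro integrableI_bounded) (auto simp: order_le_less_trans[OF _ ennreal_less_top])
  then show "f \<in> Lp p" using f by (simp add: Lp_def)
  show "Lp_norm p f \<le> B"
    unfolding Lp_norm_le_iff_integral[OF assms]
    using f \<open>integrable _ _\<close> assms by (subst (asm) nn_integral_eq_integral) auto
qed

lemma Lp_norm_cmult: "Lp_norm p (\<lambda>x. c * f x) = norm c * Lp_norm p f"
  using p by (simp add: Lp_norm_def norm_mult powr_mult powr_powr)

text \<open>The weights in \<open>powr_add_le_weighted\<close> must be positive while norms can
  vanish; the estimate is therefore proved for all strict upper bounds \<open>a\<close>,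
  \<open>b\<close> of the norms and then sharpened by letting them decrease.\<close>

lemma Lp_add_bounded:
  assumes f: "f \<in> Lp p" and g: "g \<in> Lp p"
  shows "(\<lambda>x. f x + g x) \<in> Lp p \<and> Lp_norm p (\<lambda>x. f x + g x) \<le> Lp_norm p f + Lp_norm p g"
proof -
  have *: "(\<lambda>x. f x + g x) \<in> Lp p \<and> Lp_norm p (\<lambda>x. f x + g x) \<le> a + b"
    if a: "Lp_norm p f < a" and b: "Lp_norm p g < b" for a b
  proof -
    have pos: "0 < a" "0 < b" using a b Lp_norm_nonneg order_le_less_trans by blast+
    let ?F = "\<lambda>x. norm (f x) powr p" and ?G = "\<lambda>x. norm (g x) powr p"
    let ?H = "\<lambda>x. (a + b) powr p * (a / (a + b) * (?F x / a powr p) + b / (a + b) * (?G x / b powr p))"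
    have int: "integrable lebesgue ?F" "integrable lebesgue ?G" using f g by (auto simp: Lp_def)
    have le: "norm (f x + g x) powr p \<le> ?H x" for x
      by (rule order_trans[OF powr_mono2[OF _ _ norm_triangle_ineq] powr_add_le_weighted])
         (use pos p in auto)
    have H: "integrable lebesgue ?H" using int by auto
    have "integrable lebesgue (\<lambda>x. norm (f x + g x) powr p)"
    proof (rule Bochner_Integration.integrable_bound[OF H])
      show "AE x in lebesgue. norm (norm (f x + g x) powr p) \<le> norm (?H x)"
        using le abs_ge_self order_trans by (intro AE_I2) (simp only: real_norm_def abs_of_nonneg powr_ge_zero, blast)
    qed (use f g in \<open>auto simp: Lp_def\<close>)
    moreover have "(LINT x|lebesgue. norm (f x + g x) powr p) \<le> (LINT x|lebesgue. ?H x)"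
      by (intro integral_mono calculation H le)
    moreover have "(LINT x|lebesgue. ?H x) \<le> (a + b) powr p"
    proof -
      have "(LINT x|lebesgue. ?F x) \<le> a powr p" "(LINT x|lebesgue. ?G x) \<le> b powr p"
        using a b pos by (simp_all add: Lp_norm_le_iff_integral[symmetric])
      then have "a / (a + b) * ((LINT x|lebesgue. ?F x) / a powr p) + b / (a + b) * ((LINT x|lebesgue. ?G x) / b powr p)
        \<le> a / (a + b) * 1 + b / (a + b) * 1"
        using pos by (intro add_mono mult_left_mono) auto
      also have "\<dots> = 1" using pos by (simp add: add_divide_distrib[symmetric])
      finally have fin: "(a + b) powr p * (a / (a + b) * ((LINT x|lebesgue. ?F x) / a powr p) + b / (a + b) * ((LINT x|lebesgue. ?G x) / b powr p))
        \<le> (a + b) powr p * 1" by (intro mult_left_mono) auto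
      have "(LINT x|lebesgue. ?H x) = (a + b) powr p * (a / (a + b) * ((LINT x|lebesgue. ?F x) / a powr p) + b / (a + b) * ((LINT x|lebesgue. ?G x) / b powr p))"
        using int by (subst integral_mult_right_zero, subst Bochner_Integration.integral_add) auto
      then show ?thesis using fin by (simp only: mult_1_right)
    qed
    ultimately have int': "integrable lebesgue (\<lambda>x. norm (f x + g x) powr p)"
      and le': "(LINT x|lebesgue. norm (f x + g x) powr p) \<le> (a + b) powr p" by linarith+
    then show ?thesis using f g pos
      by (simp only: Lp_norm_le_iff_integral[of "a + b"]) (auto simp: Lp_def)
  qed
  have "Lp_norm p (\<lambda>x. f x + g x) \<le> Lp_norm p f + Lp_norm p g + e" if "0 < e" for e
    using *[of "Lp_norm p f + e/2" "Lp_norm p g + e/2"] that by simp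
  then have "Lp_norm p (\<lambda>x. f x + g x) \<le> Lp_norm p f + Lp_norm p g" by (rule field_le_epsilon)
  then show ?thesis
    using *[of "Lp_norm p f + 1" "Lp_norm p g + 1"] by simp
qed

lemmas Lp_add = Lp_add_bounded[THEN conjunct1]
lemmas Lp_norm_add = Lp_add_bounded[THEN conjunct2]

lemma Lp_diff: "f \<in> Lp p \<Longrightarrow> g \<in> Lp p \<Longrightarrow> (\<lambda>x. f x - g x) \<in> Lp p"
  using Lp_add[of f "\<lambda>x. -1 * g x"] Lp_cmult[of g p "-1"] by simp

lemma Lp_norm_triangle:
  assumes "f \<in> Lp p" "g \<in> Lp p" "h \<in> Lp p"
  shows "Lp_norm p (\<lambda>x. f x - h x) \<le> Lp_norm p (\<lambda>x. f x - g x) + Lp_norm p (\<lambda>x. g x - h x)"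
  using Lp_norm_add[of "\<lambda>x. f x - g x" "\<lambda>x. g x - h x"] Lp_diff assms by auto

lemma Lp_norm_le_add_diff:
  assumes "f \<in> Lp p" "g \<in> Lp p"
  shows "Lp_norm p f \<le> Lp_norm p g + Lp_norm p (\<lambda>x. f x - g x)"
  using Lp_norm_add[of g "\<lambda>x. f x - g x"] Lp_diff assms by auto

lemma Lp_norm_0_AE:
  assumes "f \<in> Lp p" "Lp_norm p f \<le> 0"
  shows "AE x in lebesgue. f x = 0"
proof -
  have "(LINT x|lebesgue. norm (f x) powr p) \<le> 0"
    using assms Lp_norm_le_iff_integral[of 0 f] p by simp
  moreover have "0 \<le> (LINT x|lebesgue. norm (f x) powr p)" by simp
  ultimately have "(LINT x|lebesgue. norm (f x) powr p) = 0" by linarith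
  then have "AE x in lebesgue. norm (f x) powr p = 0"
    using assms by (subst (asm) integral_nonneg_eq_0_iff_AE) (auto simp: Lp_def)
  then show ?thesis by simp
qed

lemma Lp_Fatou:
  assumes u: "\<And>k. u k \<in> Lp p" "\<And>k. Lp_norm p (u k) \<le> B"
    and lim: "AE x in lebesgue. (\<lambda>k. u k x) \<longlonglongrightarrow> f x"
    and f: "f \<in> borel_measurable lebesgue"
  shows "f \<in> Lp p \<and> Lp_norm p f \<le> B"
proof -
  have B: "0 \<le> B" using u(2)[of 0] Lp_norm_nonneg order_trans by blast
  have [measurable]: "u k \<in> borel_measurable lebesgue" for k using u(1) Lp_measurable by blast
  have "AE x in lebesgue. ennreal (norm (f x) powr p) = liminf (\<lambda>k. ennreal (norm (u k x) powr p))"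
    using lim
  proof eventually_elim
    case (elim x)
    have "(\<lambda>k. norm (u k x) powr p) \<longlonglongrightarrow> norm (f x) powr p"
      using p elim by (intro tendsto_powr2 tendsto_norm) auto
    then show ?case by (intro lim_imp_Liminf[symmetric] tendsto_ennrealI) auto
  qed
  then have "(\<integral>\<^sup>+ x. ennreal (norm (f x) powr p) \<partial>lebesgue) =
      (\<integral>\<^sup>+ x. liminf (\<lambda>k. ennreal (norm (u k x) powr p)) \<partial>lebesgue)"
    by (rule nn_integral_cong_AE)
  also have "\<dots> \<le> liminf (\<lambda>k. \<integral>\<^sup>+ x. ennreal (norm (u k x) powr p) \<partial>lebesgue)"
    by (intro nn_integral_liminf) auto
  also have "\<dots> \<le> liminf (\<lambda>k. ennreal (B powr p))"
    using u B by (intro Liminf_mono always_eventually allI) (simp add: Lp_norm_le_iff_nn_integral[THEN iffD1])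
  also have "\<dots> = ennreal (B powr p)" by (simp add: Liminf_const)
  finally show ?thesis using f B by (simp add: Lp_norm_le_iff_nn_integral)
qed

text \<open>With geometric rate, the weighted increments \<open>2^k * (X (Suc k) - X k)\<close> are almost
  everywhere \<open>p\<close>-summable, so the sequence converges almost everywhere.\<close>

lemma Lp_complete:
  assumes X: "\<And>k. X k \<in> Lp p"
    and cauchy: "\<And>j k. k \<le> j \<Longrightarrow> Lp_norm p (\<lambda>x. X j x - X k x) \<le> (1/4) ^ k"
  obtains g where "g \<in> Lp p" "\<And>k. Lp_norm p (\<lambda>x. X k x - g x) \<le> (1/4) ^ k"
proof -
  have [measurable]: "X k \<in> borel_measurable lebesgue" for k using X Lp_measurable by blast
  \<comment> \<open>The weight \<open>2 ^ k\<close> uses up half of the rate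
    \<open>(1/4) ^ k\<close>: the norms of \<open>d k\<close> remain summable, and a pointwise bound
    on \<open>d k x\<close> returns increments of size \<open>(1/2) ^ k\<close>.\<close>
  define d where "d k x = of_real (2 ^ k) * (X (Suc k) x - X k x)" for k x
  have [measurable]: "d k \<in> borel_measurable lebesgue" for k unfolding d_def by measurable
  have d: "d k \<in> Lp p \<and> Lp_norm p (d k) \<le> (1/2) ^ k" for k
  proof -
    have "Lp_norm p (d k) = 2 ^ k * Lp_norm p (\<lambda>x. X (Suc k) x - X k x)"
      unfolding d_def by (simp add: Lp_norm_cmult norm_power)
    also have "\<dots> \<le> 2 ^ k * (1/4) ^ k" by (intro mult_left_mono cauchy) auto
    also have "\<dots> = (1/2) ^ k" by (simp add: power_mult_distrib[symmetric])
    finally show ?thesis unfolding d_def using Lp_cmult[OF Lp_diff[OF X X]] by blast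
  qed
  have le: "(\<integral>\<^sup>+ x. ennreal (norm (d k x) powr p) \<partial>lebesgue) \<le> ennreal ((1/2) ^ k)" for k
  proof -
    have "(\<integral>\<^sup>+ x. ennreal (norm (d k x) powr p) \<partial>lebesgue) \<le> ennreal (((1/2) ^ k) powr p)"
      using Lp_norm_le_iff_nn_integral[of "(1/2)^k" "d k"] d by simp
    also have "((1/2::real) ^ k) powr p \<le> (1/2) ^ k"
      using powr_mono'[of 1 p "(1/2::real)^k"] p by (simp add: power_le_one)
    finally show ?thesis by (simp add: ennreal_leI)
  qed
  have "(\<integral>\<^sup>+ x. (\<Sum>k. ennreal (norm (d k x) powr p)) \<partial>lebesgue) =
      (\<Sum>k. \<integral>\<^sup>+ x. ennreal (norm (d k x) powr p) \<partial>lebesgue)"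
    by (intro nn_integral_suminf) auto
  also have "\<dots> \<le> (\<Sum>k. ennreal ((1/2) ^ k))" by (intro suminf_le le) auto
  also have "\<dots> < \<infinity>"
    by (subst suminf_ennreal2) (auto intro: summable_geometric)
  finally have "AE x in lebesgue. (\<Sum>k. ennreal (norm (d k x) powr p)) \<noteq> \<infinity>"
    by (intro nn_integral_noteq_infinite) auto
  then have conv: "AE x in lebesgue. convergent (\<lambda>k. X k x)"
  proof eventually_elim
    case (elim x)
    have "summable (\<lambda>k. norm (d k x) powr p)"
      using elim by (intro summable_suminf_not_top) auto
    then have "(\<lambda>k. norm (d k x) powr p) \<longlonglongrightarrow> 0" by (rule summable_LIMSEQ_zero)
    then have "eventually (\<lambda>k. norm (d k x) powr p < 1) sequentially"
      by (rule order_tendstoD) simp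
    then have "eventually (\<lambda>k. norm (X (Suc k) x - X k x) \<le> (1/2) ^ k) sequentially"
    proof eventually_elim
      case (elim k)
      have "norm (d k x) \<le> 1"
      proof (rule ccontr)
        assume "\<not> norm (d k x) \<le> 1"
        then have "1 \<le> norm (d k x) powr p" using p by (intro ge_one_powr_ge_zero) auto
        then show False using elim by simp
      qed
      then have "2 ^ k * norm (X (Suc k) x - X k x) \<le> 1"
        by (simp add: d_def norm_mult norm_power del: right_diff_distrib)
      then show ?case by (simp add: power_one_over field_simps)
    qed
    then have "summable (\<lambda>k. X (Suc k) x - X k x)"
      by (rule summable_comparison_test_ev) (auto intro: summable_geometric)
    then have "convergent (\<lambda>k. \<Sum>i<k. X (Suc i) x - X i x)" by (rule summable_iff_convergent[THEN iffD1])
    then have "convergent (\<lambda>k. X k x - X 0 x)"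
      by (simp only: sum_lessThan_telescope[of "\<lambda>k. X k x"])
    then have "convergent (\<lambda>k. (X k x - X 0 x) + X 0 x)" by (intro convergent_add convergent_const)
    then show ?case by simp
  qed
  define g where "g x = lim (\<lambda>k. X k x)" for x
  have [measurable]: "g \<in> borel_measurable lebesgue"
    unfolding g_def by (rule borel_measurable_lim_metric) measurable
  have lim: "AE x in lebesgue. (\<lambda>k. X k x) \<longlonglongrightarrow> g x"
    using conv unfolding g_def by eventually_elim (rule convergent_LIMSEQ_iff[THEN iffD1])
  \<comment> \<open>With \<open>k\<close> fixed and \<open>j\<close> growing, Fatou transfers the
    Cauchy rate to the limit; membership of \<open>g\<close> is then read off from
    \<open>X 0 x - (X 0 x - g x)\<close>.\<close>
  have *: "(\<lambda>x. X k x - g x) \<in> Lp p \<and> Lp_norm p (\<lambda>x. X k x - g x) \<le> (1/4) ^ k" for k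
  proof (rule Lp_Fatou[where u="\<lambda>j x. X k x - X (j + k) x"])
    show "AE x in lebesgue. (\<lambda>j. X k x - X (j + k) x) \<longlonglongrightarrow> X k x - g x"
      using lim by eventually_elim (intro tendsto_diff tendsto_const LIMSEQ_ignore_initial_segment)
  qed (use X in \<open>auto intro: Lp_diff simp: cauchy Lp_norm_minus_commute[of p "X k"]\<close>)
  have "(\<lambda>x. X 0 x - (X 0 x - g x)) \<in> Lp p" by (rule Lp_diff) (use * X in auto)
  then show ?thesis using that[of g] * by simp
qed

text \<open>The limit inherits the pointwise bound \<open>w\<close>, so the differences are
  dominated by \<open>2 * w\<close> and the scalar theorem applies to their p-th powers.\<close>

lemma Lp_dominated_convergence:
  fixes w :: "real ^ 'n \<Rightarrow> real" and f :: "real ^ 'n \<Rightarrow> complex"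
  assumes u [measurable]: "\<And>k. u k \<in> borel_measurable lebesgue"
    and f [measurable]: "f \<in> borel_measurable lebesgue"
    and lim: "\<And>x. (\<lambda>k. u k x) \<longlonglongrightarrow> f x"
    and w: "integrable lebesgue (\<lambda>x. w x powr p)" 
    and le: "\<And>k x. norm (u k x) \<le> w x"
  shows "(\<lambda>k. Lp_norm p (\<lambda>x. f x - u k x)) \<longlonglongrightarrow> 0" "u k \<in> Lp p" "f \<in> Lp p"
proof -
  have fle: "norm (f x) \<le> w x" for x
    using lim[of x] le by (intro LIMSEQ_le_const2[OF tendsto_norm]) auto
  have w0: "0 \<le> w x" for x using le[of 0 x] norm_ge_zero order_trans by blast
  show "u k \<in> Lp p" unfolding Lp_def using p le w0
    by (auto intro!: Bochner_Integration.integrable_bound[OF w] powr_mono2 AE_I2)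
  show "f \<in> Lp p" unfolding Lp_def using p fle w0
    by (auto intro!: Bochner_Integration.integrable_bound[OF w] powr_mono2 AE_I2)
  have "(\<lambda>k. LINT x|lebesgue. norm (f x - u k x) powr p) \<longlonglongrightarrow> integral\<^sup>L (lebesgue :: (real ^ 'n) measure) (\<lambda>x. 0)"
  proof (rule integral_dominated_convergence)
    show "integrable lebesgue (\<lambda>x. 2 powr p * w x powr p)" using w by simp
    show "AE x in lebesgue. (\<lambda>k. norm (f x - u k x) powr p) \<longlonglongrightarrow> 0"
    proof (intro AE_I2)
      fix x
      have "(\<lambda>k. norm (f x - u k x)) \<longlonglongrightarrow> norm (f x - f x)"
        by (intro tendsto_norm tendsto_diff tendsto_const lim)
      then have "(\<lambda>k. norm (f x - u k x) powr p) \<longlonglongrightarrow> 0 powr p"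
        using p by (intro tendsto_powr2) auto
      then show "(\<lambda>k. norm (f x - u k x) powr p) \<longlonglongrightarrow> 0" using p by simp
    qed
    show "AE x in lebesgue. norm (norm (f x - u k x) powr p) \<le> 2 powr p * w x powr p" for k
    proof (intro AE_I2)
      fix x
      have "norm (f x - u k x) \<le> 2 * w x"
        using norm_triangle_ineq4[of "f x" "u k x"] fle[of x] le[of k x] by linarith
      then show "norm (norm (f x - u k x) powr p) \<le> 2 powr p * w x powr p"
        using p w0 by (simp add: powr_mult[symmetric] powr_mono2)
    qed
  qed auto
  then have "(\<lambda>k. (LINT x|lebesgue. norm (f x - u k x) powr p) powr (1 / p)) \<longlonglongrightarrow> 0 powr (1/p)"
    using p by (intro tendsto_powr2) (auto intro!: always_eventually)
  then show "(\<lambda>k. Lp_norm p (\<lambda>x. f x - u k x)) \<longlonglongrightarrow> 0"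
    by (simp add: Lp_norm_def)
qed

lemma test_Lp: 
  fixes f :: "real ^ 'n \<Rightarrow> complex"
  assumes "f \<in> test_functions"
  shows "f \<in> Lp p"
proof -
  obtain R B where RB: "0 \<le> R" "0 \<le> B" "\<And>x. norm (f x) \<le> B * indicator (cball 0 R) x"
    using test_bounded[OF assms] by blast
  have [measurable]: "f \<in> borel_measurable lebesgue"
    using test_measurable[OF assms] by (simp add: measurable_completion)
  have int: "integrable lebesgue (\<lambda>x::real^'n. B powr p * indicator (cball 0 R) x)"
    by (rule integrable_completion[THEN iffD2, OF borel_measurable_integrable integrable_indicator_cball])
       (rule integrable_indicator_cball)
  have le: "norm (f x) powr p \<le> B powr p * indicator (cball 0 R) x" for x
  proof (cases "x \<in> cball 0 R")
    case True
    then have "norm (f x) powr p \<le> B powr p" using RB(3)[of x] p by (intro powr_mono2) auto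
    then show ?thesis using True by simp
  next
    case False
    then show ?thesis using RB(3)[of x] by simp
  qed
  have "norm (norm (f x) powr p) \<le> norm (B powr p * indicator (cball 0 R) x)" for x
    using le[of x] by simp
  then have "integrable lebesgue (\<lambda>x. norm (f x) powr p)"
    by (rule Bochner_Integration.integrable_bound[OF int _ AE_I2, rotated]) measurable
  then show ?thesis by (simp add: Lp_def)
qed

section \<open>Density of the test functions in \<open>Lp p\<close>\<close>

definition approximable :: "(real ^ 'n \<Rightarrow> complex) \<Rightarrow> bool" where
  "approximable f \<longleftrightarrow> f \<in> Lp p \<and> (\<forall>e>0. \<exists>\<phi>\<in>test_functions. Lp_norm p (\<lambda>x. f x - \<phi> x) < e)"

lemma approximableD:
  "approximable f \<Longrightarrow> 0 < e \<Longrightarrow> \<exists>\<phi>\<in>test_functions. Lp_norm p (\<lambda>x. f x - \<phi> x) < e"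
  by (simp add: approximable_def)

lemma approximable_test: "f \<in> test_functions \<Longrightarrow> approximable f"
  unfolding approximable_def
proof (intro conjI allI impI bexI[of _ f])
  show "Lp_norm p (\<lambda>x. f x - f x) < e" if "0 < e" for e
    using that p by (simp add: Lp_norm_def)
qed (auto intro: test_Lp)

lemma approximable_limit:
  assumes u: "\<And>k. approximable (u k)" and f: "f \<in> Lp p"
    and lim: "(\<lambda>k. Lp_norm p (\<lambda>x. f x - u k x)) \<longlonglongrightarrow> 0"
  shows "approximable f"
  unfolding approximable_def
proof (intro conjI allI impI f)
  fix e :: real assume e: "0 < e"
  have "eventually (\<lambda>k. Lp_norm p (\<lambda>x. f x - u k x) < e / 2) sequentially"
    using lim e by (intro order_tendstoD) auto
  then obtain k where k: "Lp_norm p (\<lambda>x. f x - u k x) < e / 2"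
    using eventually_sequentially by auto
  obtain \<phi> where \<phi>: "\<phi> \<in> test_functions" "Lp_norm p (\<lambda>x. u k x - \<phi> x) < e / 2"
    using approximableD[OF u[of k], of "e / 2"] e by auto
  have "Lp_norm p (\<lambda>x. f x - \<phi> x) < e"
    using Lp_norm_triangle[OF f _ test_Lp[OF \<phi>(1)], of "u k"] u[of k] k \<phi>(2)
    unfolding approximable_def by simp
  then show "\<exists>\<phi>\<in>test_functions. Lp_norm p (\<lambda>x. f x - \<phi> x) < e" using \<phi>(1) by blast
qed

lemma approximable_add:
  assumes "approximable f" "approximable g"
  shows "approximable (\<lambda>x. f x + g x)"
  unfolding approximable_def
proof (intro conjI allI impI)
  have f: "f \<in> Lp p" and g: "g \<in> Lp p" using assms by (auto simp: approximable_def)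
  then show "(\<lambda>x. f x + g x) \<in> Lp p" by (rule Lp_add)
  fix e :: real assume "0 < e"
  then have e: "0 < e / 2" by simp
  obtain \<phi> where \<phi>: "\<phi> \<in> test_functions" "Lp_norm p (\<lambda>x. f x - \<phi> x) < e / 2"
    using approximableD[OF assms(1) e] by blast
  obtain \<psi> where \<psi>: "\<psi> \<in> test_functions" "Lp_norm p (\<lambda>x. g x - \<psi> x) < e / 2"
    using approximableD[OF assms(2) e] by blast
  note * = \<phi> \<psi>
  have "Lp_norm p (\<lambda>x. (f x - \<phi> x) + (g x - \<psi> x)) < e"
    using Lp_norm_add[OF Lp_diff[OF f test_Lp[OF *(1)]] Lp_diff[OF g test_Lp[OF *(3)]]] * by simp
  then show "\<exists>\<phi>\<in>test_functions. Lp_norm p (\<lambda>x. f x + g x - \<phi> x) < e"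
    using test_add[OF *(1) *(3)] by (intro bexI[of _ "\<lambda>x. \<phi> x + \<psi> x"]) (auto simp: algebra_simps)
qed

lemma approximable_cmult:
  assumes "approximable f"
  shows "approximable (\<lambda>x. c * f x)"
proof (cases "c = 0")
  case True
  then show ?thesis using approximable_test[OF test_zero] by simp
next
  case False
  have f: "f \<in> Lp p" using assms by (auto simp: approximable_def)
  show ?thesis unfolding approximable_def
  proof (intro conjI allI impI)
    show "(\<lambda>x. c * f x) \<in> Lp p" by (intro Lp_cmult f)
    fix e :: real assume "0 < e"
    then obtain \<phi> where \<phi>: "\<phi> \<in> test_functions" "Lp_norm p (\<lambda>x. f x - \<phi> x) < e / norm c"
      using approximableD[OF assms, of "e / norm c"] False by auto
    have "Lp_norm p (\<lambda>x. c * (f x - \<phi> x)) < e"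
      using \<phi>(2) False by (simp add: Lp_norm_cmult pos_less_divide_eq mult.commute del: right_diff_distrib)
    then show "\<exists>\<phi>\<in>test_functions. Lp_norm p (\<lambda>x. c * f x - \<phi> x) < e"
      using test_cmult[OF \<phi>(1)] by (intro bexI[of _ "\<lambda>x. c * \<phi> x"]) (auto simp: algebra_simps)
  qed
qed

lemma approximable_sum:
  "(\<And>i. i \<in> I \<Longrightarrow> approximable (f i)) \<Longrightarrow> approximable (\<lambda>x. \<Sum>i\<in>I. f i x)"
proof (induction I rule: infinite_finite_induct)
  case (insert i I)
  then show ?case using approximable_add[of "f i" "\<lambda>x. \<Sum>i\<in>I. f i x"] by simp
qed (simp_all add: approximable_test[OF test_zero])

text \<open>If \<open>U\<close> is the union of balls \<open>B j\<close> carrying bumps \<open>\<psi> j\<close> with values in \<open>[0, 1)\<close>, then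
  \<open>1 - (\<Prod>j\<le>k. (1 - \<psi> j) ^ k)\<close> converges to the indicator of \<open>U\<close>; no plateau functions are needed.\<close>

lemma approximable_indicator_open:
  fixes U :: "(real ^ 'n) set"
  assumes U: "open U" "emeasure lebesgue U < \<infinity>"
  shows "approximable (\<lambda>x. indicator U x)"
proof (cases "U = {}")
  case True
  then show ?thesis using approximable_test[OF test_zero] by simp
next
  case False
  define F where "F = {ball a r | a r. 0 < r \<and> ball a r \<subseteq> U}"
  \<comment> \<open>A countable subcover can be enumerated, so that finite products along the
    enumeration exhaust it.\<close>
  obtain F' where F': "F' \<subseteq> F" "countable F'" "\<Union>F' = \<Union>F"
    by (rule Lindelof[of F]) (auto simp: F_def)
  have UF: "\<Union>F = U"
  proof
    show "U \<subseteq> \<Union>F"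
    proof
      fix x assume "x \<in> U"
      then obtain r where "0 < r" "ball x r \<subseteq> U" using U(1) open_contains_ball by blast
      then show "x \<in> \<Union>F" using centre_in_ball unfolding F_def by blast
    qed
  qed (auto simp: F_def)
  then have "F' \<noteq> {}" using F' False by auto
  define b where "b = from_nat_into F'"
  have b: "range b = F'" unfolding b_def using F'(2) \<open>F' \<noteq> {}\<close> by (simp add: range_from_nat_into)
  have "\<exists>a r. b j = ball a r \<and> 0 < r" for j
    using b F'(1) unfolding F_def by blast
  then obtain a r where ar: "\<And>j. b j = ball (a j) (r j)" "\<And>j. 0 < r j" by metis
  have U_eq: "U = (\<Union>j. ball (a j) (r j))" using UF F'(3) b ar(1) by auto
  define s where "s j x = exp_profile 0 ((r j)\<^sup>2 - (x - a j) \<bullet> (x - a j))" for j x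
  have s01: "0 \<le> s j x" "s j x < 1" for j x by (auto simp: s_def exp_profile_def)
  have s0: "s j x = 0 \<longleftrightarrow> x \<notin> ball (a j) (r j)" for j x
  proof -
    have "x \<in> ball (a j) (r j) \<longleftrightarrow> (norm (x - a j))\<^sup>2 < (r j)\<^sup>2"
      using ar(2)[of j] power_mono_iff[of "r j" "norm (x - a j)" 2] norm_minus_commute[of x "a j"]
      by (auto simp: dist_norm not_less[symmetric])
    then show ?thesis by (auto simp: s_def exp_profile_def power2_norm_eq_inner)
  qed
  define v where "v k x = 1 - (\<Prod>j\<le>k. (1 - s j x) ^ k)" for k x
  have pr: "0 \<le> (\<Prod>j\<le>k. (1 - s j x) ^ k)" "(\<Prod>j\<le>k. (1 - s j x) ^ k) \<le> 1" for k x
    using s01[of _ x] by (auto intro!: prod_nonneg prod_le_1 power_le_one simp: less_imp_le)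
  have v_le: "norm (complex_of_real (v k x)) \<le> indicator U x" for k x
  proof (cases "x \<in> U")
    case False
    then have "s j x = 0" for j using s0 U_eq by auto
    then show ?thesis by (simp add: v_def)
  qed (use pr[of x k] in \<open>simp add: v_def norm_of_real del: of_real_diff of_real_prod\<close>)
  have v_lim: "(\<lambda>k. complex_of_real (v k x)) \<longlonglongrightarrow> indicator U x" for x
  proof (cases "x \<in> U")
    case True
    then obtain j where "x \<in> ball (a j) (r j)" using U_eq by auto
    then have j: "0 < s j x" using s0[of j x] s01[of j x] by auto
    have "(\<lambda>k. \<Prod>j\<le>k. (1 - s j x) ^ k) \<longlonglongrightarrow> 0"
    proof (rule tendsto_sandwich[of "\<lambda>_. 0" _ _ "\<lambda>k. (1 - s j x) ^ k"])
      show "(\<lambda>k. (1 - s j x) ^ k) \<longlonglongrightarrow> 0"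
        using j s01[of j x] by (intro LIMSEQ_power_zero) auto
      \<comment> \<open>Once \<open>k\<close> reaches \<open>j\<close>, the factor of the ball
        containing \<open>x\<close> occurs in the product, and all the other factors are at most
        1.\<close>
      show "eventually (\<lambda>k. (\<Prod>j\<le>k. (1 - s j x) ^ k) \<le> (1 - s j x) ^ k) sequentially"
        using eventually_ge_at_top[of j]
      proof eventually_elim
        case (elim k)
        have "(\<Prod>j\<le>k. (1 - s j x) ^ k) = (1 - s j x) ^ k * (\<Prod>i\<in>{..k}-{j}. (1 - s i x) ^ k)"
          using elim by (intro prod.remove) auto
        also have "\<dots> \<le> (1 - s j x) ^ k * 1"
          using s01[of _ x] by (intro mult_left_mono prod_le_1) (auto intro!: power_le_one simp: less_imp_le)
        finally show ?case by simp
      qed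
    qed (use pr in \<open>auto intro!: always_eventually\<close>)
    then have "(\<lambda>k. v k x) \<longlonglongrightarrow> 1 - 0" unfolding v_def by (intro tendsto_diff tendsto_const)
    then show ?thesis using True tendsto_of_real[where 'a=complex] by fastforce
  next
    case False
    then show ?thesis using v_le[of _ x] by simp
  qed
  have v_eq: "(\<lambda>x. complex_of_real (v k x)) = (\<lambda>x. 1 - (\<Prod>j\<le>k. (1 - ball_bump (a j) (r j) 0 x) ^ k))" for k
    by (simp add: v_def s_def ball_bump_def)
  have v_test: "(\<lambda>x. complex_of_real (v k x)) \<in> test_functions" for k
  proof -
    have "smooth (\<lambda>x. complex_of_real (v k x))" unfolding v_eq
      by (intro smooth_diff smooth_const smooth_prod smooth_power smooth_ball_bump)
    moreover have "{x. v k x \<noteq> 0} \<subseteq> (\<Union>j\<le>k. ball (a j) (r j))"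
    proof
      fix x assume x: "x \<in> {x. v k x \<noteq> 0}"
      show "x \<in> (\<Union>j\<le>k. ball (a j) (r j))"
      proof (rule ccontr)
        assume "\<not> ?thesis"
        then have "s j x = 0" if "j \<le> k" for j using s0 that by auto
        then show False using x by (simp add: v_def)
      qed
    qed
    then have "bounded {x. v k x \<noteq> 0}" by (rule bounded_subset[rotated]) auto
    ultimately show ?thesis by (simp add: test_functions_iff)
  qed
  have [measurable]: "U \<in> sets lebesgue" using U(1) by (simp add: borel_open sets_completionI_sets)
  have "integrable lebesgue (\<lambda>x. indicator U x :: real)" using U(2) by auto
  moreover have "(\<lambda>x. indicator U x powr p) = (indicator U :: _ \<Rightarrow> real)"
    by (auto simp: indicator_def)
  ultimately have w: "integrable lebesgue (\<lambda>x. indicator U x powr p)" by simp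
  have meas: "(\<lambda>x. complex_of_real (v k x)) \<in> borel_measurable lebesgue" for k
    using test_Lp[OF v_test] Lp_measurable by blast
  note dc = Lp_dominated_convergence[OF meas _ v_lim w v_le]
  show ?thesis
    by (rule approximable_limit[OF approximable_test[OF v_test]]) (rule dc; measurable)+
qed

text \<open>Outer regularity: for an open superset \<open>U k\<close> the p-th power of the
  difference of indicators is the indicator of \<open>U k - E\<close>, so the norm is the p-th root
  of a measure that tends to 0.\<close>

lemma approximable_indicator:
  fixes E :: "(real ^ 'n) set"
  assumes E [measurable]: "E \<in> sets lebesgue" and fin: "emeasure lebesgue E < \<infinity>"
  shows "approximable (\<lambda>x. indicator E x)"
proof -
  have "\<exists>U. open U \<and> E \<subseteq> U \<and> emeasure lebesgue (U - E) < ennreal (inverse (real (Suc k)))" for k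
    using sets_lebesgue_outer_open[OF E, of "inverse (real (Suc k))"] by (metis inverse_positive_iff_positive of_nat_0_less_iff zero_less_Suc)
  then obtain U where U: "\<And>k. open (U k)" "\<And>k. E \<subseteq> U k"
    "\<And>k. emeasure lebesgue (U k - E) < ennreal (inverse (real (Suc k)))" by metis
  have [measurable]: "U k \<in> sets lebesgue" for k using U(1) by (simp add: borel_open sets_completionI_sets)
  have finU: "emeasure lebesgue (U k) < \<infinity>" for k
  proof -
    have "emeasure lebesgue (U k) \<le> emeasure lebesgue E + emeasure lebesgue (U k - E)"
      using U(2)[of k] by (intro order_trans[OF _ emeasure_subadditive] emeasure_mono) auto
    also have "\<dots> < \<infinity>" using fin U(3)[of k] by (auto simp: less_top[symmetric] top_unique)
    finally show ?thesis .
  qed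
  show ?thesis
  proof (rule approximable_limit[OF approximable_indicator_open[OF U(1) finU]])
    have "integrable lebesgue (\<lambda>x. indicator E x :: real)" using fin by auto
    moreover have "(\<lambda>x. norm (indicator E x :: complex) powr p) = (indicator E :: _ \<Rightarrow> real)"
      by (auto simp: indicator_def)
    ultimately show "(\<lambda>x. indicator E x) \<in> Lp p" by (simp add: Lp_def)
    have le: "Lp_norm p (\<lambda>x. indicator E x - indicator (U k) x) \<le> inverse (real (Suc k)) powr (1 / p)" for k
    proof -
      have "(\<lambda>x. norm (indicator E x - indicator (U k) x :: complex) powr p) = indicator (U k - E)"
        using U(2)[of k] p by (auto simp: indicator_def fun_eq_iff)
      then have "Lp_norm p (\<lambda>x. indicator E x - indicator (U k) x) = measure lebesgue (U k - E) powr (1 / p)"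
        unfolding Lp_norm_def by simp
      also have "measure lebesgue (U k - E) \<le> inverse (real (Suc k))"
        unfolding measure_def using U(3)[of k]
        by (intro enn2real_leI) (auto simp: less_imp_le)
      then have "measure lebesgue (U k - E) powr (1 / p) \<le> inverse (real (Suc k)) powr (1 / p)"
        using p by (intro powr_mono2) auto
      finally show ?thesis .
    qed
    have "(\<lambda>k. inverse (real (Suc k)) powr (1 / p)) \<longlonglongrightarrow> 0 powr (1 / p)"
      using p by (intro tendsto_powr2 LIMSEQ_inverse_real_of_nat) (auto intro!: always_eventually)
    then have "(\<lambda>k. inverse (real (Suc k)) powr (1 / p)) \<longlonglongrightarrow> 0" by simp
    then show "(\<lambda>k. Lp_norm p (\<lambda>x. indicator E x - indicator (U k) x)) \<longlonglongrightarrow> 0"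
      by (rule tendsto_sandwich[OF always_eventually always_eventually tendsto_const, rotated 2])
         (use le in simp_all)
  qed
qed

lemma approximable_Lp:
  assumes "f \<in> Lp p"
  shows "approximable f"
proof -
  have [measurable]: "f \<in> borel_measurable lebesgue" using assms Lp_measurable by blast
  obtain s where s: "\<And>i. simple_function lebesgue (s i)" "\<And>x. (\<lambda>i. s i x) \<longlonglongrightarrow> f x"
    "\<And>i x. norm (s i x) \<le> 2 * norm (f x)"
    using borel_measurable_implies_sequence_metric[of f lebesgue 0] by (auto simp: dist_norm)
  have [measurable]: "s i \<in> borel_measurable lebesgue" for i
    using s(1) borel_measurable_simple_function by blast
  have int: "integrable lebesgue (\<lambda>x. norm (f x) powr p)" using assms by (simp add: Lp_def)
  then have "integrable lebesgue (\<lambda>x. 2 powr p * norm (f x) powr p)" by simp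
  then have w: "integrable lebesgue (\<lambda>x. (2 * norm (f x)) powr p)" by (simp add: powr_mult)
  have meas: "s i \<in> borel_measurable lebesgue" for i by measurable
  note dc = Lp_dominated_convergence[of s, OF meas _ s(2) w s(3)]
  have "approximable (s i)" for i
  proof -
    have fin: "finite (range (s i))" using simple_functionD(1)[OF s(1)] by simp
    \<comment> \<open>Chebyshev's inequality: the indicator of this level set is at most
      \<open>norm (s i x) powr p / norm y powr p\<close>. The level set of 0 can have infinite
      measure and is left out of the sum below.\<close>
    have lev: "emeasure lebesgue (s i -` {y}) < \<infinity>" if "y \<noteq> 0" for y
    proof -
      have "s i \<in> Lp p" by (rule dc) measurable
      then have "integrable lebesgue (\<lambda>x. norm (s i x) powr p)" by (simp add: Lp_def)
      from integrable_mult_right[OF this, of "inverse (norm y powr p)"]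
      have "integrable lebesgue (\<lambda>x. inverse (norm y powr p) * norm (s i x) powr p)" by simp
      then have "integrable lebesgue (\<lambda>x. indicator (s i -` {y}) x :: real)"
      proof (rule Bochner_Integration.integrable_bound)
        show "AE x in lebesgue. norm (indicator (s i -` {y}) x :: real) \<le> norm (inverse (norm y powr p) * norm (s i x) powr p)"
          using that by (intro AE_I2) (auto simp: indicator_def)
        have "s i -` {y} \<in> sets lebesgue" using simple_functionD(2)[OF s(1), of i "{y}"] by simp
        then show "(\<lambda>x. indicator (s i -` {y}) x :: real) \<in> borel_measurable lebesgue" by measurable
      qed
      then show ?thesis by (auto simp: integrable_indicator_iff)
    qed
    have "(\<lambda>x. \<Sum>y\<in>range (s i) - {0}. y * indicator (s i -` {y}) x) = s i"
    proof
      fix x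
      have "(\<Sum>y\<in>range (s i) - {0}. y * indicator (s i -` {y}) x) = (\<Sum>y\<in>range (s i) - {0}. if y = s i x then y else 0)"
        by (intro sum.cong) (auto simp: indicator_def)
      also have "\<dots> = s i x" using fin by (simp add: sum.delta)
      finally show "(\<Sum>y\<in>range (s i) - {0}. y * indicator (s i -` {y}) x) = s i x" .
    qed
    moreover have "approximable (\<lambda>x. \<Sum>y\<in>range (s i) - {0}. y * indicator (s i -` {y}) x)"
      using simple_functionD(2)[OF s(1), of i]
      by (intro approximable_sum approximable_cmult approximable_indicator lev) auto
    ultimately show ?thesis by simp
  qed
  then show ?thesis
    by (rule approximable_limit[OF _ assms]) (rule dc; measurable)
qed

lemma test_dense:
  assumes "f \<in> Lp p" "0 < e"
  obtains \<phi> where "\<phi> \<in> test_functions" "Lp_norm p (\<lambda>x. f x - \<phi> x) < e"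
  using approximable_Lp[OF assms(1)] assms(2) unfolding approximable_def by blast

end

section \<open>Integration over Euclidean space\<close>

lemma integrable_pair_bounded:
  fixes F :: "'a::euclidean_space \<times> 'b::euclidean_space \<Rightarrow> complex"
  assumes F: "F \<in> borel_measurable (lborel \<Otimes>\<^sub>M lborel)"
    and a: "integrable lborel a" and b: "integrable lborel b"
    and le: "\<And>x y. norm (F (x, y)) \<le> a x * b y"
  shows "integrable (lborel \<Otimes>\<^sub>M lborel) F"
proof -
  have [measurable]: "a \<in> borel_measurable borel" "b \<in> borel_measurable borel"
    using borel_measurable_integrable[OF a] borel_measurable_integrable[OF b] by simp_all
  have "integrable (lborel \<Otimes>\<^sub>M lborel) (\<lambda>(x, y). a x * b y)"
  proof (rule lborel_pair.Fubini_integrable)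
    show "integrable lborel (\<lambda>x. LINT y|lborel. norm (case (x, y) of (x, y) \<Rightarrow> a x * b y))"
      using a by (simp add: abs_mult)
  qed (use b in auto)
  then show ?thesis
    by (rule Bochner_Integration.integrable_bound[OF _ F])
       (auto intro!: AE_I2 order_trans[OF le])
qed

text \<open>Negative \<open>c\<close> is wanted for the substitution
  \<open>\<eta> = \<xi> - t *\<^sub>R v\<close> in \<open>fourier_cutoff_product\<close>.\<close>

lemma
  fixes f :: "'a::euclidean_space \<Rightarrow> complex"
  assumes f: "f \<in> borel_measurable borel" and c: "c \<noteq> 0"
  shows lborel_integral_affine:
      "(LINT x|lborel. f x) = of_real (\<bar>c\<bar> ^ DIM('a)) * (LINT x|lborel. f (t + c *\<^sub>R x))"
    and lborel_integrable_affine: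
      "integrable lborel (\<lambda>x. f (t + c *\<^sub>R x)) \<longleftrightarrow> integrable lborel f"
proof -
  have [measurable]: "f \<in> borel_measurable borel" by (rule f)
  have eq: "(lborel :: 'a measure) = density (distr lborel borel (\<lambda>x. t + c *\<^sub>R x)) (\<lambda>_. ennreal (\<bar>c\<bar> ^ DIM('a)))"
    using lborel_affine[OF c, of t] by (simp add: ennreal_power)
  show "(LINT x|lborel. f x) = of_real (\<bar>c\<bar> ^ DIM('a)) * (LINT x|lborel. f (t + c *\<^sub>R x))"
    by (subst eq, subst integral_density)
       (auto simp: integral_distr scaleR_conv_of_real)
  show "integrable lborel (\<lambda>x. f (t + c *\<^sub>R x)) \<longleftrightarrow> integrable lborel f"
  proof -
    have "integrable lborel f \<longleftrightarrow> integrable lborel (\<lambda>x. \<bar>c\<bar> ^ DIM('a) *\<^sub>R f (t + c *\<^sub>R x))"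
      by (subst eq, subst integrable_density) (auto simp: integrable_distr_eq)
    also have "\<dots> \<longleftrightarrow> integrable lborel (\<lambda>x. f (t + c *\<^sub>R x))"
    proof
      assume "integrable lborel (\<lambda>x. \<bar>c\<bar> ^ DIM('a) *\<^sub>R f (t + c *\<^sub>R x))"
      from integrable_scaleR_right[OF this, of "inverse (\<bar>c\<bar> ^ DIM('a))"]
      show "integrable lborel (\<lambda>x. f (t + c *\<^sub>R x))" using c by simp
    qed simp
    finally show ?thesis by blast
  qed
qed

lemma lborel_integral_translate:
  fixes f :: "'a::euclidean_space \<Rightarrow> complex"
  assumes "f \<in> borel_measurable borel"
  shows "(LINT x|lborel. f (t + x)) = (LINT x|lborel. f x)"
  using lborel_integral_affine[OF assms, of 1 t] by simp

text \<open>\<open>lborel\<close> is by construction the image of a product measure indexed by basis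
  vectors; relabelling these by coordinates gives Fubini for products of one-variable functions. It
  serves the Gaussian and the weights \<open>inverse (1 + (\<xi> $ j)\<^sup>2)\<close>.\<close>

lemma
  fixes f :: "'n::finite \<Rightarrow> real \<Rightarrow> 'c::{real_normed_field,banach,second_countable_topology}"
  assumes f: "\<And>i. integrable lborel (f i)"
  shows lborel_integral_prod_vec:
      "(LINT x|(lborel :: (real ^ 'n) measure). (\<Prod>i\<in>UNIV. f i (x $ i))) = (\<Prod>i\<in>UNIV. (LINT t|lborel. f i t))"
    and lborel_integrable_prod_vec:
      "integrable (lborel :: (real ^ 'n) measure) (\<lambda>x. \<Prod>i\<in>UNIV. f i (x $ i))"
proof -
  interpret product_sigma_finite "\<lambda>_::real ^ 'n. lborel :: real measure"
    by standard
  have [measurable]: "f i \<in> borel_measurable borel" for i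
    using borel_measurable_integrable[OF f] by simp
  define F where "F b = f (axis_index b)" for b :: "real ^ 'n"
  have F: "F (axis i 1) = f i" for i by (simp add: F_def)
  have Basis: "(Basis :: (real ^ 'n) set) = range (\<lambda>i. axis i 1)" by (auto simp: Basis_vec_def)
  have inj: "inj (\<lambda>i::'n. axis i (1::real))" by (auto simp: inj_def axis_eq_axis)
  have prod_eq: "(\<Prod>i\<in>UNIV. f i (x $ i)) = (\<Prod>b\<in>Basis. F b (x \<bullet> b))" for x :: "real ^ 'n"
    unfolding Basis using inj by (subst prod.reindex) (auto simp: F inner_axis)
  let ?T = "\<lambda>f. \<Sum>b\<in>Basis. f b *\<^sub>R b :: real ^ 'n"
  have lb: "(lborel :: (real ^ 'n) measure) = distr (\<Pi>\<^sub>M b\<in>Basis. lborel) borel ?T"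
    by (subst lborel_def) (simp add: lborel_eq_real)
  have T: "?T \<in> (\<Pi>\<^sub>M b\<in>Basis. lborel) \<rightarrow>\<^sub>M borel" by measurable
  have M: "(\<lambda>x. \<Prod>b\<in>Basis. F b (x \<bullet> b)) \<in> borel_measurable (borel :: (real ^ 'n) measure)"
    unfolding F_def by measurable
  have comp: "(\<Prod>b\<in>Basis. F b (?T g \<bullet> b)) = (\<Prod>b\<in>Basis. F b (g b))" for g
    by (intro prod.cong refl) (simp add: inner_sum_left inner_Basis if_distrib cong: if_cong)
  have Fint: "integrable lborel (F b)" for b unfolding F_def by (rule f)
  show "(LINT x|(lborel :: (real ^ 'n) measure). (\<Prod>i\<in>UNIV. f i (x $ i))) = (\<Prod>i\<in>UNIV. (LINT t|lborel. f i t))"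
  proof -
    have "(LINT x|(lborel :: (real ^ 'n) measure). (\<Prod>i\<in>UNIV. f i (x $ i))) =
        (LINT g|(\<Pi>\<^sub>M b\<in>Basis. lborel). (\<Prod>b\<in>Basis. F b (g b)))"
      unfolding prod_eq by (subst lb, subst integral_distr[OF T M]) (simp only: comp)
    also have "\<dots> = (\<Prod>b\<in>Basis. (LINT t|lborel. F b t))"
      by (rule product_integral_prod) (auto intro: Fint)
    also have "\<dots> = (\<Prod>i\<in>UNIV. (LINT t|lborel. f i t))"
      unfolding Basis using inj by (subst prod.reindex) (auto simp: F)
    finally show ?thesis .
  qed
  have "integrable (\<Pi>\<^sub>M b\<in>Basis. lborel) (\<lambda>g. \<Prod>b\<in>Basis. F b (g b))"
    by (rule product_integrable_prod) (auto intro: Fint)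
  then show "integrable (lborel :: (real ^ 'n) measure) (\<lambda>x. \<Prod>i\<in>UNIV. f i (x $ i))"
    unfolding prod_eq by (subst lb, subst integrable_distr_eq[OF T M]) (simp only: comp)
qed

section \<open>The standard Gaussian density and its characteristic function\<close>

definition gauss :: "real ^ 'n \<Rightarrow> real" where
  "gauss x = (\<Prod>i\<in>UNIV. std_normal_density (x $ i))"

lemma std_normal_integral: "(LINT x|lborel. std_normal_density x) = 1"
  using integral_std_normal_moment_even[of 0] by simp

lemma std_normal_integrable: "integrable lborel std_normal_density"
  using integrable_std_normal_moment[of 0] by simp

lemma gauss_integrable: "integrable lborel gauss"
  unfolding gauss_def[abs_def] by (rule lborel_integrable_prod_vec) (rule std_normal_integrable)

lemma gauss_integral: "(LINT x|lborel. gauss x) = 1"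
  unfolding gauss_def using lborel_integral_prod_vec[OF std_normal_integrable]
  by (simp add: std_normal_integral)

lemma gauss_nonneg: "0 \<le> gauss x"
  by (auto simp: gauss_def intro!: prod_nonneg)

lemma std_normal_le: "sqrt (2 * pi) * std_normal_density t \<le> 1"
  by (simp add: std_normal_density_def)

text \<open>The left-hand side is \<open>exp (- (x \<bullet> x) / 2)\<close>. Being at most 1, and
  equal to 1 at the origin, it can be inserted as a convergence factor under an integral.\<close>

lemma gauss_le: "sqrt (2 * pi) ^ CARD('n) * gauss (x :: real ^ 'n) \<le> 1"
proof -
  have "sqrt (2 * pi) ^ CARD('n) * gauss x = (\<Prod>i\<in>UNIV. sqrt (2 * pi) * std_normal_density (x $ i))"
    by (simp add: gauss_def prod.distrib)
  also have "\<dots> \<le> 1" by (intro prod_le_1) (auto simp: std_normal_le)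
  finally show ?thesis .
qed

lemma gauss_zero: "sqrt (2 * pi) ^ CARD('n) * gauss (0 :: real ^ 'n) = 1"
  by (simp add: gauss_def std_normal_density_def power_divide)

lemma gauss_minus: "gauss (- x) = gauss x"
  by (simp add: gauss_def std_normal_density_def)

lemma gauss_continuous: "continuous_on UNIV gauss"
  unfolding gauss_def std_normal_density_def by (intro continuous_intros) auto

lemma gauss_measurable [measurable]: "gauss \<in> borel_measurable borel"
  by (intro borel_measurable_continuous_onI gauss_continuous)

lemma continuous_on_cis_inner [continuous_intros]:
  "continuous_on A f \<Longrightarrow> continuous_on A (\<lambda>x. cis (f x))"
  unfolding cis_conv_exp by (intro continuous_intros)

lemma cis_measurable [measurable]: "cis \<in> borel_measurable borel"
  by (intro borel_measurable_continuous_onI continuous_intros)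

text \<open>The value is \<open>exp (- t\<^sup>2 / 2)\<close>, written as a multiple of the density
  so that the product over the coordinates reassembles into \<open>gauss\<close>.\<close>

lemma std_normal_char:
  "(LINT x|lborel. complex_of_real (std_normal_density x) * cis (x * t)) =
     of_real (sqrt (2 * pi) * std_normal_density t)"
proof -
  have "of_real (exp (- t\<^sup>2 / 2)) = (CLINT x|std_normal_distribution. exp (\<i> * complex_of_real (t * x)))"
    using fun_cong[OF char_std_normal_distribution, of t] by (simp add: char_def)
  also have "\<dots> = (LINT x|lborel. std_normal_density x *\<^sub>R exp (\<i> * complex_of_real (t * x)))"
    by (subst integral_density) auto
  finally show ?thesis
    by (simp add: std_normal_density_def scaleR_conv_of_real cis_conv_exp mult.commute)
qed

lemma gauss_char:
  "(LINT v|lborel. complex_of_real (gauss v) * cis (v \<bullet> t)) =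
     of_real (sqrt (2 * pi) ^ CARD('n) * gauss (t :: real ^ 'n))"
proof -
  have "(\<Sum>i\<in>UNIV. (v $ i) * (t $ i)) = v \<bullet> t" for v by (simp add: inner_vec_def)
  moreover have "cis (\<Sum>i\<in>A. g i) = (\<Prod>i\<in>A. cis (g i))" for A :: "'n set" and g
    by (induction A rule: infinite_finite_induct) (auto simp: cis_mult[symmetric])
  ultimately have eq: "complex_of_real (gauss v) * cis (v \<bullet> t) =
      (\<Prod>i\<in>UNIV. complex_of_real (std_normal_density (v $ i)) * cis ((v $ i) * (t $ i)))" for v
    by (simp add: gauss_def prod.distrib flip: \<open>\<And>v. _ = v \<bullet> t\<close>)
  have int: "integrable lborel (\<lambda>s. complex_of_real (std_normal_density s) * cis (s * (t $ i)))" for i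
    by (rule Bochner_Integration.integrable_bound[OF std_normal_integrable]) (auto simp: norm_mult)
  show ?thesis
    unfolding eq using lborel_integral_prod_vec[OF int]
    by (simp add: std_normal_char gauss_def prod.distrib)
qed

section \<open>The Fourier transform of test functions\<close>

text \<open>Fubini and affine substitution are used over \<open>lborel\<close>; for Borel functions
  the Lebesgue integral in \<open>fourier\<close> can be moved there.\<close>

lemma fourier_lborel:
  fixes f :: "real ^ 'n \<Rightarrow> complex"
  assumes [measurable]: "f \<in> borel_measurable borel"
  shows "fourier f \<xi> = (LINT x|lborel. f x * cis (- (x \<bullet> \<xi>))) / of_real ((2 * pi) ^ CARD('n))"
proof -
  have "(LINT x|lebesgue. f x * cis (- (x \<bullet> \<xi>))) = (LINT x|lborel. f x * cis (- (x \<bullet> \<xi>)))"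
    by (rule integral_completion) measurable
  then show ?thesis by (simp add: fourier_def cis_conv_exp)
qed

lemma integrable_mult_cis:
  fixes f :: "real ^ 'n \<Rightarrow> complex"
  assumes f: "integrable lborel f" and [measurable]: "g \<in> borel_measurable borel"
  shows "integrable lborel (\<lambda>x. f x * cis (g x))"
proof -
  have [measurable]: "f \<in> borel_measurable borel" using borel_measurable_integrable[OF f] by simp
  show ?thesis by (rule Bochner_Integration.integrable_bound[OF f]) (auto simp: norm_mult)
qed

lemma fourier_measurable:
  fixes f :: "real ^ 'n \<Rightarrow> complex"
  assumes [measurable]: "f \<in> borel_measurable borel"
  shows "fourier f \<in> borel_measurable borel"
proof -
  have "(\<lambda>\<xi>. (LINT x|lborel. f x * cis (- (x \<bullet> \<xi>))) / of_real ((2 * pi) ^ CARD('n))) \<in> borel_measurable borel"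
    by measurable
  moreover have "fourier f = (\<lambda>\<xi>. (LINT x|lborel. f x * cis (- (x \<bullet> \<xi>))) / of_real ((2 * pi) ^ CARD('n)))"
    by (rule ext) (rule fourier_lborel[OF assms])
  ultimately show ?thesis by simp
qed

lemma fourier_norm_le:
  fixes f :: "real ^ 'n \<Rightarrow> complex"
  assumes f: "integrable lborel f"
  shows "norm (fourier f \<xi>) \<le> (LINT x|lborel. norm (f x)) / (2 * pi) ^ CARD('n)"
proof -
  have [measurable]: "f \<in> borel_measurable borel" using borel_measurable_integrable[OF f] by simp
  have "norm (LINT x|lborel. f x * cis (- (x \<bullet> \<xi>))) \<le> (LINT x|lborel. norm (f x * cis (- (x \<bullet> \<xi>))))"
    by (rule integral_norm_bound)
  then show ?thesis
    by (simp add: fourier_lborel norm_divide norm_mult norm_power divide_right_mono)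
qed

lemma smooth_line_derivative:
  assumes "smooth f"
  shows "((\<lambda>s. f (x + s *\<^sub>R axis i 1)) has_vector_derivative partial i f (x + s *\<^sub>R axis i 1)) (at s within S)"
proof -
  have "((\<lambda>s. x + s *\<^sub>R axis i 1) has_derivative (\<lambda>h. h *\<^sub>R axis i 1)) (at s within S)"
    by (auto intro!: derivative_eq_intros)
  from has_derivative_compose[OF this smooth_has_derivative[OF assms]]
  have "((\<lambda>s. f (x + s *\<^sub>R axis i 1)) has_derivative (\<lambda>h. frechet_derivative f (at (x + s *\<^sub>R axis i 1)) (h *\<^sub>R axis i 1))) (at s within S)" .
  moreover have "linear (frechet_derivative f (at (x + s *\<^sub>R axis i 1)))"
    by (meson assms has_derivative_linear smooth_has_derivative)
  ultimately show ?thesis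
    by (simp add: has_vector_derivative_def partial_def linear_scale)
qed

lemma has_vector_derivative_quotient_tendsto:
  assumes "(g has_vector_derivative d) (at 0)"
  shows "((\<lambda>s. (g s - g 0) /\<^sub>R s) \<longlongrightarrow> d) (at 0)"
proof -
  have "((\<lambda>s. (g s - g 0 - s *\<^sub>R d) /\<^sub>R norm s) \<longlongrightarrow> 0) (at 0)"
    using assms by (simp add: has_vector_derivative_def has_derivative_def)
  then have "((\<lambda>s. norm ((g s - g 0 - s *\<^sub>R d) /\<^sub>R norm s)) \<longlongrightarrow> 0) (at 0)"
    by (rule tendsto_norm_zero)
  then have "((\<lambda>s. norm ((g s - g 0) /\<^sub>R s - d)) \<longlongrightarrow> 0) (at 0)"
  proof (rule Lim_transform_eventually)
    show "eventually (\<lambda>s. norm ((g s - g 0 - s *\<^sub>R d) /\<^sub>R norm s) = norm ((g s - g 0) /\<^sub>R s - d)) (at 0)"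
      unfolding eventually_at_filter
    proof (intro always_eventually allI impI)
      fix s :: real assume s: "s \<noteq> 0"
      have "(g s - g 0) /\<^sub>R s - d = (g s - g 0 - s *\<^sub>R d) /\<^sub>R s"
        using s by (simp add: scaleR_diff_right)
      then show "norm ((g s - g 0 - s *\<^sub>R d) /\<^sub>R norm s) = norm ((g s - g 0) /\<^sub>R s - d)" by simp
    qed
  qed
  then show ?thesis by (simp add: tendsto_norm_zero_iff LIM_zero_iff)
qed

text \<open>Difference quotients replace integration by parts: by translation invariance the
  quotient with step \<open>t k\<close> transforms to \<open>fourier f\<close> times
  \<open>(cis (t k * \<xi> $ i) - 1) / t k\<close>, and dominated convergence lets the step tend to
  0.\<close>

lemma fourier_partial:
  fixes f :: "real ^ 'n \<Rightarrow> complex"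
  assumes f: "f \<in> test_functions"
  shows "fourier (partial i f) \<xi> = \<i> * of_real (\<xi> $ i) * fourier f \<xi>"
proof -
  have sm: "smooth f" using f by (rule test_smooth)
  have [measurable]: "f \<in> borel_measurable borel" "partial i f \<in> borel_measurable borel"
    using f test_partial test_measurable by blast+
  define e where "e = (axis i 1 :: real ^ 'n)"
  have e: "norm e = 1" by (simp add: e_def)
  define t where "t k = inverse (real (Suc k))" for k
  have t: "0 < t k" "t k \<le> 1" for k by (auto simp: t_def inverse_le_1_iff)
  have t0: "t \<longlonglongrightarrow> 0" unfolding t_def by (rule LIMSEQ_inverse_real_of_nat)
  then have t_at: "filterlim t (at 0) sequentially"
    using t by (auto simp: filterlim_at less_imp_neq[symmetric] intro!: always_eventually)
  obtain R B where R: "0 \<le> R" "\<And>x. norm (f x) \<le> B * indicator (cball 0 R) x"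
    using test_bounded[OF f] by blast
  obtain R' B' where B: "0 \<le> B'" "\<And>x. norm (partial i f x) \<le> B' * indicator (cball 0 R') x"
    using test_bounded[OF test_partial[OF f]] by blast
  have B': "norm (partial i f x) \<le> B'" for x
    using B(2)[of x] B(1) by (cases "x \<in> cball 0 R'") auto
  define q where "q k x = (f (x + t k *\<^sub>R e) - f x) /\<^sub>R t k" for k x
  have q_meas [measurable]: "q k \<in> borel_measurable borel" for k unfolding q_def by measurable
  \<comment> \<open>The mean value inequality gives the height \<open>B'\<close>, and steps of
    length at most 1 enlarge the radius of the support by at most 1; one majorant thus serves all
    \<open>k\<close>.\<close>
  have q_le: "norm (q k x) \<le> B' * indicator (cball 0 (R + 1)) x" for k x
  proof (cases "x \<in> cball 0 (R + 1)")
    case True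
    have "norm (f (x + t k *\<^sub>R e) - f (x + 0 *\<^sub>R e)) \<le> B' * norm (t k - 0)"
    proof (rule differentiable_bound[of "{0..t k}" "\<lambda>s. f (x + s *\<^sub>R e)" "\<lambda>s h. h *\<^sub>R partial i f (x + s *\<^sub>R e)"])
      show "((\<lambda>s. f (x + s *\<^sub>R e)) has_derivative (\<lambda>h. h *\<^sub>R partial i f (x + s *\<^sub>R e))) (at s within {0..t k})" for s
        using smooth_line_derivative[OF sm, of x i s "{0..t k}"]
        by (simp add: has_vector_derivative_def e_def)
      show "onorm (\<lambda>h. h *\<^sub>R partial i f (x + s *\<^sub>R e)) \<le> B'" for s
      proof (rule onorm_le)
        show "norm (h *\<^sub>R partial i f (x + s *\<^sub>R e)) \<le> B' * norm h" for h :: real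
          using mult_right_mono[OF B', of "norm h"] by (simp add: mult.commute)
      qed
    qed (use t[of k] in auto)
    then have "norm (f (x + t k *\<^sub>R e) - f x) \<le> B' * t k" using t[of k] by simp
    then have "norm (f (x + t k *\<^sub>R e) - f x) / t k \<le> B'" using t[of k] by (simp add: pos_divide_le_eq)
    then show ?thesis using True t[of k] by (simp add: q_def divide_inverse mult.commute)
  next
    case False
    then have "norm x > R + 1" by simp
    then have "norm (x + t k *\<^sub>R e) > R"
      using norm_triangle_ineq2[of x "- (t k *\<^sub>R e)"] t[of k] e by simp
    then have "f (x + t k *\<^sub>R e) = 0" using R(2)[of "x + t k *\<^sub>R e"] by simp
    moreover have "f x = 0" using R(2)[of x] False by simp
    ultimately show ?thesis using False by (simp add: q_def)
  qed
  have q_lim: "(\<lambda>k. q k x) \<longlonglongrightarrow> partial i f x" for x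
  proof -
    have "((\<lambda>s. f (x + s *\<^sub>R e)) has_vector_derivative partial i f x) (at 0)"
      using smooth_line_derivative[OF sm, of x i 0 UNIV] by (simp add: e_def)
    from has_vector_derivative_quotient_tendsto[OF this]
    have "((\<lambda>s. (f (x + s *\<^sub>R e) - f x) /\<^sub>R s) \<longlongrightarrow> partial i f x) (at 0)" by simp
    from filterlim_compose[OF this t_at] show ?thesis by (simp add: q_def)
  qed
  have "(\<lambda>k. LINT x|lborel. q k x * cis (- (x \<bullet> \<xi>))) \<longlonglongrightarrow> (LINT x|lborel. partial i f x * cis (- (x \<bullet> \<xi>)))"
  proof (rule integral_dominated_convergence[where w="\<lambda>x. B' * indicator (cball 0 (R + 1)) x"])
    show "AE x in lborel. (\<lambda>k. q k x * cis (- (x \<bullet> \<xi>))) \<longlonglongrightarrow> partial i f x * cis (- (x \<bullet> \<xi>))"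
      by (intro AE_I2 tendsto_mult q_lim tendsto_const)
    show "integrable lborel (\<lambda>x::real^'n. B' * indicator (cball 0 (R + 1)) x)"
      by (rule integrable_indicator_cball)
  qed (use q_le in \<open>auto simp: norm_mult\<close>)
  moreover have "(LINT x|lborel. q k x * cis (- (x \<bullet> \<xi>))) =
      ((cis (t k * \<xi> $ i) - 1) /\<^sub>R t k) * (LINT x|lborel. f x * cis (- (x \<bullet> \<xi>)))" for k
  proof -
    let ?g = "\<lambda>x. f x * cis (- (x \<bullet> \<xi>))"
    have int: "integrable lborel ?g"
      by (intro integrable_mult_cis test_integrable f) measurable
    have int': "integrable lborel (\<lambda>x. ?g (t k *\<^sub>R e + x))"
      using lborel_integrable_affine[of ?g 1 "t k *\<^sub>R e"] int by simp
    have eq: "q k x * cis (- (x \<bullet> \<xi>)) = (cis (t k * \<xi> $ i) * ?g (t k *\<^sub>R e + x) - ?g x) /\<^sub>R t k" for x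
    proof -
      have "cis (- (x \<bullet> \<xi>)) = cis (t k * \<xi> $ i) * cis (- ((t k *\<^sub>R e + x) \<bullet> \<xi>))"
        by (simp add: cis_mult e_def inner_add_left inner_axis')
      then show ?thesis by (simp add: q_def add.commute scaleR_conv_of_real field_simps)
    qed
    have "(LINT x|lborel. q k x * cis (- (x \<bullet> \<xi>))) =
        (cis (t k * \<xi> $ i) * (LINT x|lborel. ?g (t k *\<^sub>R e + x)) - (LINT x|lborel. ?g x)) /\<^sub>R t k"
      unfolding eq using int int' by simp
    also have "(LINT x|lborel. ?g (t k *\<^sub>R e + x)) = (LINT x|lborel. ?g x)"
      by (rule lborel_integral_translate) measurable
    finally show ?thesis by (simp add: scaleR_conv_of_real field_simps)
  qed
  moreover have "(\<lambda>k. (cis (t k * \<xi> $ i) - 1) /\<^sub>R t k) \<longlonglongrightarrow> \<i> * of_real (\<xi> $ i)"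
  proof -
    have "((\<lambda>s. cis (s * \<xi> $ i)) has_vector_derivative (\<i> * of_real (\<xi> $ i))) (at 0)"
      unfolding has_vector_derivative_def
      by (rule derivative_eq_intros | simp add: scaleR_conv_of_real mult_ac)+
    from has_vector_derivative_quotient_tendsto[OF this]
    have "((\<lambda>s. (cis (s * \<xi> $ i) - 1) /\<^sub>R s) \<longlongrightarrow> \<i> * of_real (\<xi> $ i)) (at 0)" by simp
    from filterlim_compose[OF this t_at] show ?thesis .
  qed
  ultimately have "(\<lambda>k. ((cis (t k * \<xi> $ i) - 1) /\<^sub>R t k) * (LINT x|lborel. f x * cis (- (x \<bullet> \<xi>))))
      \<longlonglongrightarrow> (LINT x|lborel. partial i f x * cis (- (x \<bullet> \<xi>)))"
    "(\<lambda>k. ((cis (t k * \<xi> $ i) - 1) /\<^sub>R t k) * (LINT x|lborel. f x * cis (- (x \<bullet> \<xi>))))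
      \<longlonglongrightarrow> \<i> * of_real (\<xi> $ i) * (LINT x|lborel. f x * cis (- (x \<bullet> \<xi>)))"
    by (simp, intro tendsto_mult tendsto_const, simp)
  from LIMSEQ_unique[OF this] show ?thesis by (simp add: fourier_lborel)
qed

text \<open>Unlike the symbol of a bare derivative, \<open>1 + (\<xi> $ i)\<^sup>2\<close> has no
  zeros, so it can be divided out.\<close>

lemma fourier_one_minus_partial2:
  fixes f :: "real ^ 'n \<Rightarrow> complex"
  assumes f: "f \<in> test_functions"
  shows "fourier (\<lambda>x. f x - partial i (partial i f) x) \<xi> = of_real (1 + (\<xi> $ i)\<^sup>2) * fourier f \<xi>"
proof -
  let ?g = "partial i (partial i f)"
  have g: "?g \<in> test_functions" by (intro test_partial f)
  have meas: "f \<in> borel_measurable borel" "?g \<in> borel_measurable borel"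
    "(\<lambda>x. f x - ?g x) \<in> borel_measurable borel"
    using f g test_diff[OF f g] by (auto intro: test_measurable)
  have int: "integrable lborel (\<lambda>x. f x * cis (- (x \<bullet> \<xi>)))" "integrable lborel (\<lambda>x. ?g x * cis (- (x \<bullet> \<xi>)))"
    by (rule integrable_mult_cis, rule test_integrable, use f g in simp, measurable)+
  have "fourier (\<lambda>x. f x - ?g x) \<xi> = fourier f \<xi> - fourier ?g \<xi>"
    using int meas by (simp add: fourier_lborel left_diff_distrib diff_divide_distrib)
  also have "fourier ?g \<xi> = - of_real ((\<xi> $ i)\<^sup>2) * fourier f \<xi>"
  proof -
    have "fourier ?g \<xi> = (\<i> * \<i>) * (of_real ((\<xi> $ i)\<^sup>2) * fourier f \<xi>)"
      by (simp only: fourier_partial[OF test_partial[OF f]] fourier_partial[OF f]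
          power2_eq_square of_real_mult mult_ac)
    then show ?thesis by simp
  qed
  finally show ?thesis by (simp add: algebra_simps)
qed

text \<open>The operator behind \<open>g\<close> is the product over \<open>J\<close> of one minus
  the second partial derivatives. Over all coordinates its symbol is a product of one-variable
  weights with integrable reciprocals, which settles \<open>fourier_integrable\<close> in every
  dimension.\<close>

lemma fourier_weighted:
  fixes f :: "real ^ 'n \<Rightarrow> complex"
  assumes "finite J" "f \<in> test_functions"
  shows "\<exists>g\<in>test_functions. \<forall>\<xi>. fourier g \<xi> = of_real (\<Prod>j\<in>J. 1 + (\<xi> $ j)\<^sup>2) * fourier f \<xi>"
  using assms
proof (induction J arbitrary: f)
  case empty
  then show ?case by auto
next
  case (insert j J)
  let ?f = "\<lambda>x. f x - partial j (partial j f) x"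
  have "?f \<in> test_functions" by (intro test_diff test_partial insert.prems)
  from insert.IH[OF this] obtain g where g: "g \<in> test_functions"
    "\<And>\<xi>. fourier g \<xi> = of_real (\<Prod>j\<in>J. 1 + (\<xi> $ j)\<^sup>2) * fourier ?f \<xi>" by blast
  have "fourier g \<xi> = of_real (\<Prod>j\<in>insert j J. 1 + (\<xi> $ j)\<^sup>2) * fourier f \<xi>" for \<xi>
    using insert.hyps by (simp add: g(2) fourier_one_minus_partial2[OF insert.prems] del: of_real_add)
  then show ?case using g(1) by blast
qed

section \<open>Decay of transforms and smoothness of inverse transforms\<close>

lemma integrable_inverse_1_plus_sq: "integrable lborel (\<lambda>x::real. inverse (1 + x\<^sup>2))"
proof -
  have "einterval (-\<infinity>) \<infinity> = (UNIV :: real set)" by (auto simp: einterval_def)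
  then show ?thesis using integrable_inverse_1_plus_square by (simp add: set_integrable_def)
qed

lemma fourier_integrable:
  fixes f :: "real ^ 'n \<Rightarrow> complex"
  assumes f: "f \<in> test_functions"
  shows "integrable lborel (fourier f)"
proof -
  obtain g where g: "g \<in> test_functions"
    "\<And>\<xi>. fourier g \<xi> = of_real (\<Prod>j\<in>UNIV. 1 + (\<xi> $ j)\<^sup>2) * fourier f \<xi>"
    using fourier_weighted[OF finite f] by blast
  define C where "C = (LINT x|lborel. norm (g x)) / (2 * pi) ^ CARD('n)"
  let ?w = "\<lambda>\<xi>::real^'n. C * (\<Prod>j\<in>UNIV. inverse (1 + (\<xi> $ j)\<^sup>2))"
  have le: "norm (fourier f \<xi>) \<le> ?w \<xi>" for \<xi>
  proof -
    have pos: "0 < (\<Prod>j\<in>UNIV. 1 + (\<xi> $ j)\<^sup>2)" by (intro prod_pos) (simp add: add_pos_nonneg)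
    then have "norm (fourier g \<xi>) = (\<Prod>j\<in>UNIV. 1 + (\<xi> $ j)\<^sup>2) * norm (fourier f \<xi>)"
      unfolding g(2) by (simp only: norm_mult norm_of_real abs_of_pos)
    moreover have "norm (fourier g \<xi>) \<le> C"
      unfolding C_def by (intro fourier_norm_le test_integrable g)
    ultimately have "norm (fourier f \<xi>) \<le> C / (\<Prod>j\<in>UNIV. 1 + (\<xi> $ j)\<^sup>2)"
      using pos by (simp add: pos_le_divide_eq mult.commute)
    then show ?thesis using prod_inversef[of "\<lambda>j. 1 + (\<xi> $ j)\<^sup>2" UNIV] by (simp add: o_def divide_inverse)
  qed
  have "integrable lborel ?w"
    by (intro integrable_mult_right lborel_integrable_prod_vec integrable_inverse_1_plus_sq)
  then show ?thesis
  proof (rule Bochner_Integration.integrable_bound)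
    show "fourier f \<in> borel_measurable lborel"
      using fourier_measurable[OF test_measurable[OF f]] by simp
    show "AE \<xi> in lborel. norm (fourier f \<xi>) \<le> norm (?w \<xi>)"
      using le by (intro AE_I2 order_trans[OF le]) simp
  qed
qed

text \<open>Decay is tested by integrability against monomials. Listing the factors of a monomial
  makes multiplication by a coordinate a cons, and a condition on size alone is stable under bounded
  Borel symbols.\<close>

definition rapid :: "(real ^ 'n \<Rightarrow> complex) \<Rightarrow> bool" where
  "rapid h \<longleftrightarrow> h \<in> borel_measurable borel \<and>
     (\<forall>is. integrable lborel (\<lambda>\<xi>. of_real (\<Prod>i\<leftarrow>is. \<xi> $ i) * h \<xi>))"

lemma rapidD: "rapid h \<Longrightarrow> integrable lborel (\<lambda>\<xi>. of_real (\<Prod>i\<leftarrow>is. \<xi> $ i) * h \<xi>)"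
  by (simp add: rapid_def)

lemma rapid_measurable: "rapid h \<Longrightarrow> h \<in> borel_measurable borel"
  by (simp add: rapid_def)

lemma rapid_integrable: "rapid h \<Longrightarrow> integrable lborel h"
  using rapidD[of h "[]"] by simp

lemma rapid_fourier:
  fixes f :: "real ^ 'n \<Rightarrow> complex"
  assumes "f \<in> test_functions"
  shows "rapid (fourier f)"
proof -
  have "integrable lborel (\<lambda>\<xi>. of_real (\<Prod>i\<leftarrow>is. \<xi> $ i) * fourier f \<xi>)" for "is"
    using assms
  proof (induction "is" arbitrary: f)
    case Nil
    then show ?case by (simp add: fourier_integrable)
  next
    case (Cons i "is")
    from Cons.IH[OF test_partial[OF Cons.prems, of i]]
    have "integrable lborel (\<lambda>\<xi>. - \<i> * (of_real (\<Prod>i\<leftarrow>is. \<xi> $ i) * fourier (partial i f) \<xi>))"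
      by (rule integrable_mult_right)
    then show ?case by (simp add: fourier_partial Cons.prems mult_ac)
  qed
  then show ?thesis using fourier_measurable[OF test_measurable[OF assms]] by (simp add: rapid_def)
qed

lemma rapid_mult_bounded:
  assumes h: "rapid h" and [measurable]: "m \<in> borel_measurable borel"
    and B: "\<And>\<xi>. norm (m \<xi>) \<le> B"
  shows "rapid (\<lambda>\<xi>. m \<xi> * h \<xi>)"
proof -
  have [measurable]: "h \<in> borel_measurable borel" by (rule rapid_measurable[OF h])
  have "integrable lborel (\<lambda>\<xi>. of_real (\<Prod>i\<leftarrow>is. \<xi> $ i) * (m \<xi> * h \<xi>))" (is "integrable _ (\<lambda>\<xi>. ?P \<xi> * _)") for "is"
  proof (rule Bochner_Integration.integrable_bound)
    show "integrable lborel (\<lambda>\<xi>. of_real B * (?P \<xi> * h \<xi>))"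
      by (intro integrable_mult_right rapidD h)
    have "(\<lambda>\<xi>. ?P \<xi> * h \<xi>) \<in> borel_measurable lborel"
      using rapidD[OF h] by (rule borel_measurable_integrable)
    then have "(\<lambda>\<xi>. m \<xi> * (?P \<xi> * h \<xi>)) \<in> borel_measurable lborel"
      by measurable
    then show "(\<lambda>\<xi>. ?P \<xi> * (m \<xi> * h \<xi>)) \<in> borel_measurable lborel"
      by (simp add: mult_ac)
    have "norm (?P \<xi> * (m \<xi> * h \<xi>)) \<le> norm (of_real B * (?P \<xi> * h \<xi>))" for \<xi>
    proof -
      have "norm (m \<xi>) * norm (?P \<xi> * h \<xi>) \<le> \<bar>B\<bar> * norm (?P \<xi> * h \<xi>)"
        using B[of \<xi>] by (intro mult_right_mono) auto
      then show ?thesis by (simp only: norm_mult norm_of_real mult_ac)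
    qed
    then show "AE \<xi> in lborel. norm (?P \<xi> * (m \<xi> * h \<xi>)) \<le> norm (of_real B * (?P \<xi> * h \<xi>))"
      by simp
  qed
  then show ?thesis by (simp add: rapid_def)
qed

lemma rapid_coord:
  assumes "rapid h"
  shows "rapid (\<lambda>\<xi>. \<i> * of_real (\<xi> $ i) * h \<xi>)"
proof -
  have [measurable]: "h \<in> borel_measurable borel" by (rule rapid_measurable[OF assms])
  have "integrable lborel (\<lambda>\<xi>. of_real (\<Prod>i\<leftarrow>is. \<xi> $ i) * (\<i> * of_real (\<xi> $ i) * h \<xi>))" for "is"
  proof -
    have "integrable lborel (\<lambda>\<xi>. \<i> * (of_real (\<Prod>i\<leftarrow>i # is. \<xi> $ i) * h \<xi>))"
      by (intro integrable_mult_right rapidD assms)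
    then show ?thesis by (simp add: mult_ac)
  qed
  then show ?thesis by (simp add: rapid_def)
qed

text \<open>Taylor's remainder of second order. The quadratic bound holds for all \<open>b\<close>,
  so it can be integrated over all frequencies.\<close>

lemma cis_remainder: "norm (cis (a + b) - cis a - \<i> * of_real b * cis a) \<le> b\<^sup>2"
proof -
  have "norm (cis b - (\<Sum>k\<le>1. (\<i> * of_real b) ^ k / fact k)) \<le> \<bar>b\<bar> ^ Suc 1 / fact (Suc 1)"
    unfolding cis_conv_exp using iexp_approx1[of b 1] by simp
  also have "\<dots> \<le> b\<^sup>2" by (simp add: power2_eq_square)
  finally have "norm (cis b - 1 - \<i> * of_real b) \<le> b\<^sup>2" by (simp add: algebra_simps)
  moreover have "cis (a + b) - cis a - \<i> * of_real b * cis a = cis a * (cis b - 1 - \<i> * of_real b)"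
    by (simp add: cis_mult[symmetric] algebra_simps)
  ultimately show ?thesis by (simp add: norm_mult)
qed

text \<open>The Frechet derivative is obtained in all directions at once: the remainder of the
  integrand is at most \<open>(norm (y - x) * norm \<xi>)\<^sup>2 * norm (h \<xi>)\<close>, so the
  integrated remainder is quadratic in \<open>y - x\<close> with the second moment \<open>K\<close>
  as constant.\<close>

lemma rapid_inverse_transform_derivative:
  fixes h :: "real ^ 'n \<Rightarrow> complex"
  assumes h: "rapid h"
  shows "((\<lambda>x. LINT \<xi>|lborel. h \<xi> * cis (x \<bullet> \<xi>)) has_derivative
    (\<lambda>k. \<Sum>i\<in>UNIV. (k $ i) *\<^sub>R (LINT \<xi>|lborel. \<i> * of_real (\<xi> $ i) * h \<xi> * cis (x \<bullet> \<xi>)))) (at x)"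
proof -
  let ?g = "\<lambda>x. LINT \<xi>|lborel. h \<xi> * cis (x \<bullet> \<xi>)"
  let ?G = "\<lambda>i. LINT \<xi>|lborel. \<i> * of_real (\<xi> $ i) * h \<xi> * cis (x \<bullet> \<xi>)"
  let ?D = "\<lambda>k. \<Sum>i\<in>UNIV. (k $ i) *\<^sub>R ?G i"
  define K where "K = (LINT \<xi>|lborel. norm \<xi> ^ 2 * norm (h \<xi>))"
  have int0: "integrable lborel (\<lambda>\<xi>. h \<xi> * cis (y \<bullet> \<xi>))" for y
    by (intro integrable_mult_cis rapid_integrable h) measurable
  have int1: "integrable lborel (\<lambda>\<xi>. \<i> * of_real (\<xi> $ i) * h \<xi> * cis (x \<bullet> \<xi>))" for i
    by (intro integrable_mult_cis rapid_integrable rapid_coord h) measurable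
  \<comment> \<open>The second moment is a sum of quadratic monomials, one for each list
    \<open>[i, i]\<close>.\<close>
  have "integrable lborel (\<lambda>\<xi>. \<Sum>i\<in>UNIV. norm (of_real (\<Prod>i\<leftarrow>[i, i]. \<xi> $ i) * h \<xi>))"
    using rapidD[OF h] by (intro Bochner_Integration.integrable_sum integrable_norm) blast
  moreover have "(\<Sum>i\<in>UNIV. norm (of_real (\<Prod>i\<leftarrow>[i, i]. \<xi> $ i) * h \<xi>)) = norm \<xi> ^ 2 * norm (h \<xi>)" for \<xi>
    unfolding power2_norm_eq_inner
    by (simp add: inner_vec_def sum_distrib_right norm_mult flip: abs_mult)
  ultimately have int2: "integrable lborel (\<lambda>\<xi>. norm \<xi> ^ 2 * norm (h \<xi>))" by simp
  have lin: "bounded_linear ?D"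
    by (intro bounded_linear_sum bounded_linear_compose[OF bounded_linear_scaleR_left bounded_linear_vec_nth])
  have le: "norm (?g y - ?g x - ?D (y - x)) \<le> norm (y - x) ^ 2 * K" for y
  proof -
    have "?D (y - x) = (LINT \<xi>|lborel. (\<Sum>i\<in>UNIV. ((y - x) $ i) *\<^sub>R (\<i> * of_real (\<xi> $ i) * h \<xi> * cis (x \<bullet> \<xi>))))"
      using int1 by (simp del: vector_minus_component add: Bochner_Integration.integral_sum)
    also have "\<dots> = (LINT \<xi>|lborel. h \<xi> * (\<i> * of_real ((y - x) \<bullet> \<xi>) * cis (x \<bullet> \<xi>)))"
      by (intro Bochner_Integration.integral_cong refl)
         (simp add: inner_vec_def sum_distrib_left sum_distrib_right scaleR_conv_of_real mult_ac)
    finally have D: "?D (y - x) = (LINT \<xi>|lborel. h \<xi> * (\<i> * of_real ((y - x) \<bullet> \<xi>) * cis (x \<bullet> \<xi>)))" .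
    have int3: "integrable lborel (\<lambda>\<xi>. h \<xi> * (\<i> * of_real ((y - x) \<bullet> \<xi>) * cis (x \<bullet> \<xi>)))"
    proof -
      have "integrable lborel (\<lambda>\<xi>. \<Sum>i\<in>UNIV. ((y - x) $ i) *\<^sub>R (\<i> * of_real (\<xi> $ i) * h \<xi> * cis (x \<bullet> \<xi>)))"
        using int1 by (intro Bochner_Integration.integrable_sum integrable_scaleR_right) auto
      then show ?thesis
        by (rule Bochner_Integration.integrable_cong[THEN iffD1, rotated 2, OF _ refl])
         (simp add: inner_vec_def sum_distrib_left sum_distrib_right scaleR_conv_of_real mult_ac)
    qed
    let ?r = "\<lambda>\<xi>. h \<xi> * (cis (y \<bullet> \<xi>) - cis (x \<bullet> \<xi>) - \<i> * of_real ((y - x) \<bullet> \<xi>) * cis (x \<bullet> \<xi>))"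
    have "?g y - ?g x - ?D (y - x) = (LINT \<xi>|lborel. ?r \<xi>)"
      unfolding D using int0[of y] int0[of x] int3 by (simp add: right_diff_distrib)
    also have "norm \<dots> \<le> (LINT \<xi>|lborel. norm (y - x) ^ 2 * (norm \<xi> ^ 2 * norm (h \<xi>)))"
    proof (rule order_trans[OF integral_norm_bound integral_mono[OF integrable_norm]])
      show "integrable lborel ?r"
        using int0[of y] int0[of x] int3 by (simp add: right_diff_distrib)
      show "integrable lborel (\<lambda>\<xi>. norm (y - x) ^ 2 * (norm \<xi> ^ 2 * norm (h \<xi>)))"
        by (intro integrable_mult_right int2)
      show "norm (?r \<xi>) \<le> norm (y - x) ^ 2 * (norm \<xi> ^ 2 * norm (h \<xi>))" for \<xi>
      proof -
        have "norm (cis (y \<bullet> \<xi>) - cis (x \<bullet> \<xi>) - \<i> * of_real ((y - x) \<bullet> \<xi>) * cis (x \<bullet> \<xi>)) \<le> ((y - x) \<bullet> \<xi>)\<^sup>2"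
          using cis_remainder[of "x \<bullet> \<xi>" "(y - x) \<bullet> \<xi>"] by (simp add: inner_diff_left)
        also have "\<dots> = \<bar>(y - x) \<bullet> \<xi>\<bar>\<^sup>2" by simp
        also have "\<dots> \<le> (norm (y - x) * norm \<xi>)\<^sup>2"
          by (intro power_mono Cauchy_Schwarz_ineq2) auto
        finally have "norm (h \<xi>) * norm (cis (y \<bullet> \<xi>) - cis (x \<bullet> \<xi>) - \<i> * of_real ((y - x) \<bullet> \<xi>) * cis (x \<bullet> \<xi>))
            \<le> norm (h \<xi>) * (norm (y - x) * norm \<xi>)\<^sup>2" by (intro mult_left_mono) auto
        then show ?thesis by (simp add: norm_mult power_mult_distrib mult_ac)
      qed
    qed
    finally show ?thesis by (simp add: K_def)
  qed
  show ?thesis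
  proof (rule has_derivativeI_sandwich[of 1 _ _ _ _ "\<lambda>y. norm (y - x) * K"])
    show "norm (?g y - ?g x - ?D (y - x)) / norm (y - x) \<le> norm (y - x) * K" if "y \<noteq> x" for y
      using le[of y] that by (simp add: pos_divide_le_eq power2_eq_square mult_ac)
    show "((\<lambda>y. norm (y - x) * K) \<longlongrightarrow> 0) (at x)"
      by (auto intro!: tendsto_eq_intros)
  qed (use lin in auto)
qed

text \<open>Inverse transforms of \<open>rapid\<close> functions form a class closed under partial
  derivatives, because \<open>rapid_coord\<close> absorbs the factor that a derivative
  produces.\<close>

lemma smooth_inverse_transform:
  assumes "rapid h"
  shows "smooth (\<lambda>x. LINT \<xi>|lborel. h \<xi> * cis (x \<bullet> \<xi>))"
proof (rule smooth_coinduct[where P="\<lambda>g. \<exists>h. rapid h \<and> g = (\<lambda>x. LINT \<xi>|lborel. h \<xi> * cis (x \<bullet> \<xi>))"])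
  fix g assume "\<exists>h. rapid h \<and> g = (\<lambda>x. LINT \<xi>|lborel. h \<xi> * cis (x \<bullet> \<xi>))"
  then obtain h where h: "rapid h" and g: "g = (\<lambda>x. LINT \<xi>|lborel. h \<xi> * cis (x \<bullet> \<xi>))" by blast
  note D = rapid_inverse_transform_derivative[OF h]
  show "g differentiable_on UNIV" unfolding g by (rule differentiable_on_UNIV_I[OF D])
  fix i
  have "partial i g = (\<lambda>x. LINT \<xi>|lborel. \<i> * of_real (\<xi> $ i) * h \<xi> * cis (x \<bullet> \<xi>))"
    unfolding g by (rule ext) (simp add: partialI[OF D] axis_def if_distrib[where f="\<lambda>c. c *\<^sub>R _"] cong: if_cong)
  then show "\<exists>h. rapid h \<and> partial i g = (\<lambda>x. LINT \<xi>|lborel. h \<xi> * cis (x \<bullet> \<xi>))"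
    using rapid_coord[OF h, of i] by blast
qed (use assms in blast)

section \<open>Fourier inversion\<close>

text \<open>Gaussian regularization: with \<open>T \<epsilon>\<close> the integral of \<open>fourier f \<xi> * cis (x \<bullet> \<xi>)\<close> against a
  Gaussian of width \<open>1 / \<epsilon>\<close>, Fubini and the Fourier transform of the Gaussian turn \<open>T \<epsilon>\<close> into
  the average of \<open>f (x + \<epsilon> v)\<close> over a standard normal \<open>v\<close>.\<close>

lemma gauss_regularization:
  fixes f :: "real ^ 'n \<Rightarrow> complex"
  assumes f: "f \<in> test_functions" and \<epsilon>: "0 < \<epsilon>"
  shows "(LINT \<xi>|lborel. fourier f \<xi> * cis (x \<bullet> \<xi>) * of_real (sqrt (2 * pi) ^ CARD('n) * gauss (\<epsilon> *\<^sub>R \<xi>)))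
    = (LINT v|lborel. f (x + \<epsilon> *\<^sub>R v) * of_real (gauss v))"
proof -
  have [measurable]: "f \<in> borel_measurable borel" by (rule test_measurable[OF f])
  \<comment> \<open>The square of \<open>c\<close> is the normalisation of \<open>fourier\<close>.
    One factor cancels against the constant of the Gaussian weight, which leaves the kernel divided
    by \<open>c\<close>; the other cancels the constant produced by
    \<open>gauss_char\<close>.\<close>
  define c where "c = sqrt (2 * pi) ^ CARD('n)"
  have "c * c = (sqrt (2 * pi) * sqrt (2 * pi)) ^ CARD('n)" by (simp only: c_def power_mult_distrib)
  then have c: "0 < c" "c * c = (2 * pi) ^ CARD('n)" by (simp_all add: c_def)
  let ?F = "\<lambda>\<xi> y. f y * cis ((x - y) \<bullet> \<xi>) * of_real (gauss (\<epsilon> *\<^sub>R \<xi>) / c)"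
  have gi: "integrable lborel (\<lambda>\<xi>::real^'n. gauss (\<epsilon> *\<^sub>R \<xi>) / c)"
  proof -
    have "integrable lborel (\<lambda>\<xi>::real^'n. complex_of_real (gauss (0 + \<epsilon> *\<^sub>R \<xi>)))"
      by (rule lborel_integrable_affine[THEN iffD2]) (use \<epsilon> gauss_integrable in \<open>auto intro: integrable_of_real\<close>)
    then have "integrable lborel (\<lambda>\<xi>::real^'n. gauss (\<epsilon> *\<^sub>R \<xi>))"
      by (simp add: complex_of_real_integrable_eq)
    then show ?thesis by (rule integrable_divide_zero)
  qed
  have int: "integrable (lborel \<Otimes>\<^sub>M lborel) (case_prod ?F)"
  proof (rule integrable_pair_bounded)
    show "integrable lborel (\<lambda>\<xi>::real^'n. gauss (\<epsilon> *\<^sub>R \<xi>) / c)" by (rule gi)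
    show "integrable lborel (\<lambda>y. norm (f y))" using test_integrable[OF f] by simp
    show "norm (case_prod ?F (\<xi>, y)) \<le> gauss (\<epsilon> *\<^sub>R \<xi>) / c * norm (f y)" for \<xi> y
      using gauss_nonneg[of "\<epsilon> *\<^sub>R \<xi>"] c by (simp add: norm_mult norm_divide mult.commute)
  qed measurable
  have "fourier f \<xi> * cis (x \<bullet> \<xi>) * of_real (c * gauss (\<epsilon> *\<^sub>R \<xi>)) = (LINT y|lborel. ?F \<xi> y)" for \<xi>
  proof -
    have "(LINT y|lborel. ?F \<xi> y) = (LINT y|lborel. (f y * cis (- (y \<bullet> \<xi>))) * (cis (x \<bullet> \<xi>) * of_real (gauss (\<epsilon> *\<^sub>R \<xi>) / c)))"
      by (intro Bochner_Integration.integral_cong refl) (simp add: cis_mult inner_diff_left)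
    also have "\<dots> = (LINT y|lborel. f y * cis (- (y \<bullet> \<xi>))) * (cis (x \<bullet> \<xi>) * of_real (gauss (\<epsilon> *\<^sub>R \<xi>) / c))"
      by simp
    finally have F: "(LINT y|lborel. ?F \<xi> y) = (LINT y|lborel. f y * cis (- (y \<bullet> \<xi>))) * (cis (x \<bullet> \<xi>) * of_real (gauss (\<epsilon> *\<^sub>R \<xi>) / c))" .
    have "fourier f \<xi> = (LINT y|lborel. f y * cis (- (y \<bullet> \<xi>))) / (of_real c * of_real c)"
      unfolding of_real_mult[symmetric] c(2) by (rule fourier_lborel) measurable
    then show ?thesis unfolding F using c(1) by simp
  qed
  then have "(LINT \<xi>|lborel. fourier f \<xi> * cis (x \<bullet> \<xi>) * of_real (c * gauss (\<epsilon> *\<^sub>R \<xi>))) = (LINT \<xi>|lborel. LINT y|lborel. ?F \<xi> y)"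
    by simp
  also have "\<dots> = (LINT y|lborel. LINT \<xi>|lborel. ?F \<xi> y)"
    by (rule lborel_pair.Fubini_integral[OF int, symmetric])
  also have "\<dots> = (LINT y|lborel. f y * of_real (gauss ((1 / \<epsilon>) *\<^sub>R (y - x)) / \<epsilon> ^ CARD('n)))"
  proof (intro Bochner_Integration.integral_cong refl)
    fix y
    let ?H = "\<lambda>\<xi>. cis ((x - y) \<bullet> \<xi>) * of_real (gauss (\<epsilon> *\<^sub>R \<xi>))"
    have "(LINT \<xi>|lborel. ?H \<xi>) = of_real (\<bar>1 / \<epsilon>\<bar> ^ DIM(real ^ 'n)) * (LINT \<xi>|lborel. ?H (0 + (1 / \<epsilon>) *\<^sub>R \<xi>))"
      using \<epsilon> by (intro lborel_integral_affine) auto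
    also have "(LINT \<xi>|lborel. ?H (0 + (1 / \<epsilon>) *\<^sub>R \<xi>)) = (LINT w|lborel. of_real (gauss w) * cis (w \<bullet> ((1 / \<epsilon>) *\<^sub>R (x - y))))"
      using \<epsilon> by (intro Bochner_Integration.integral_cong refl) (simp add: inner_commute mult.commute)
    also have "\<dots> = of_real (c * gauss ((1 / \<epsilon>) *\<^sub>R (x - y)))" unfolding c_def by (rule gauss_char)
    also have "gauss ((1 / \<epsilon>) *\<^sub>R (x - y)) = gauss ((1 / \<epsilon>) *\<^sub>R (y - x))"
      using gauss_minus[of "(1 / \<epsilon>) *\<^sub>R (y - x)"] by (simp add: algebra_simps)
    finally have H: "(LINT \<xi>|lborel. ?H \<xi>) = of_real (c * gauss ((1 / \<epsilon>) *\<^sub>R (y - x)) / \<epsilon> ^ CARD('n))"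
      using \<epsilon> by (simp add: power_inverse divide_inverse mult_ac)
    have "(LINT \<xi>|lborel. ?F \<xi> y) = (LINT \<xi>|lborel. (f y / of_real c) * ?H \<xi>)"
      by (intro Bochner_Integration.integral_cong refl) simp
    also have "\<dots> = (f y / of_real c) * (LINT \<xi>|lborel. ?H \<xi>)" by (rule integral_mult_right_zero)
    finally show "(LINT \<xi>|lborel. ?F \<xi> y) = f y * of_real (gauss ((1 / \<epsilon>) *\<^sub>R (y - x)) / \<epsilon> ^ CARD('n))"
      unfolding H using c by simp
  qed
  also have "\<dots> = of_real (\<bar>\<epsilon>\<bar> ^ DIM(real ^ 'n)) * (LINT v|lborel. f (x + \<epsilon> *\<^sub>R v) * of_real (gauss ((1 / \<epsilon>) *\<^sub>R ((x + \<epsilon> *\<^sub>R v) - x)) / \<epsilon> ^ CARD('n)))"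
    using \<epsilon> by (intro lborel_integral_affine) auto
  also have "\<dots> = (LINT v|lborel. of_real (\<epsilon> ^ CARD('n)) * (f (x + \<epsilon> *\<^sub>R v) * of_real (gauss ((1 / \<epsilon>) *\<^sub>R ((x + \<epsilon> *\<^sub>R v) - x)) / \<epsilon> ^ CARD('n))))"
    using \<epsilon> by simp
  also have "\<dots> = (LINT v|lborel. f (x + \<epsilon> *\<^sub>R v) * of_real (gauss v))"
    using \<epsilon> by (intro Bochner_Integration.integral_cong refl) simp
  finally show ?thesis by (simp add: c_def)
qed

text \<open>Both sides of \<open>gauss_regularization\<close> converge as \<open>\<epsilon>\<close>
  tends to 0: the left is dominated by the integrable \<open>norm (fourier f \<xi>)\<close>, the
  right by a multiple of \<open>gauss\<close>, whose total mass is 1.\<close>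

lemma fourier_inversion:
  fixes f :: "real ^ 'n \<Rightarrow> complex"
  assumes f: "f \<in> test_functions"
  shows "(LINT \<xi>|lborel. fourier f \<xi> * cis (x \<bullet> \<xi>)) = f x"
proof -
  have [measurable]: "f \<in> borel_measurable borel" by (rule test_measurable[OF f])
  have [measurable]: "fourier f \<in> borel_measurable borel" by (intro fourier_measurable) measurable
  define c where "c = sqrt (2 * pi) ^ CARD('n)"
  define t where "t k = inverse (real (Suc k))" for k
  have t: "0 < t k" for k by (simp add: t_def)
  have t0: "t \<longlonglongrightarrow> 0" unfolding t_def by (rule LIMSEQ_inverse_real_of_nat)
  let ?F = "\<lambda>k \<xi>. fourier f \<xi> * cis (x \<bullet> \<xi>) * of_real (c * gauss (t k *\<^sub>R \<xi>))"
  have "(\<lambda>k. LINT \<xi>|lborel. ?F k \<xi>) \<longlonglongrightarrow>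
      (LINT \<xi>|lborel. fourier f \<xi> * cis (x \<bullet> \<xi>))"
  proof (rule integral_dominated_convergence[where w="\<lambda>\<xi>. norm (fourier f \<xi>)"])
    show "AE \<xi> in lborel. (\<lambda>k. ?F k \<xi>) \<longlonglongrightarrow> fourier f \<xi> * cis (x \<bullet> \<xi>)"
    proof (intro AE_I2)
      fix \<xi> :: "real ^ 'n"
      have "(\<lambda>k. t k *\<^sub>R \<xi>) \<longlonglongrightarrow> 0 *\<^sub>R \<xi>" by (intro tendsto_intros t0)
      then have "(\<lambda>k. gauss (t k *\<^sub>R \<xi>)) \<longlonglongrightarrow> gauss (0 *\<^sub>R \<xi>)"
        by (rule continuous_on_tendsto_compose[OF gauss_continuous]) auto
      then have "(\<lambda>k. ?F k \<xi>) \<longlonglongrightarrow>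
          fourier f \<xi> * cis (x \<bullet> \<xi>) * of_real (c * gauss (0 *\<^sub>R \<xi>))"
        by (intro tendsto_intros)
      then show "(\<lambda>k. ?F k \<xi>) \<longlonglongrightarrow> fourier f \<xi> * cis (x \<bullet> \<xi>)"
        using gauss_zero[where 'n='n] by (simp only: scaleR_zero_left c_def of_real_1 mult_1_right)
    qed
    show "AE \<xi> in lborel. norm (?F k \<xi>) \<le> norm (fourier f \<xi>)" for k
    proof (intro AE_I2)
      fix \<xi> :: "real ^ 'n"
      have "0 \<le> c" by (simp add: c_def)
      then have "\<bar>c * gauss (t k *\<^sub>R \<xi>)\<bar> \<le> 1"
        using gauss_nonneg[of "t k *\<^sub>R \<xi>"] gauss_le[of "t k *\<^sub>R \<xi>"] unfolding c_def by simp
      then have "norm (fourier f \<xi>) * \<bar>c * gauss (t k *\<^sub>R \<xi>)\<bar> \<le> norm (fourier f \<xi>) * 1"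
        by (intro mult_left_mono) auto
      then show "norm (?F k \<xi>) \<le> norm (fourier f \<xi>)"
        by (simp only: norm_mult norm_cis norm_of_real mult_1_right)
    qed
    show "integrable lborel (\<lambda>\<xi>. norm (fourier f \<xi>))" using fourier_integrable[OF f] by simp
  qed measurable
  moreover have "(\<lambda>k. LINT v|lborel. f (x + t k *\<^sub>R v) * of_real (gauss v)) \<longlonglongrightarrow> (LINT v|lborel. f x * of_real (gauss (v :: real ^ 'n)))"
  proof -
    obtain R B where B: "0 \<le> B" "\<And>x. norm (f x) \<le> B * indicator (cball 0 R) x"
      using test_bounded[OF f] by blast
    have B': "norm (f y) \<le> B" for y using B(2)[of y] B(1) by (cases "y \<in> cball 0 R") auto
    show ?thesis
    proof (rule integral_dominated_convergence[where w="\<lambda>v. B * gauss v"])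
      show "AE v in lborel. (\<lambda>k. f (x + t k *\<^sub>R v) * of_real (gauss v)) \<longlonglongrightarrow> f x * of_real (gauss v)"
      proof (intro AE_I2 tendsto_mult tendsto_const)
        fix v :: "real ^ 'n"
        have "(\<lambda>k. x + t k *\<^sub>R v) \<longlonglongrightarrow> x + 0 *\<^sub>R v" by (intro tendsto_intros t0)
        then have "(\<lambda>k. f (x + t k *\<^sub>R v)) \<longlonglongrightarrow> f (x + 0 *\<^sub>R v)"
          by (rule continuous_on_tendsto_compose[OF test_continuous[OF f]]) auto
        then show "(\<lambda>k. f (x + t k *\<^sub>R v)) \<longlonglongrightarrow> f x" by simp
      qed
      show "AE v in lborel. norm (f (x + t k *\<^sub>R v) * of_real (gauss v)) \<le> B * gauss v" for k
      proof (intro AE_I2)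
        show "norm (f (x + t k *\<^sub>R v) * of_real (gauss v)) \<le> B * gauss v" for v :: "real ^ 'n"
          using mult_right_mono[OF B', of "gauss v"] gauss_nonneg[of v] by (simp add: norm_mult)
      qed
      show "integrable lborel (\<lambda>v::real^'n. B * gauss v)" by (intro integrable_mult_right gauss_integrable)
    qed measurable
  qed
  moreover have "(LINT v|lborel. f x * of_real (gauss (v :: real ^ 'n))) = f x"
    by (simp add: gauss_integral)
  ultimately show ?thesis
    using gauss_regularization[OF f t, of x] LIMSEQ_unique unfolding c_def by fastforce
qed

section \<open>Translations and products in frequency space\<close>

lemma test_translation_L1:
  fixes \<phi> :: "real ^ 'n \<Rightarrow> complex"
  assumes \<phi>: "\<phi> \<in> test_functions" and y: "y \<longlonglongrightarrow> 0"
  shows "(\<lambda>k. LINT \<xi>|lborel. norm (\<phi> (\<xi> - y k) - \<phi> \<xi>)) \<longlonglongrightarrow> 0"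
proof -
  have [measurable]: "\<phi> \<in> borel_measurable borel" by (rule test_measurable[OF \<phi>])
  obtain R B where B: "0 \<le> R" "0 \<le> B" "\<And>x. norm (\<phi> x) \<le> B * indicator (cball 0 R) x"
    using test_bounded[OF \<phi>] by blast
  \<comment> \<open>A convergent sequence of shifts is bounded, so all the translates live in one
    ball and a multiple of its indicator dominates the differences.\<close>
  obtain M where M: "0 < M" "\<And>k. norm (y k) \<le> M"
    using convergent_imp_Bseq[of y] y unfolding convergent_def Bseq_def by blast
  have le: "norm (\<phi> (\<xi> - y k) - \<phi> \<xi>) \<le> 2 * B * indicator (cball 0 (R + M)) \<xi>" for k \<xi>
  proof (cases "\<xi> \<in> cball 0 (R + M)")
    case True
    have "norm (\<phi> x) \<le> B" for x using B(3)[of x] B(2) by (cases "x \<in> cball 0 R") auto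
    then have "norm (\<phi> (\<xi> - y k)) + norm (\<phi> \<xi>) \<le> B + B" by (intro add_mono)
    then show ?thesis using True norm_triangle_ineq4[of "\<phi> (\<xi> - y k)" "\<phi> \<xi>"] by simp
  next
    case False
    then have "norm (\<xi> - y k) > R" "norm \<xi> > R"
      using norm_triangle_ineq2[of \<xi> "y k"] M(1) M(2)[of k] by auto
    then show ?thesis using B(3)[of "\<xi> - y k"] B(3)[of \<xi>] False by simp
  qed
  have "(\<lambda>k. LINT \<xi>|lborel. norm (\<phi> (\<xi> - y k) - \<phi> \<xi>)) \<longlonglongrightarrow> integral\<^sup>L (lborel :: (real ^ 'n) measure) (\<lambda>\<xi>. 0)"
  proof (rule integral_dominated_convergence[where w="\<lambda>\<xi>. 2 * B * indicator (cball 0 (R + M)) \<xi>"])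
    show "integrable lborel (\<lambda>\<xi>::real^'n. 2 * B * indicator (cball 0 (R + M)) \<xi> :: real)"
      by (rule integrable_indicator_cball)
    show "AE \<xi> in lborel. (\<lambda>k. norm (\<phi> (\<xi> - y k) - \<phi> \<xi>)) \<longlonglongrightarrow> 0"
    proof (intro AE_I2)
      fix \<xi>
      have "(\<lambda>k. \<xi> - y k) \<longlonglongrightarrow> \<xi> - 0" by (intro tendsto_intros y)
      then have "(\<lambda>k. \<phi> (\<xi> - y k)) \<longlonglongrightarrow> \<phi> (\<xi> - 0)"
        by (rule continuous_on_tendsto_compose[OF test_continuous[OF \<phi>]]) auto
      then have "(\<lambda>k. norm (\<phi> (\<xi> - y k) - \<phi> \<xi>)) \<longlonglongrightarrow> norm (\<phi> (\<xi> - 0) - \<phi> \<xi>)" by (intro tendsto_intros)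
      then show "(\<lambda>k. norm (\<phi> (\<xi> - y k) - \<phi> \<xi>)) \<longlonglongrightarrow> 0" by simp
    qed
    show "AE \<xi> in lborel. norm (norm (\<phi> (\<xi> - y k) - \<phi> \<xi>)) \<le> 2 * B * indicator (cball 0 (R + M)) \<xi>" for k
      using le by (intro AE_I2) simp
  qed measurable
  then show ?thesis by simp
qed

text \<open>A three-epsilon argument from density of the test functions at exponent 1; translation
  invariance makes the error of the shifted approximation equal to that of the unshifted
  one.\<close>

lemma L1_translation:
  fixes h :: "real ^ 'n \<Rightarrow> complex"
  assumes h: "integrable lborel h" and y: "y \<longlonglongrightarrow> 0"
  shows "(\<lambda>k. LINT \<xi>|lborel. norm (h (\<xi> - y k) - h \<xi>)) \<longlonglongrightarrow> 0"
proof (rule LIMSEQ_I)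
  have [measurable]: "h \<in> borel_measurable borel" using borel_measurable_integrable[OF h] by simp
  fix e :: real assume "0 < e"
  have hLp: "h \<in> Lp 1" using h by (simp add: Lp_def integrable_completion measurable_completion)
  obtain \<phi> where \<phi>: "\<phi> \<in> test_functions" "Lp_norm 1 (\<lambda>x. h x - \<phi> x) < e / 3"
    by (rule test_dense[OF _ hLp, of "e / 3"]) (use \<open>0 < e\<close> in auto)
  have [measurable]: "\<phi> \<in> borel_measurable borel" by (rule test_measurable[OF \<phi>(1)])
  have \<phi>i: "integrable lborel \<phi>" by (rule test_integrable[OF \<phi>(1)])
  have near: "(LINT x|lborel. norm (h x - \<phi> x)) < e / 3"
    using \<phi>(2) by (simp add: Lp_norm_def integral_completion)
  obtain N where N: "\<And>k. N \<le> k \<Longrightarrow> norm ((LINT \<xi>|lborel. norm (\<phi> (\<xi> - y k) - \<phi> \<xi>)) - 0) < e / 3"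
    using LIMSEQ_D[OF test_translation_L1[OF \<phi>(1) y], of "e / 3"] \<open>0 < e\<close> by auto
  have "norm ((LINT \<xi>|lborel. norm (h (\<xi> - y k) - h \<xi>)) - 0) < e" if "N \<le> k" for k
  proof -
    have sh: "integrable lborel (\<lambda>\<xi>. g (\<xi> - y k))" if "integrable lborel g" for g :: "real ^ 'n \<Rightarrow> complex"
      using lborel_integrable_affine[of g 1 "- y k"] that borel_measurable_integrable[OF that] by simp
    have hd: "integrable lborel (\<lambda>\<xi>. h \<xi> - \<phi> \<xi>)" using h \<phi>i by simp
    have "(LINT \<xi>|lborel. norm (h (\<xi> - y k) - \<phi> (\<xi> - y k))) = (LINT \<xi>|lborel. norm (h \<xi> - \<phi> \<xi>))"
    proof -
      have "complex_of_real (LINT \<xi>|lborel. norm (h (\<xi> - y k) - \<phi> (\<xi> - y k))) = of_real (LINT \<xi>|lborel. norm (h \<xi> - \<phi> \<xi>))"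
        using lborel_integral_translate[of "\<lambda>\<xi>. of_real (norm (h \<xi> - \<phi> \<xi>))" "- y k"] by simp
      then show ?thesis by (simp only: of_real_eq_iff)
    qed
    moreover let ?R = "\<lambda>\<xi>. norm (h (\<xi> - y k) - \<phi> (\<xi> - y k)) + norm (\<phi> (\<xi> - y k) - \<phi> \<xi>) + norm (h \<xi> - \<phi> \<xi>)"
    have "(LINT \<xi>|lborel. norm (h (\<xi> - y k) - h \<xi>)) \<le>
      (LINT \<xi>|lborel. ?R \<xi>)"
    proof (rule integral_mono)
      show "integrable lborel (\<lambda>\<xi>. norm (h (\<xi> - y k) - h \<xi>))" using sh[OF h] h by simp
      show "integrable lborel (\<lambda>\<xi>. ?R \<xi>)"
        using sh[OF h] sh[OF \<phi>i] h \<phi>i by simp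
      show "norm (h (\<xi> - y k) - h \<xi>) \<le> ?R \<xi>" for \<xi>
        using norm_triangle_ineq[of "h (\<xi> - y k) - \<phi> (\<xi> - y k)" "\<phi> (\<xi> - y k) - \<phi> \<xi>"]
          norm_triangle_ineq4[of "h (\<xi> - y k) - \<phi> \<xi>" "h \<xi> - \<phi> \<xi>"] by simp
    qed
    moreover have "(LINT \<xi>|lborel. ?R \<xi>) =
      (LINT \<xi>|lborel. norm (h (\<xi> - y k) - \<phi> (\<xi> - y k))) + (LINT \<xi>|lborel. norm (\<phi> (\<xi> - y k) - \<phi> \<xi>)) + (LINT \<xi>|lborel. norm (h \<xi> - \<phi> \<xi>))"
      using sh[OF h] sh[OF \<phi>i] h \<phi>i by simp
    moreover have "(LINT \<xi>|lborel. norm (\<phi> (\<xi> - y k) - \<phi> \<xi>)) < e / 3" using N[OF that] by simp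
    moreover have "0 \<le> (LINT \<xi>|lborel. norm (h (\<xi> - y k) - h \<xi>))" by simp
    ultimately show ?thesis using near unfolding real_norm_def by linarith
  qed
  then show "\<exists>N. \<forall>k\<ge>N. norm ((LINT \<xi>|lborel. norm (h (\<xi> - y k) - h \<xi>)) - 0) < e" by blast
qed

text \<open>A product transforms into a convolution, and the dilation by \<open>t\<close> turns it
  into an average of translates of \<open>h\<close> by \<open>t *\<^sub>R v\<close> with weight
  \<open>fourier \<theta> v\<close>.\<close>

lemma fourier_cutoff_product:
  fixes \<theta> h :: "real ^ 'n \<Rightarrow> complex"
  assumes \<theta>: "\<theta> \<in> test_functions" and h: "integrable lborel h" and t: "0 < t"
    and meas: "(\<lambda>x. \<theta> (t *\<^sub>R x) * (LINT \<eta>|lborel. h \<eta> * cis (x \<bullet> \<eta>))) \<in> borel_measurable borel"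
  shows "fourier (\<lambda>x. \<theta> (t *\<^sub>R x) * (LINT \<eta>|lborel. h \<eta> * cis (x \<bullet> \<eta>))) \<xi> =
    (LINT v|lborel. fourier \<theta> v * h (\<xi> - t *\<^sub>R v))"
proof -
  have [measurable]: "h \<in> borel_measurable borel" "\<theta> \<in> borel_measurable borel"
    using borel_measurable_integrable[OF h] test_measurable[OF \<theta>] by simp_all
  have [measurable]: "fourier \<theta> \<in> borel_measurable borel" by (intro fourier_measurable) measurable
  define c where "c = complex_of_real ((2 * pi) ^ CARD('n))"
  have c: "c \<noteq> 0" by (simp add: c_def)
  let ?F = "\<lambda>x \<eta>. \<theta> (t *\<^sub>R x) * h \<eta> * cis (- (x \<bullet> (\<xi> - \<eta>)))"
  have \<theta>t: "integrable lborel (\<lambda>x. \<theta> (t *\<^sub>R x))"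
    using lborel_integrable_affine[of \<theta> t 0] t test_integrable[OF \<theta>] by simp
  have int: "integrable (lborel \<Otimes>\<^sub>M lborel) (case_prod ?F)"
  proof (rule integrable_pair_bounded)
    show "integrable lborel (\<lambda>x. norm (\<theta> (t *\<^sub>R x)))" using \<theta>t by simp
    show "integrable lborel (\<lambda>x. norm (h x))" using h by simp
  qed (measurable, simp add: norm_mult)
  have "c * fourier (\<lambda>x. \<theta> (t *\<^sub>R x) * (LINT \<eta>|lborel. h \<eta> * cis (x \<bullet> \<eta>))) \<xi> =
      (LINT x|lborel. \<theta> (t *\<^sub>R x) * (LINT \<eta>|lborel. h \<eta> * cis (x \<bullet> \<eta>)) * cis (- (x \<bullet> \<xi>)))"
    using c by (simp add: fourier_lborel[OF meas] c_def)
  also have "\<dots> = (LINT x|lborel. LINT \<eta>|lborel. ?F x \<eta>)"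
  proof (intro Bochner_Integration.integral_cong refl)
    fix x
    have "(LINT \<eta>|lborel. ?F x \<eta>) = (LINT \<eta>|lborel. (\<theta> (t *\<^sub>R x) * cis (- (x \<bullet> \<xi>))) * (h \<eta> * cis (x \<bullet> \<eta>)))"
      by (intro Bochner_Integration.integral_cong refl) (simp add: cis_mult inner_diff_right)
    also have "\<dots> = (\<theta> (t *\<^sub>R x) * cis (- (x \<bullet> \<xi>))) * (LINT \<eta>|lborel. h \<eta> * cis (x \<bullet> \<eta>))"
      by (rule integral_mult_right_zero)
    finally show "\<theta> (t *\<^sub>R x) * (LINT \<eta>|lborel. h \<eta> * cis (x \<bullet> \<eta>)) * cis (- (x \<bullet> \<xi>)) = (LINT \<eta>|lborel. ?F x \<eta>)"
      by (simp only: mult_ac)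
  qed
  also have "\<dots> = (LINT \<eta>|lborel. LINT x|lborel. ?F x \<eta>)"
    by (rule lborel_pair.Fubini_integral[OF int, symmetric])
  also have "\<dots> = (LINT \<eta>|lborel. c / of_real (t ^ CARD('n)) * (h \<eta> * fourier \<theta> ((1 / t) *\<^sub>R (\<xi> - \<eta>))))"
  proof (intro Bochner_Integration.integral_cong refl)
    fix \<eta>
    let ?H = "\<lambda>x. \<theta> (t *\<^sub>R x) * cis (- (x \<bullet> (\<xi> - \<eta>)))"
    have "(LINT x|lborel. ?H x) = of_real (\<bar>1 / t\<bar> ^ DIM(real ^ 'n)) * (LINT x|lborel. ?H (0 + (1 / t) *\<^sub>R x))"
      using t by (intro lborel_integral_affine) auto
    also have "(LINT x|lborel. ?H (0 + (1 / t) *\<^sub>R x)) = (LINT x|lborel. \<theta> x * cis (- (x \<bullet> ((1 / t) *\<^sub>R (\<xi> - \<eta>)))))"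
      using t by (intro Bochner_Integration.integral_cong refl) simp
    also have "\<dots> = c * fourier \<theta> ((1 / t) *\<^sub>R (\<xi> - \<eta>))"
      by (subst fourier_lborel) (simp_all add: c_def)
    finally have H: "(LINT x|lborel. ?H x) = c / of_real (t ^ CARD('n)) * fourier \<theta> ((1 / t) *\<^sub>R (\<xi> - \<eta>))"
      using t by (simp add: power_inverse divide_inverse mult_ac)
    have "(LINT x|lborel. ?F x \<eta>) = (LINT x|lborel. h \<eta> * ?H x)"
      by (simp only: mult_ac)
    also have "\<dots> = h \<eta> * (LINT x|lborel. ?H x)" by (rule integral_mult_right_zero)
    finally show "(LINT x|lborel. ?F x \<eta>) = c / of_real (t ^ CARD('n)) * (h \<eta> * fourier \<theta> ((1 / t) *\<^sub>R (\<xi> - \<eta>)))"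
      unfolding H by (simp only: mult_ac)
  qed
  also have "\<dots> = c / of_real (t ^ CARD('n)) * (LINT \<eta>|lborel. h \<eta> * fourier \<theta> ((1 / t) *\<^sub>R (\<xi> - \<eta>)))"
    by (rule integral_mult_right_zero)
  \<comment> \<open>Substitution with factor \<open>- t\<close>; its Jacobian cancels the power of
    \<open>t\<close> left by the dilation.\<close>
  also have "(LINT \<eta>|lborel. h \<eta> * fourier \<theta> ((1 / t) *\<^sub>R (\<xi> - \<eta>))) =
      of_real (\<bar>- t\<bar> ^ DIM(real ^ 'n)) * (LINT v|lborel. h (\<xi> + (- t) *\<^sub>R v) * fourier \<theta> ((1 / t) *\<^sub>R (\<xi> - (\<xi> + (- t) *\<^sub>R v))))"
    using t by (intro lborel_integral_affine) auto
  also have "\<dots> = of_real (t ^ CARD('n)) * (LINT v|lborel. fourier \<theta> v * h (\<xi> - t *\<^sub>R v))"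
    using t by (simp add: mult.commute)
  finally have "c * fourier (\<lambda>x. \<theta> (t *\<^sub>R x) * (LINT \<eta>|lborel. h \<eta> * cis (x \<bullet> \<eta>))) \<xi> =
      c * (LINT v|lborel. fourier \<theta> v * h (\<xi> - t *\<^sub>R v))"
    using t by simp
  then show ?thesis using c by simp
qed

text \<open>With the integrals exchanged, each inner integral tends to the one without shift by
  continuity of translations, and the remaining weight integrates to \<open>\<theta> 0\<close> by
  Fourier inversion at the origin. No pointwise regularity of \<open>h\<close> enters, which matters
  because it will contain a measurable multiplier.\<close>

lemma integral_cutoff_limit:
  fixes \<theta> h k :: "real ^ 'n \<Rightarrow> complex"
  assumes \<theta>: "\<theta> \<in> test_functions" and h: "integrable lborel h" and t: "t \<longlonglongrightarrow> 0"
    and [measurable]: "k \<in> borel_measurable borel" and K: "\<And>\<xi>. norm (k \<xi>) \<le> K"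
  shows "(\<lambda>j. LINT \<xi>|lborel. k \<xi> * (LINT v|lborel. fourier \<theta> v * h (\<xi> - t j *\<^sub>R v))) \<longlonglongrightarrow>
    \<theta> 0 * (LINT \<xi>|lborel. k \<xi> * h \<xi>)"
proof -
  have [measurable]: "h \<in> borel_measurable borel" "\<theta> \<in> borel_measurable borel"
    using borel_measurable_integrable[OF h] test_measurable[OF \<theta>] by simp_all
  have [measurable]: "fourier \<theta> \<in> borel_measurable borel" by (intro fourier_measurable) measurable
  have \<theta>i: "integrable lborel (fourier \<theta>)" by (rule fourier_integrable[OF \<theta>])
  have K0: "0 \<le> K" using K[of 0] norm_ge_zero order_trans by blast
  define L where "L = (LINT \<xi>|lborel. norm (h \<xi>))"
  have sh: "integrable lborel (\<lambda>\<xi>. h (\<xi> - y))" for y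
    using lborel_integrable_affine[of h 1 "- y"] h by simp
  have shL: "(LINT \<xi>|lborel. norm (h (\<xi> - y))) = L" for y
  proof -
    have "complex_of_real (LINT \<xi>|lborel. norm (h (\<xi> - y))) = of_real L"
      using lborel_integral_translate[of "\<lambda>\<xi>. of_real (norm (h \<xi>))" "- y"] by (simp add: L_def)
    then show ?thesis by (simp only: of_real_eq_iff)
  qed
  have kint: "integrable lborel (\<lambda>\<xi>. k \<xi> * h (\<xi> - y))" for y
    by (rule Bochner_Integration.integrable_bound[OF integrable_mult_right[OF sh[of y], of "of_real K"]])
       (use K K0 in \<open>auto simp: norm_mult intro!: mult_right_mono\<close>)
  have knint: "integrable lborel (\<lambda>\<xi>. norm (k \<xi>) * norm (h (\<xi> - y)))" for y
    using integrable_norm[OF kint[of y]] by (simp add: norm_mult)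
  have kle: "norm (LINT \<xi>|lborel. k \<xi> * h (\<xi> - y)) \<le> K * L" for y
  proof -
    have "norm (LINT \<xi>|lborel. k \<xi> * h (\<xi> - y)) \<le> (LINT \<xi>|lborel. norm (k \<xi> * h (\<xi> - y)))"
      by (rule integral_norm_bound)
    also have "\<dots> \<le> (LINT \<xi>|lborel. K * norm (h (\<xi> - y)))"
      using knint sh K by (intro integral_mono) (auto simp: norm_mult intro!: mult_right_mono)
    also have "\<dots> = K * L" by (simp add: shL)
    finally show ?thesis .
  qed
  have swap: "(LINT \<xi>|lborel. k \<xi> * (LINT v|lborel. fourier \<theta> v * h (\<xi> - s *\<^sub>R v))) =
      (LINT v|lborel. fourier \<theta> v * (LINT \<xi>|lborel. k \<xi> * h (\<xi> - s *\<^sub>R v)))" for s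
  proof -
    let ?F = "\<lambda>v \<xi>. fourier \<theta> v * (k \<xi> * h (\<xi> - s *\<^sub>R v))"
    \<comment> \<open>\<open>h (\<xi> - s *\<^sub>R v)\<close> couples the two variables, so the
      majorant is not sought in product form: integrating over \<open>\<xi>\<close> first removes
      the shift and leaves at most \<open>norm (fourier \<theta> v) * (K * L)\<close>.\<close>
    have int: "integrable (lborel \<Otimes>\<^sub>M lborel) (case_prod ?F)"
    proof (rule lborel_pair.Fubini_integrable)
      show "integrable lborel (\<lambda>v. LINT \<xi>|lborel. norm (case (v, \<xi>) of (v, \<xi>) \<Rightarrow> ?F v \<xi>))"
      proof (rule Bochner_Integration.integrable_bound)
        show "integrable lborel (\<lambda>v. norm (fourier \<theta> v) * (K * L))" using \<theta>i by simp
        show "AE v in lborel. norm (LINT \<xi>|lborel. norm (case (v, \<xi>) of (v, \<xi>) \<Rightarrow> ?F v \<xi>)) \<le> norm (norm (fourier \<theta> v) * (K * L))"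
        proof (intro AE_I2)
          fix v
          have "(LINT \<xi>|lborel. norm (?F v \<xi>)) \<le> (LINT \<xi>|lborel. norm (fourier \<theta> v) * (K * norm (h (\<xi> - s *\<^sub>R v))))"
            using knint sh K
            by (intro integral_mono) (auto simp: norm_mult intro!: mult_left_mono mult_right_mono)
          also have "\<dots> = norm (fourier \<theta> v) * (K * L)" by (simp add: shL)
          finally show "norm (LINT \<xi>|lborel. norm (case (v, \<xi>) of (v, \<xi>) \<Rightarrow> ?F v \<xi>)) \<le> norm (norm (fourier \<theta> v) * (K * L))"
            by (simp add: abs_of_nonneg)
        qed
      qed measurable
      show "AE v in lborel. integrable lborel (\<lambda>\<xi>. case (v, \<xi>) of (v, \<xi>) \<Rightarrow> ?F v \<xi>)"
        using kint by (intro AE_I2) simp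
    qed measurable
    have "(LINT \<xi>|lborel. k \<xi> * (LINT v|lborel. fourier \<theta> v * h (\<xi> - s *\<^sub>R v))) = (LINT \<xi>|lborel. LINT v|lborel. ?F v \<xi>)"
      by (simp add: mult.left_commute)
    also have "\<dots> = (LINT v|lborel. LINT \<xi>|lborel. ?F v \<xi>)"
      by (rule lborel_pair.Fubini_integral[OF int])
    finally show ?thesis by simp
  qed
  have "(\<lambda>j. LINT v|lborel. fourier \<theta> v * (LINT \<xi>|lborel. k \<xi> * h (\<xi> - t j *\<^sub>R v))) \<longlonglongrightarrow>
      (LINT v|lborel. fourier \<theta> v * (LINT \<xi>|lborel. k \<xi> * h \<xi>))"
  proof (rule integral_dominated_convergence[where w="\<lambda>v. norm (fourier \<theta> v) * (K * L)"])
    show "integrable lborel (\<lambda>v. norm (fourier \<theta> v) * (K * L))" using \<theta>i by simp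
    show "AE v in lborel. norm (fourier \<theta> v * (LINT \<xi>|lborel. k \<xi> * h (\<xi> - t j *\<^sub>R v))) \<le> norm (fourier \<theta> v) * (K * L)" for j
      by (intro AE_I2) (simp only: norm_mult mult_left_mono[OF kle] norm_ge_zero)
    show "AE v in lborel. (\<lambda>j. fourier \<theta> v * (LINT \<xi>|lborel. k \<xi> * h (\<xi> - t j *\<^sub>R v))) \<longlonglongrightarrow> fourier \<theta> v * (LINT \<xi>|lborel. k \<xi> * h \<xi>)"
    proof (intro AE_I2 tendsto_mult tendsto_const)
      fix v :: "real ^ 'n"
      have "(\<lambda>j. t j *\<^sub>R v) \<longlonglongrightarrow> 0 *\<^sub>R v" by (intro tendsto_intros t)
      then have "(\<lambda>j. LINT \<xi>|lborel. norm (h (\<xi> - t j *\<^sub>R v) - h \<xi>)) \<longlonglongrightarrow> 0"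
        by (intro L1_translation h) simp
      then have lim: "(\<lambda>j. K * (LINT \<xi>|lborel. norm (h (\<xi> - t j *\<^sub>R v) - h \<xi>))) \<longlonglongrightarrow> 0"
        by (rule tendsto_mult_right_zero)
      have le: "norm ((LINT \<xi>|lborel. k \<xi> * h (\<xi> - t j *\<^sub>R v)) - (LINT \<xi>|lborel. k \<xi> * h \<xi>)) \<le>
          K * (LINT \<xi>|lborel. norm (h (\<xi> - t j *\<^sub>R v) - h \<xi>))" for j
      proof -
        have i0: "integrable lborel (\<lambda>\<xi>. k \<xi> * h \<xi>)" using kint[of 0] by simp
        have "(LINT \<xi>|lborel. k \<xi> * h (\<xi> - t j *\<^sub>R v)) - (LINT \<xi>|lborel. k \<xi> * h \<xi>) =
            (LINT \<xi>|lborel. k \<xi> * h (\<xi> - t j *\<^sub>R v) - k \<xi> * h \<xi>)"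
          using kint i0 by simp
        also have "norm \<dots> \<le> (LINT \<xi>|lborel. norm (k \<xi> * h (\<xi> - t j *\<^sub>R v) - k \<xi> * h \<xi>))"
          by (rule integral_norm_bound)
        also have "\<dots> \<le> (LINT \<xi>|lborel. K * norm (h (\<xi> - t j *\<^sub>R v) - h \<xi>))"
        proof (rule integral_mono)
          show "integrable lborel (\<lambda>\<xi>. norm (k \<xi> * h (\<xi> - t j *\<^sub>R v) - k \<xi> * h \<xi>))" using kint i0 by simp
          show "integrable lborel (\<lambda>\<xi>. K * norm (h (\<xi> - t j *\<^sub>R v) - h \<xi>))" using sh h by simp
          show "norm (k \<xi> * h (\<xi> - t j *\<^sub>R v) - k \<xi> * h \<xi>) \<le> K * norm (h (\<xi> - t j *\<^sub>R v) - h \<xi>)" for \<xi>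
            by (simp only: right_diff_distrib[symmetric] norm_mult) (intro mult_right_mono K norm_ge_zero)
        qed
        finally show ?thesis by simp
      qed
      show "(\<lambda>j. LINT \<xi>|lborel. k \<xi> * h (\<xi> - t j *\<^sub>R v)) \<longlonglongrightarrow> (LINT \<xi>|lborel. k \<xi> * h \<xi>)"
        by (rule Lim_null[THEN iffD2], rule Lim_null_comparison[OF always_eventually lim]) (use le in blast)
    qed
  qed measurable
  moreover have "(LINT v|lborel. fourier \<theta> v * (LINT \<xi>|lborel. k \<xi> * h \<xi>)) = \<theta> 0 * (LINT \<xi>|lborel. k \<xi> * h \<xi>)"
    using fourier_inversion[OF \<theta>, of 0] by simp
  ultimately show ?thesis unfolding swap by (simp only:)
qed

section \<open>Multipliers on test functions\<close>

text \<open>Multipliers are only Lebesgue measurable, while the Fubini arguments concern Borel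
  functions. The real and imaginary parts are replaced separately.\<close>

lemma borel_version:
  fixes m :: "real ^ 'n \<Rightarrow> complex"
  assumes m: "m \<in> borel_measurable lebesgue" and K: "\<And>\<xi>. norm (m \<xi>) \<le> K"
  obtains m' where "m' \<in> borel_measurable borel" "\<And>\<xi>. norm (m' \<xi>) \<le> K" "AE \<xi> in lebesgue. m \<xi> = m' \<xi>"
proof -
  have "(\<lambda>\<xi>. Re (m \<xi>)) \<in> borel_measurable lebesgue" "(\<lambda>\<xi>. Im (m \<xi>)) \<in> borel_measurable lebesgue"
    using m by measurable
  from this[THEN completion_ex_borel_measurable_real]
  obtain a b where ab: "a \<in> borel_measurable lborel" "AE \<xi> in lborel. Re (m \<xi>) = a \<xi>"
    "b \<in> borel_measurable lborel" "AE \<xi> in lborel. Im (m \<xi>) = b \<xi>" by blast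
  have [measurable]: "a \<in> borel_measurable borel" "b \<in> borel_measurable borel" using ab by simp_all
  \<comment> \<open>The Borel parts can violate the bound on a null set; putting 0 there makes it
    hold everywhere.\<close>
  define m' where "m' \<xi> = (if norm (Complex (a \<xi>) (b \<xi>)) \<le> K then Complex (a \<xi>) (b \<xi>) else 0)" for \<xi>
  show ?thesis
  proof
    have "(\<lambda>\<xi>. Complex (a \<xi>) (b \<xi>)) = (\<lambda>\<xi>. of_real (a \<xi>) + \<i> * of_real (b \<xi>))"
      by (simp add: fun_eq_iff complex_eq_iff)
    then have [measurable]: "(\<lambda>\<xi>. Complex (a \<xi>) (b \<xi>)) \<in> borel_measurable borel" by simp
    show "m' \<in> borel_measurable borel" unfolding m'_def by measurable
    have "0 \<le> K" using K[of 0] norm_ge_zero order_trans by blast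
    then show "norm (m' \<xi>) \<le> K" for \<xi> by (simp add: m'_def)
    have "AE \<xi> in lborel. m \<xi> = m' \<xi>" using ab(2,4)
    proof eventually_elim
      case (elim \<xi>)
      then have "m \<xi> = Complex (a \<xi>) (b \<xi>)" by (simp add: complex_eq_iff)
      then show ?case using K[of \<xi>] by (simp add: m'_def)
    qed
    then show "AE \<xi> in lebesgue. m \<xi> = m' \<xi>" by (rule AE_completion)
  qed
qed

definition admissible :: "(real ^ 'n \<Rightarrow> complex) \<Rightarrow> bool" where
  "admissible m \<longleftrightarrow> m \<in> borel_measurable lebesgue \<and> bounded (range m)"

lemma admissibleI: "m \<in> borel_measurable lebesgue \<Longrightarrow> (\<And>\<xi>. norm (m \<xi>) \<le> K) \<Longrightarrow> admissible m"
  by (auto simp: admissible_def bounded_iff)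

lemma admissibleE:
  assumes "admissible m"
  obtains K where "0 \<le> K" "\<And>\<xi>. norm (m \<xi>) \<le> K"
proof -
  from assms obtain K where K: "\<And>\<xi>. norm (m \<xi>) \<le> K" by (auto simp: admissible_def bounded_iff)
  moreover have "0 \<le> K" using K[of 0] norm_ge_zero order_trans by blast
  ultimately show ?thesis using that by blast
qed

lemma admissible_const: "admissible (\<lambda>\<xi>. c)"
  by (rule admissibleI[of _ "norm c"]) auto

lemma admissible_add:
  assumes "admissible m1" "admissible m2"
  shows "admissible (\<lambda>\<xi>. m1 \<xi> + m2 \<xi>)"
proof -
  obtain K1 where K1: "\<And>\<xi>. norm (m1 \<xi>) \<le> K1" using assms(1) by (rule admissibleE) blast
  obtain K2 where K2: "\<And>\<xi>. norm (m2 \<xi>) \<le> K2" using assms(2) by (rule admissibleE) blast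
  have "norm (m1 \<xi> + m2 \<xi>) \<le> K1 + K2" for \<xi> by (intro norm_triangle_mono K1 K2)
  then show ?thesis using assms by (intro admissibleI) (auto simp: admissible_def)
qed

lemma admissible_mult:
  assumes "admissible m1" "admissible m2"
  shows "admissible (\<lambda>\<xi>. m1 \<xi> * m2 \<xi>)"
proof -
  obtain K1 where K1: "0 \<le> K1" "\<And>\<xi>. norm (m1 \<xi>) \<le> K1" using assms(1) by (rule admissibleE) blast
  obtain K2 where K2: "\<And>\<xi>. norm (m2 \<xi>) \<le> K2" using assms(2) by (rule admissibleE) blast
  have "norm (m1 \<xi> * m2 \<xi>) \<le> K1 * K2" for \<xi>
    unfolding norm_mult using K1 K2 by (intro mult_mono) auto
  then show ?thesis using assms by (intro admissibleI) (auto simp: admissible_def)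
qed

lemma multiplier_op_cis:
  "multiplier_op m f x = (LINT \<xi>|lebesgue. m \<xi> * fourier f \<xi> * cis (x \<bullet> \<xi>))"
  by (simp add: multiplier_op_def cis_conv_exp)

lemma multiplier_op_lborel:
  fixes m f :: "real ^ 'n \<Rightarrow> complex"
  assumes [measurable]: "m \<in> borel_measurable borel" and f: "f \<in> test_functions"
  shows "multiplier_op m f x = (LINT \<xi>|lborel. m \<xi> * fourier f \<xi> * cis (x \<bullet> \<xi>))"
proof -
  have [measurable]: "fourier f \<in> borel_measurable borel"
    by (intro fourier_measurable test_measurable f)
  show ?thesis unfolding multiplier_op_cis by (rule integral_completion) measurable
qed

lemma fourier_lebesgue_measurable:
  "f \<in> test_functions \<Longrightarrow> fourier f \<in> borel_measurable lebesgue"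
  by (intro measurable_completion) (simp add: fourier_measurable test_measurable)

lemma cis_lebesgue_measurable: "(\<lambda>\<xi>. cis (x \<bullet> \<xi>)) \<in> borel_measurable lebesgue"
  by (intro measurable_completion) measurable

lemma fourier_lebesgue_integrable:
  "f \<in> test_functions \<Longrightarrow> integrable lebesgue (fourier f)"
  by (subst integrable_completion)
     (auto simp: fourier_measurable test_measurable fourier_integrable)

lemma multiplier_integrand_measurable:
  "m \<in> borel_measurable lebesgue \<Longrightarrow> f \<in> test_functions \<Longrightarrow>
     (\<lambda>\<xi>. m \<xi> * fourier f \<xi> * cis (x \<bullet> \<xi>)) \<in> borel_measurable lebesgue"
  by (intro borel_measurable_times fourier_lebesgue_measurable cis_lebesgue_measurable)

lemma multiplier_integrand_integrable:
  assumes m: "admissible m" and f: "f \<in> test_functions"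
  shows "integrable lebesgue (\<lambda>\<xi>. m \<xi> * fourier f \<xi> * cis (x \<bullet> \<xi>))"
proof -
  obtain K where K: "0 \<le> K" "\<And>\<xi>. norm (m \<xi>) \<le> K" using m by (rule admissibleE) blast
  have "integrable lebesgue (\<lambda>\<xi>. of_real K * fourier f \<xi>)"
    by (intro integrable_mult_right fourier_lebesgue_integrable f)
  then show ?thesis
  proof (rule Bochner_Integration.integrable_bound)
    show "(\<lambda>\<xi>. m \<xi> * fourier f \<xi> * cis (x \<bullet> \<xi>)) \<in> borel_measurable lebesgue"
      using m f by (intro multiplier_integrand_measurable) (auto simp: admissible_def)
    show "AE \<xi> in lebesgue. norm (m \<xi> * fourier f \<xi> * cis (x \<bullet> \<xi>)) \<le> norm (of_real K * fourier f \<xi>)"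
      using K by (intro AE_I2) (simp add: norm_mult mult_right_mono)
  qed
qed

lemma multiplier_op_cong_AE:
  assumes "m \<in> borel_measurable lebesgue" "m' \<in> borel_measurable lebesgue" "f \<in> test_functions"
    and "AE \<xi> in lebesgue. m \<xi> = m' \<xi>"
  shows "multiplier_op m f = multiplier_op m' f"
proof
  fix x
  show "multiplier_op m f x = multiplier_op m' f x"
    unfolding multiplier_op_cis
    using assms by (intro integral_cong_AE multiplier_integrand_measurable) auto
qed

text \<open>Through continuity this yields the measurability that membership in \<open>Lp p\<close>
  demands. Passing to a Borel version of \<open>m\<close> leaves the operator unchanged at every
  point.\<close>

lemma multiplier_op_smooth:
  assumes m: "admissible m" and f: "f \<in> test_functions"
  shows "smooth (multiplier_op m f)"
proof -
  obtain K where K: "0 \<le> K" "\<And>\<xi>. norm (m \<xi>) \<le> K" using m by (rule admissibleE) blast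
  obtain m' where m': "m' \<in> borel_measurable borel" "\<And>\<xi>. norm (m' \<xi>) \<le> K" "AE \<xi> in lebesgue. m \<xi> = m' \<xi>"
    by (rule borel_version[of m K]) (use m K(2) in \<open>auto simp: admissible_def\<close>)
  have "multiplier_op m f = multiplier_op m' f"
    using m f m' by (intro multiplier_op_cong_AE) (auto simp: admissible_def measurable_completion)
  also have "\<dots> = (\<lambda>x. LINT \<xi>|lborel. (m' \<xi> * fourier f \<xi>) * cis (x \<bullet> \<xi>))"
    by (rule ext) (rule multiplier_op_lborel[OF m'(1) f])
  finally show ?thesis
    using smooth_inverse_transform[OF rapid_mult_bounded[OF rapid_fourier[OF f] m'(1,2)]] by simp
qed

lemma smooth_lebesgue_measurable: "smooth f \<Longrightarrow> f \<in> borel_measurable lebesgue"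
  by (intro measurable_completion) (simp add: borel_measurable_continuous_onI smooth_continuous)

lemma multiplier_op_add:
  assumes "admissible m1" "admissible m2" "f \<in> test_functions"
  shows "multiplier_op (\<lambda>\<xi>. m1 \<xi> + m2 \<xi>) f = (\<lambda>x. multiplier_op m1 f x + multiplier_op m2 f x)"
  using assms by (auto simp: multiplier_op_cis distrib_right multiplier_integrand_integrable)

lemma multiplier_op_cmult:
  "multiplier_op (\<lambda>\<xi>. c * m \<xi>) f = (\<lambda>x. c * multiplier_op m f x)"
  by (simp only: fun_eq_iff multiplier_op_cis mult.assoc integral_mult_right_zero simp_thms)

lemma fourier_test_integrand:
  assumes "f \<in> test_functions"
  shows "integrable lborel (\<lambda>x. f x * cis (- (x \<bullet> \<xi>)))"
  by (intro integrable_mult_cis test_integrable assms) measurable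

lemma fourier_add:
  assumes "f \<in> test_functions" "g \<in> test_functions"
  shows "fourier (\<lambda>x. f x + g x) = (\<lambda>\<xi>. fourier f \<xi> + fourier g \<xi>)"
  using assms
  by (simp add: fun_eq_iff fourier_lborel test_measurable test_add fourier_test_integrand
      distrib_right add_divide_distrib)

lemma fourier_cmult: "fourier (\<lambda>x. c * f x) = (\<lambda>\<xi>. c * fourier f \<xi>)"
  by (simp add: fun_eq_iff fourier_def mult.assoc)

lemma multiplier_op_test_add:
  assumes "admissible m" "f \<in> test_functions" "g \<in> test_functions"
  shows "multiplier_op m (\<lambda>x. f x + g x) = (\<lambda>x. multiplier_op m f x + multiplier_op m g x)"
  using assms
  by (simp add: fun_eq_iff multiplier_op_cis fourier_add distrib_left distrib_right multiplier_integrand_integrable)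

lemma multiplier_op_test_cmult:
  "multiplier_op m (\<lambda>x. c * f x) = (\<lambda>x. c * multiplier_op m f x)"
  by (simp add: fun_eq_iff multiplier_op_cis fourier_cmult mult.assoc mult.left_commute)

lemma multiplier_op_one:
  assumes "f \<in> test_functions"
  shows "multiplier_op (\<lambda>\<xi>. 1) f = f"
  using fourier_inversion[OF assms] by (simp add: fun_eq_iff multiplier_op_lborel assms)

lemma multiplier_op_tendsto:
  assumes m: "\<And>k. m k \<in> borel_measurable lebesgue" "\<And>k \<xi>. norm (m k \<xi>) \<le> K"
    and lim: "\<And>\<xi>. (\<lambda>k. m k \<xi>) \<longlonglongrightarrow> m' \<xi>" and m': "m' \<in> borel_measurable lebesgue"
    and f: "f \<in> test_functions"
  shows "(\<lambda>k. multiplier_op (m k) f x) \<longlonglongrightarrow> multiplier_op m' f x"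
  unfolding multiplier_op_cis
proof (rule integral_dominated_convergence[where w="\<lambda>\<xi>. K * norm (fourier f \<xi>)"])
  show "integrable lebesgue (\<lambda>\<xi>. K * norm (fourier f \<xi>))"
    using fourier_lebesgue_integrable[OF f] by simp
  show "AE \<xi> in lebesgue. (\<lambda>k. m k \<xi> * fourier f \<xi> * cis (x \<bullet> \<xi>)) \<longlonglongrightarrow> m' \<xi> * fourier f \<xi> * cis (x \<bullet> \<xi>)"
    by (intro AE_I2 tendsto_mult lim tendsto_const)
  show "AE \<xi> in lebesgue. norm (m k \<xi> * fourier f \<xi> * cis (x \<bullet> \<xi>)) \<le> K * norm (fourier f \<xi>)" for k
    using m(2) by (intro AE_I2) (simp add: norm_mult mult_right_mono)
qed (intro multiplier_integrand_measurable m m' f)+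

text \<open>Formulated through the defining integral on test functions, so that no choice of an
  extension and no null sets enter. Membership is demanded beside the norm bound, since
  \<open>Lp_norm\<close> of a non-member can be 0 by default.\<close>

definition mult_bound :: "real \<Rightarrow> (real ^ 'n \<Rightarrow> complex) \<Rightarrow> real \<Rightarrow> bool" where
  "mult_bound p m B \<longleftrightarrow> admissible m \<and> 0 \<le> B \<and>
     (\<forall>f\<in>test_functions. multiplier_op m f \<in> Lp p \<and>
        Lp_norm p (multiplier_op m f) \<le> B * Lp_norm p f)"

lemma mult_bound_admissible: "mult_bound p m B \<Longrightarrow> admissible m"
  and mult_bound_nonneg: "mult_bound p m B \<Longrightarrow> 0 \<le> B"
  and mult_bound_Lp: "mult_bound p m B \<Longrightarrow> f \<in> test_functions \<Longrightarrow> multiplier_op m f \<in> Lp p"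
  and mult_bound_le: "mult_bound p m B \<Longrightarrow> f \<in> test_functions \<Longrightarrow>
    Lp_norm p (multiplier_op m f) \<le> B * Lp_norm p f"
  by (simp_all add: mult_bound_def)

lemma mult_bound_mono:
  assumes m: "mult_bound p m A" and le: "A \<le> B"
  shows "mult_bound p m B"
  unfolding mult_bound_def
proof (intro conjI ballI)
  show "0 \<le> B" using mult_bound_nonneg[OF m] le by simp
  show "Lp_norm p (multiplier_op m f) \<le> B * Lp_norm p f" if "f \<in> test_functions" for f
    using mult_bound_le[OF m that] mult_right_mono[OF le Lp_norm_nonneg[of p f]] by linarith
qed (auto intro: mult_bound_Lp[OF m] mult_bound_admissible[OF m])

lemma cutoff_exists:
  obtains \<theta> :: "real ^ 'n \<Rightarrow> complex" where
    "\<theta> \<in> test_functions" "\<theta> 0 = 1" "\<And>x. norm (\<theta> x) \<le> 1"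
proof
  \<comment> \<open>At its centre the bump has height \<open>exp (-1)\<close>, hence the factor
    \<open>exp 1\<close>.\<close>
  let ?\<theta> = "\<lambda>x::real^'n. of_real (exp 1) * ball_bump 0 1 0 x"
  show "?\<theta> \<in> test_functions" by (intro test_cmult ball_bump_test)
  show "?\<theta> 0 = 1" by (simp add: ball_bump_def exp_profile_def exp_minus flip: of_real_mult)
  show "norm (?\<theta> x) \<le> 1" for x
  proof -
    have "exp 1 * exp (- inverse s) \<le> 1" if "0 < s" "s \<le> 1" for s :: real
      using that one_le_inverse[of s] by (simp flip: exp_add)
    then have "exp 1 * exp_profile 0 (1 - x \<bullet> x) \<le> 1" by (simp add: exp_profile_def)
    moreover have "0 \<le> exp_profile 0 (1 - x \<bullet> x)" by (simp add: exp_profile_def)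
    ultimately show ?thesis by (simp add: ball_bump_def norm_mult)
  qed
qed

section \<open>Sums, limits and products of bounded multipliers\<close>

context
  fixes p :: real
  assumes p: "1 \<le> p"
begin

lemma mult_bound_one: "mult_bound p (\<lambda>\<xi>. 1) 1"
  by (simp add: mult_bound_def admissible_const multiplier_op_one test_Lp[OF p])

lemma mult_bound_cmult:
  assumes "mult_bound p m A"
  shows "mult_bound p (\<lambda>\<xi>. c * m \<xi>) (norm c * A)"
  using assms unfolding mult_bound_def
  by (auto simp: multiplier_op_cmult Lp_norm_cmult[OF p] mult.assoc
      intro!: Lp_cmult admissible_mult admissible_const mult_left_mono)

lemma mult_bound_add:
  assumes 1: "mult_bound p m1 A1" and 2: "mult_bound p m2 A2"
  shows "mult_bound p (\<lambda>\<xi>. m1 \<xi> + m2 \<xi>) (A1 + A2)"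
  unfolding mult_bound_def
proof (intro conjI ballI)
  fix f :: "real ^ 'a \<Rightarrow> complex" assume f: "f \<in> test_functions"
  note L = mult_bound_Lp[OF 1 f] mult_bound_Lp[OF 2 f]
  have eq: "multiplier_op (\<lambda>\<xi>. m1 \<xi> + m2 \<xi>) f = (\<lambda>x. multiplier_op m1 f x + multiplier_op m2 f x)"
    by (intro multiplier_op_add mult_bound_admissible[OF 1] mult_bound_admissible[OF 2] f)
  show "multiplier_op (\<lambda>\<xi>. m1 \<xi> + m2 \<xi>) f \<in> Lp p" unfolding eq by (rule Lp_add[OF p L])
  show "Lp_norm p (multiplier_op (\<lambda>\<xi>. m1 \<xi> + m2 \<xi>) f) \<le> (A1 + A2) * Lp_norm p f"
    unfolding eq distrib_right
    by (rule order_trans[OF Lp_norm_add[OF p L]]) (intro add_mono mult_bound_le[OF 1 f] mult_bound_le[OF 2 f])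
qed (use mult_bound_nonneg[OF 1] mult_bound_nonneg[OF 2] in
     \<open>auto intro: admissible_add mult_bound_admissible[OF 1] mult_bound_admissible[OF 2]\<close>)

lemma mult_bound_sum:
  assumes "finite I" "\<And>i. i \<in> I \<Longrightarrow> mult_bound p (m i) (A i)"
  shows "mult_bound p (\<lambda>\<xi>. \<Sum>i\<in>I. m i \<xi>) (\<Sum>i\<in>I. A i)"
  using assms
proof (induction I rule: finite_induct)
  case empty
  then show ?case using mult_bound_cmult[OF mult_bound_one, of 0] by simp
next
  case (insert i I)
  then show ?case using mult_bound_add[of "m i" "A i" "\<lambda>\<xi>. \<Sum>i\<in>I. m i \<xi>"] by simp
qed

text \<open>\<open>mult_bound\<close> controls operators and bounds each symbol without uniformity
  in \<open>k\<close>; the constant \<open>K\<close> supplies the common bound by which the defining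
  integrals converge at every point, before Fatou is applied.\<close>

lemma mult_bound_limit:
  assumes m: "\<And>k. mult_bound p (m k) B" and K: "\<And>k \<xi>. norm (m k \<xi>) \<le> K"
    and lim: "\<And>\<xi>. (\<lambda>k. m k \<xi>) \<longlonglongrightarrow> m' \<xi>"
  shows "mult_bound p m' B"
proof -
  have meas: "m k \<in> borel_measurable lebesgue" for k
    using mult_bound_admissible[OF m] by (simp add: admissible_def)
  have m'_meas: "m' \<in> borel_measurable lebesgue"
    by (rule borel_measurable_LIMSEQ_metric[OF meas lim])
  have "norm (m' \<xi>) \<le> K" for \<xi>
    by (rule LIMSEQ_le_const2[OF tendsto_norm[OF lim]]) (use K in auto)
  then have adm: "admissible m'" using m'_meas by (intro admissibleI)
  show ?thesis unfolding mult_bound_def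
  proof (intro conjI ballI adm mult_bound_nonneg[OF m])
    fix f :: "real ^ 'a \<Rightarrow> complex" assume f: "f \<in> test_functions"
    have "multiplier_op m' f \<in> Lp p \<and> Lp_norm p (multiplier_op m' f) \<le> B * Lp_norm p f"
    proof (rule Lp_Fatou[OF p])
      show "AE x in lebesgue. (\<lambda>k. multiplier_op (m k) f x) \<longlonglongrightarrow> multiplier_op m' f x"
        by (intro AE_I2 multiplier_op_tendsto[OF meas K lim m'_meas f])
      show "multiplier_op m' f \<in> borel_measurable lebesgue"
        by (intro smooth_lebesgue_measurable multiplier_op_smooth adm f)
    qed (use m f in \<open>auto intro: mult_bound_Lp mult_bound_le\<close>)
    then show "multiplier_op m' f \<in> Lp p" "Lp_norm p (multiplier_op m' f) \<le> B * Lp_norm p f" by auto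
  qed
qed

text \<open>The output of the first operator is smooth but not compactly supported, so the second one is
  applied to cutoffs \<open>\<theta> (x / k) * g x\<close>. Their images converge pointwise, because cutting off
  amounts to averaging the integrable frequency side of \<open>g\<close> over small translations.\<close>

lemma mult_bound_mult:
  assumes 1: "mult_bound p m1 A1" and 2: "mult_bound p m2 A2"
  shows "mult_bound p (\<lambda>\<xi>. m1 \<xi> * m2 \<xi>) (A1 * A2)"
  unfolding mult_bound_def
proof (intro conjI ballI)
  show adm: "admissible (\<lambda>\<xi>. m1 \<xi> * m2 \<xi>)"
    by (intro admissible_mult mult_bound_admissible[OF 1] mult_bound_admissible[OF 2])
  show "0 \<le> A1 * A2" using mult_bound_nonneg[OF 1] mult_bound_nonneg[OF 2] by simp
  fix f :: "real ^ 'a \<Rightarrow> complex" assume f: "f \<in> test_functions"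
  have meas: "m1 \<in> borel_measurable lebesgue" "m2 \<in> borel_measurable lebesgue"
    using mult_bound_admissible[OF 1] mult_bound_admissible[OF 2] by (auto simp: admissible_def)
  obtain K1 where K1: "\<And>\<xi>. norm (m1 \<xi>) \<le> K1"
    by (rule admissibleE[OF mult_bound_admissible[OF 1]]) blast
  obtain K2 where K2: "\<And>\<xi>. norm (m2 \<xi>) \<le> K2"
    by (rule admissibleE[OF mult_bound_admissible[OF 2]]) blast
  \<comment> \<open>Borel versions for the computations on the frequency side; the operators
    themselves do not change.\<close>
  obtain b1 where b1: "b1 \<in> borel_measurable borel" "\<And>\<xi>. norm (b1 \<xi>) \<le> K1" "AE \<xi> in lebesgue. m1 \<xi> = b1 \<xi>"
    by (rule borel_version[OF meas(1) K1]) blast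
  obtain b2 where b2: "b2 \<in> borel_measurable borel" "\<And>\<xi>. norm (b2 \<xi>) \<le> K2" "AE \<xi> in lebesgue. m2 \<xi> = b2 \<xi>"
    by (rule borel_version[OF meas(2) K2]) blast
  have [measurable]: "b1 \<in> borel_measurable borel" "b2 \<in> borel_measurable borel" by fact+
  have b_meas: "b1 \<in> borel_measurable lebesgue" "b2 \<in> borel_measurable lebesgue"
    "(\<lambda>\<xi>. b1 \<xi> * b2 \<xi>) \<in> borel_measurable lebesgue"
    by (rule measurable_completion; measurable)+
  have eq1: "multiplier_op m1 u = multiplier_op b1 u" if "u \<in> test_functions" for u
    by (rule multiplier_op_cong_AE[OF meas(1) b_meas(1) that b1(3)])
  have eq2: "multiplier_op m2 f = multiplier_op b2 f"
    by (rule multiplier_op_cong_AE[OF meas(2) b_meas(2) f b2(3)])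
  have eq12: "multiplier_op (\<lambda>\<xi>. m1 \<xi> * m2 \<xi>) f = multiplier_op (\<lambda>\<xi>. b1 \<xi> * b2 \<xi>) f"
  proof (rule multiplier_op_cong_AE[OF _ b_meas(3) f])
    show "(\<lambda>\<xi>. m1 \<xi> * m2 \<xi>) \<in> borel_measurable lebesgue" using meas by measurable
    show "AE \<xi> in lebesgue. m1 \<xi> * m2 \<xi> = b1 \<xi> * b2 \<xi>"
      using b1(3) b2(3) by eventually_elim simp
  qed
  define h where "h \<xi> = b2 \<xi> * fourier f \<xi>" for \<xi>
  have h: "rapid h" unfolding h_def[abs_def]
    by (rule rapid_mult_bounded[OF rapid_fourier[OF f] b2(1,2)])
  have hi: "integrable lborel h" by (rule rapid_integrable[OF h])
  define g where "g x = (LINT \<xi>|lborel. h \<xi> * cis (x \<bullet> \<xi>))" for x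
  have g_eq: "multiplier_op m2 f = g"
    by (simp add: fun_eq_iff eq2 multiplier_op_lborel b2(1) f g_def h_def)
  have g_smooth: "smooth g" unfolding g_def[abs_def] by (rule smooth_inverse_transform[OF h])
  have g_Lp: "g \<in> Lp p" and g_le: "Lp_norm p g \<le> A2 * Lp_norm p f"
    using mult_bound_Lp[OF 2 f] mult_bound_le[OF 2 f] by (simp_all add: g_eq)
  obtain \<theta> :: "real ^ 'a \<Rightarrow> complex" where \<theta>: "\<theta> \<in> test_functions" "\<theta> 0 = 1" "\<And>x. norm (\<theta> x) \<le> 1"
    by (rule cutoff_exists) blast
  define t where "t k = inverse (real (Suc k))" for k
  have t: "0 < t k" for k by (simp add: t_def)
  have t0: "t \<longlonglongrightarrow> 0" unfolding t_def by (rule LIMSEQ_inverse_real_of_nat)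
  \<comment> \<open>The cutoff makes a test function of \<open>g\<close>, so the bound for
    \<open>m1\<close> applies; \<open>norm (\<theta> x) \<le> 1\<close> keeps the norm below that of
    \<open>g\<close>.\<close>
  define u where "u k x = \<theta> (t k *\<^sub>R x) * g x" for k x
  have u_test: "u k \<in> test_functions" for k
  proof -
    obtain R B where R: "0 \<le> R" "\<And>x. norm (\<theta> x) \<le> B * indicator (cball 0 R) x"
      using test_bounded[OF \<theta>(1)] by blast
    have "norm x \<le> R / t k" if "u k x \<noteq> 0" for x
    proof -
      have "t k *\<^sub>R x \<in> cball 0 R" using that R(2)[of "t k *\<^sub>R x"] by (cases "t k *\<^sub>R x \<in> cball 0 R") (auto simp: u_def)
      then show ?thesis using t[of k] by (simp add: pos_le_divide_eq mult.commute)
    qed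
    then have "bounded {x. u k x \<noteq> 0}" unfolding bounded_iff by blast
    moreover have "smooth (u k)"
      unfolding u_def[abs_def] using smooth_affine[OF test_smooth[OF \<theta>(1)], of "t k" 0]
      by (intro smooth_mult g_smooth) simp
    ultimately show ?thesis by (simp add: test_functions_iff)
  qed
  have u_le: "Lp_norm p (u k) \<le> A2 * Lp_norm p f" for k
  proof -
    have "Lp_norm p (u k) \<le> Lp_norm p g"
    proof (subst Lp_norm_le_iff_integral[OF p Lp_norm_nonneg], subst Lp_norm_powr[OF p], rule integral_mono)
      show "integrable lebesgue (\<lambda>x. norm (u k x) powr p)" using test_Lp[OF p u_test] by (simp add: Lp_def)
      show "integrable lebesgue (\<lambda>x. norm (g x) powr p)" using g_Lp by (simp add: Lp_def)
      show "norm (u k x) powr p \<le> norm (g x) powr p" for x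
        using p \<theta>(3)[of "t k *\<^sub>R x"] by (intro powr_mono2) (auto simp: u_def norm_mult mult_left_le_one_le)
    qed
    then show ?thesis using g_le by simp
  qed
  have T: "multiplier_op m1 (u k) \<in> Lp p \<and> Lp_norm p (multiplier_op m1 (u k)) \<le> A1 * A2 * Lp_norm p f" for k
  proof
    show "multiplier_op m1 (u k) \<in> Lp p" by (rule mult_bound_Lp[OF 1 u_test])
    have "Lp_norm p (multiplier_op m1 (u k)) \<le> A1 * Lp_norm p (u k)" by (rule mult_bound_le[OF 1 u_test])
    also have "\<dots> \<le> A1 * (A2 * Lp_norm p f)" by (intro mult_left_mono u_le mult_bound_nonneg[OF 1])
    finally show "Lp_norm p (multiplier_op m1 (u k)) \<le> A1 * A2 * Lp_norm p f" by simp
  qed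
  have lim: "(\<lambda>k. multiplier_op m1 (u k) x) \<longlonglongrightarrow> multiplier_op (\<lambda>\<xi>. m1 \<xi> * m2 \<xi>) f x" for x
  proof -
    \<comment> \<open>Symbol and oscillation together form the bounded kernel that evaluates the
      first operator at \<open>x\<close>; \<open>\<theta> 0 = 1\<close> then gives the limit the
      right constant.\<close>
    let ?k = "\<lambda>\<xi>. b1 \<xi> * cis (x \<bullet> \<xi>)"
    have "(\<lambda>k. LINT \<xi>|lborel. ?k \<xi> * (LINT v|lborel. fourier \<theta> v * h (\<xi> - t k *\<^sub>R v))) \<longlonglongrightarrow>
        \<theta> 0 * (LINT \<xi>|lborel. ?k \<xi> * h \<xi>)"
    proof (rule integral_cutoff_limit[OF \<theta>(1) hi t0])
      show "?k \<in> borel_measurable borel" by measurable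
      show "norm (?k \<xi>) \<le> K1" for \<xi> using b1(2) by (simp add: norm_mult)
    qed
    moreover have "(LINT \<xi>|lborel. ?k \<xi> * (LINT v|lborel. fourier \<theta> v * h (\<xi> - t k *\<^sub>R v))) = multiplier_op m1 (u k) x" for k
    proof -
      have "u k = (\<lambda>x. \<theta> (t k *\<^sub>R x) * (LINT \<eta>|lborel. h \<eta> * cis (x \<bullet> \<eta>)))"
        by (simp add: fun_eq_iff u_def g_def)
      with fourier_cutoff_product[OF \<theta>(1) hi t, of k] test_measurable[OF u_test[of k]]
      have "fourier (u k) \<xi> = (LINT v|lborel. fourier \<theta> v * h (\<xi> - t k *\<^sub>R v))" for \<xi> by simp
      then show ?thesis
        by (simp only: eq1[OF u_test] multiplier_op_lborel[OF b1(1) u_test] mult_ac)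
    qed
    moreover have "\<theta> 0 * (LINT \<xi>|lborel. ?k \<xi> * h \<xi>) = multiplier_op (\<lambda>\<xi>. m1 \<xi> * m2 \<xi>) f x"
    proof -
      have "(\<lambda>\<xi>. b1 \<xi> * b2 \<xi>) \<in> borel_measurable borel" by measurable
      from multiplier_op_lborel[OF this f] show ?thesis
        by (simp add: \<theta>(2) eq12 h_def mult_ac)
    qed
    ultimately show ?thesis by simp
  qed
  have "multiplier_op (\<lambda>\<xi>. m1 \<xi> * m2 \<xi>) f \<in> Lp p \<and>
      Lp_norm p (multiplier_op (\<lambda>\<xi>. m1 \<xi> * m2 \<xi>) f) \<le> A1 * A2 * Lp_norm p f"
    using T lim
    by (intro Lp_Fatou[OF p, of "\<lambda>k. multiplier_op m1 (u k)"])
       (auto intro: smooth_lebesgue_measurable multiplier_op_smooth adm f)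
  then show "multiplier_op (\<lambda>\<xi>. m1 \<xi> * m2 \<xi>) f \<in> Lp p"
    "Lp_norm p (multiplier_op (\<lambda>\<xi>. m1 \<xi> * m2 \<xi>) f) \<le> A1 * A2 * Lp_norm p f" by auto
qed

lemma mult_bound_power: "mult_bound p m A \<Longrightarrow> mult_bound p (\<lambda>\<xi>. m \<xi> ^ k) (A ^ k)"
proof (induction k)
  case 0
  then show ?case using mult_bound_one by simp
next
  case (Suc k)
  then show ?case using mult_bound_mult[of m A "\<lambda>\<xi>. m \<xi> ^ k" "A ^ k"] by simp
qed

section \<open>Bounded extensions\<close>

text \<open>\<open>closure_rel T f g\<close> is the graph of the continuous extension of \<open>T\<close>.\<close>

definition closure_rel ::
    "((real ^ 'n \<Rightarrow> complex) \<Rightarrow> real ^ 'n \<Rightarrow> complex) \<Rightarrow>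
     (real ^ 'n \<Rightarrow> complex) \<Rightarrow> (real ^ 'n \<Rightarrow> complex) \<Rightarrow> bool" where
  "closure_rel T f g \<longleftrightarrow> g \<in> Lp p \<and>
     (\<forall>e>0. \<exists>\<phi>\<in>test_functions. Lp_norm p (\<lambda>x. f x - \<phi> x) < e \<and> Lp_norm p (\<lambda>x. g x - T \<phi> x) < e)"

context
  fixes m :: "real ^ 'n \<Rightarrow> complex" and B :: real
  assumes mB: "mult_bound p m B"
begin

private abbreviation "T \<equiv> multiplier_op m"

private lemma adm: "admissible m" by (rule mult_bound_admissible[OF mB])

lemma closure_rel_Lp: "closure_rel T f g \<Longrightarrow> g \<in> Lp p"
  by (simp add: closure_rel_def)

lemma closure_relE:
  assumes "closure_rel T f g" "0 < e"
  obtains \<phi> where "\<phi> \<in> test_functions" "Lp_norm p (\<lambda>x. f x - \<phi> x) < e"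
    "Lp_norm p (\<lambda>x. g x - T \<phi> x) < e"
  using assms unfolding closure_rel_def by blast

lemma closure_rel_add:
  assumes f: "f \<in> Lp p" "f' \<in> Lp p" and R: "closure_rel T f g" "closure_rel T f' g'"
  shows "closure_rel T (\<lambda>x. f x + f' x) (\<lambda>x. g x + g' x)"
  unfolding closure_rel_def
proof (intro conjI allI impI)
  note g = closure_rel_Lp[OF R(1)] closure_rel_Lp[OF R(2)]
  show "(\<lambda>x. g x + g' x) \<in> Lp p" by (rule Lp_add[OF p g])
  fix e :: real assume "0 < e"
  then have e: "0 < e / 2" by simp
  obtain \<phi> where \<phi>: "\<phi> \<in> test_functions" "Lp_norm p (\<lambda>x. f x - \<phi> x) < e / 2" "Lp_norm p (\<lambda>x. g x - T \<phi> x) < e / 2"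
    by (rule closure_relE[OF R(1) e]) blast
  obtain \<psi> where \<psi>: "\<psi> \<in> test_functions" "Lp_norm p (\<lambda>x. f' x - \<psi> x) < e / 2" "Lp_norm p (\<lambda>x. g' x - T \<psi> x) < e / 2"
    by (rule closure_relE[OF R(2) e]) blast
  have "Lp_norm p (\<lambda>x. (f x - \<phi> x) + (f' x - \<psi> x)) < e"
    using Lp_norm_add[OF p Lp_diff[OF p f(1) test_Lp[OF p \<phi>(1)]] Lp_diff[OF p f(2) test_Lp[OF p \<psi>(1)]]] \<phi> \<psi> by simp
  moreover have "Lp_norm p (\<lambda>x. (g x - T \<phi> x) + (g' x - T \<psi> x)) < e"
    using Lp_norm_add[OF p Lp_diff[OF p g(1) mult_bound_Lp[OF mB \<phi>(1)]] Lp_diff[OF p g(2) mult_bound_Lp[OF mB \<psi>(1)]]] \<phi> \<psi> by simp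
  ultimately show "\<exists>\<phi>\<in>test_functions. Lp_norm p (\<lambda>x. f x + f' x - \<phi> x) < e \<and> Lp_norm p (\<lambda>x. g x + g' x - T \<phi> x) < e"
    by (intro bexI[of _ "\<lambda>x. \<phi> x + \<psi> x"] test_add \<phi> \<psi>)
       (simp add: multiplier_op_test_add[OF adm \<phi>(1) \<psi>(1)] algebra_simps)
qed

lemma closure_rel_cmult:
  assumes R: "closure_rel T f g"
  shows "closure_rel T (\<lambda>x. c * f x) (\<lambda>x. c * g x)"
  unfolding closure_rel_def
proof (intro conjI allI impI)
  show "(\<lambda>x. c * g x) \<in> Lp p" by (rule Lp_cmult[OF closure_rel_Lp[OF R]])
  fix e :: real assume "0 < e"
  \<comment> \<open>The summand 1 allows for \<open>c = 0\<close>.\<close>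
  then have e: "0 < e / (norm c + 1)" by (simp add: add_nonneg_pos)
  obtain \<phi> where \<phi>: "\<phi> \<in> test_functions" "Lp_norm p (\<lambda>x. f x - \<phi> x) < e / (norm c + 1)"
      "Lp_norm p (\<lambda>x. g x - T \<phi> x) < e / (norm c + 1)"
    by (rule closure_relE[OF R e]) blast
  have small: "norm c * s < e" if "0 \<le> s" "s < e / (norm c + 1)" for s
  proof -
    have "norm c * s \<le> (norm c + 1) * s" using that by (simp add: distrib_right)
    also have "\<dots> < e" using that by (simp add: pos_less_divide_eq add_nonneg_pos mult.commute)
    finally show ?thesis .
  qed
  have "Lp_norm p (\<lambda>x. c * (f x - \<phi> x)) < e" "Lp_norm p (\<lambda>x. c * (g x - T \<phi> x)) < e"
    unfolding Lp_norm_cmult[OF p] using small \<phi> by simp_all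
  then show "\<exists>\<phi>\<in>test_functions. Lp_norm p (\<lambda>x. c * f x - \<phi> x) < e \<and> Lp_norm p (\<lambda>x. c * g x - T \<phi> x) < e"
    by (intro bexI[of _ "\<lambda>x. c * \<phi> x"] test_cmult \<phi>) (simp add: multiplier_op_test_cmult right_diff_distrib)
qed

lemma closure_rel_bound:
  assumes f: "f \<in> Lp p" and R: "closure_rel T f g"
  shows "Lp_norm p g \<le> B * Lp_norm p f"
proof (rule field_le_epsilon)
  fix e :: real assume "0 < e"
  have B: "0 \<le> B" by (rule mult_bound_nonneg[OF mB])
  \<comment> \<open>The approximation error enters once directly and once multiplied by
    \<open>B\<close>.\<close>
  define d where "d = e / (B + 1)"
  have d: "0 < d" "d * (B + 1) = e" using B \<open>0 < e\<close> by (auto simp: d_def)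
  obtain \<phi> where \<phi>: "\<phi> \<in> test_functions" "Lp_norm p (\<lambda>x. f x - \<phi> x) < d" "Lp_norm p (\<lambda>x. g x - T \<phi> x) < d"
    by (rule closure_relE[OF R d(1)]) blast
  have "Lp_norm p g \<le> Lp_norm p (T \<phi>) + d"
    using Lp_norm_le_add_diff[OF p closure_rel_Lp[OF R] mult_bound_Lp[OF mB \<phi>(1)]] \<phi>(3) by simp
  also have "Lp_norm p (T \<phi>) \<le> B * Lp_norm p \<phi>" by (rule mult_bound_le[OF mB \<phi>(1)])
  also have "B * Lp_norm p \<phi> \<le> B * (Lp_norm p f + d)"
    using Lp_norm_le_add_diff[OF p test_Lp[OF p \<phi>(1)] f] \<phi>(2) Lp_norm_minus_commute[of p f \<phi>]
    by (intro mult_left_mono B) simp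
  also have "B * (Lp_norm p f + d) + d = B * Lp_norm p f + e" using d(2) by (simp add: algebra_simps)
  finally show "Lp_norm p g \<le> B * Lp_norm p f + e" by simp
qed

text \<open>The relation is linear, so two values for \<open>f\<close> give their difference as a
  value for 0, and \<open>closure_rel_bound\<close> makes that difference null.\<close>

lemma closure_rel_unique:
  assumes f: "f \<in> Lp p" and R: "closure_rel T f g" "closure_rel T f g'"
  shows "AE x in lebesgue. g x = g' x"
proof -
  have "closure_rel T (\<lambda>x. f x + (-1) * f x) (\<lambda>x. g x + (-1) * g' x)"
    by (intro closure_rel_add closure_rel_cmult R f Lp_cmult)
  then have R0: "closure_rel T (\<lambda>x. 0) (\<lambda>x. g x - g' x)" by simp
  have "(\<lambda>x. 0) \<in> Lp p" by (intro test_Lp[OF p] test_zero)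
  from closure_rel_bound[OF this R0] have "Lp_norm p (\<lambda>x. g x - g' x) \<le> 0"
    using p by (simp add: Lp_norm_def)
  from Lp_norm_0_AE[OF p closure_rel_Lp[OF R0] this] show ?thesis by simp
qed

lemma closure_rel_test: "\<phi> \<in> test_functions \<Longrightarrow> closure_rel T \<phi> (T \<phi>)"
  unfolding closure_rel_def
proof (intro conjI allI impI bexI[of _ \<phi>] mult_bound_Lp[OF mB])
  fix e :: real assume "0 < e"
  then show "Lp_norm p (\<lambda>x. \<phi> x - \<phi> x) < e" "Lp_norm p (\<lambda>x. T \<phi> x - T \<phi> x) < e"
    using p by (simp_all add: Lp_norm_def)
qed

lemma closure_rel_exists:
  assumes f: "f \<in> Lp p"
  shows "\<exists>g. closure_rel T f g"
proof -
  have B: "0 \<le> B" by (rule mult_bound_nonneg[OF mB])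
  \<comment> \<open>Chosen so that \<open>d j + d k\<close> is at most
    \<open>(1/4) ^ k / (B + 1)\<close> for \<open>k \<le> j\<close>; the operator multiplies this by
    at most \<open>B\<close>, which leaves the rate required by \<open>Lp_complete\<close>.\<close>
  define d where "d k = (1/4) ^ k / (2 * (B + 1))" for k :: nat
  have d: "0 < d k" for k using B by (simp add: d_def)
  have "\<forall>k. \<exists>\<phi>. \<phi> \<in> test_functions \<and> Lp_norm p (\<lambda>x. f x - \<phi> x) < d k"
    by (intro allI, rule test_dense[OF p f d]) blast
  then obtain \<phi> where \<phi>: "\<And>k. \<phi> k \<in> test_functions" "\<And>k. Lp_norm p (\<lambda>x. f x - \<phi> k x) < d k" by metis
  note \<phi>L = test_Lp[OF p \<phi>(1)] and TL = mult_bound_Lp[OF mB \<phi>(1)]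
  have "Lp_norm p (\<lambda>x. T (\<phi> j) x - T (\<phi> k) x) \<le> (1/4) ^ k" if "k \<le> j" for j k
  proof -
    have test: "(\<lambda>x. \<phi> j x - \<phi> k x) \<in> test_functions" by (intro test_diff \<phi>(1))
    have "(\<lambda>x. T (\<phi> j) x - T (\<phi> k) x) = T (\<lambda>x. \<phi> j x - \<phi> k x)"
      using multiplier_op_test_add[OF adm \<phi>(1) test_cmult[OF \<phi>(1)], of j "-1" k]
        multiplier_op_test_cmult[of m "-1" "\<phi> k"] by simp
    then have "Lp_norm p (\<lambda>x. T (\<phi> j) x - T (\<phi> k) x) \<le> B * Lp_norm p (\<lambda>x. \<phi> j x - \<phi> k x)"
      using mult_bound_le[OF mB test] by simp
    moreover have "Lp_norm p (\<lambda>x. \<phi> j x - \<phi> k x) \<le> d j + d k"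
      using Lp_norm_triangle[OF p \<phi>L f \<phi>L, of j k] \<phi>(2)[of j] \<phi>(2)[of k] Lp_norm_minus_commute[of p f "\<phi> j"]
      by simp
    moreover have "d j + d k \<le> (1/4) ^ k / (B + 1)"
    proof -
      have "(1/4) ^ j \<le> (1/4 :: real) ^ k" using that by (intro power_decreasing) auto
      then have "d j \<le> d k" using B by (simp add: d_def divide_right_mono)
      moreover have half: "x / (2 * c) + x / (2 * c) = x / c" if "0 < c" for x c :: real
        using that by (simp add: field_simps)
      have "d k + d k = (1/4) ^ k / (B + 1)"
        unfolding d_def by (rule half) (use B in simp)
      ultimately show ?thesis by linarith
    qed
    ultimately have "Lp_norm p (\<lambda>x. T (\<phi> j) x - T (\<phi> k) x) \<le> B * ((1/4) ^ k / (B + 1))"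
      using B mult_left_mono order_trans by meson
    moreover have "B * (s / (B + 1)) \<le> s" if "0 \<le> s" for s
      using B that by (simp add: field_simps)
    ultimately show ?thesis by (meson order_trans zero_le_divide_1_iff zero_le_numeral zero_le_power)
  qed
  from Lp_complete[OF p TL this]
  obtain g where g: "g \<in> Lp p" "\<And>k. Lp_norm p (\<lambda>x. T (\<phi> k) x - g x) \<le> (1/4) ^ k" by blast
  have "closure_rel T f g" unfolding closure_rel_def
  proof (intro conjI allI impI g(1))
    fix e :: real assume "0 < e"
    then obtain k where k: "(1/4) ^ k < e" using real_arch_pow_inv[of e "1/4"] by auto
    have "d k \<le> (1/4) ^ k" using B by (simp add: d_def pos_divide_le_eq)
    then have "Lp_norm p (\<lambda>x. f x - \<phi> k x) < e" using \<phi>(2)[of k] k by linarith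
    moreover have "Lp_norm p (\<lambda>x. g x - T (\<phi> k) x) < e"
      using g(2)[of k] k Lp_norm_minus_commute[of p g "T (\<phi> k)"] by simp
    ultimately show "\<exists>\<phi>\<in>test_functions. Lp_norm p (\<lambda>x. f x - \<phi> x) < e \<and> Lp_norm p (\<lambda>x. g x - T \<phi> x) < e"
      using \<phi>(1) by blast
  qed
  then show ?thesis by blast
qed

lemma mult_bound_extends: "\<exists>S. extends_multiplier_op p m S"
proof -
  \<comment> \<open>The values are chosen independently for each function; additivity and
    homogeneity hold almost everywhere by uniqueness.\<close>
  define S where "S f = (SOME g. closure_rel T f g)" for f
  have S: "closure_rel T f (S f)" if "f \<in> Lp p" for f
    unfolding S_def by (rule someI_ex[OF closure_rel_exists[OF that]])
  have "bounded_op_Lp p S" unfolding bounded_op_Lp_def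
  proof (intro conjI ballI allI)
    show "S f \<in> Lp p" if "f \<in> Lp p" for f by (rule closure_rel_Lp[OF S[OF that]])
    show "AE x in lebesgue. S (\<lambda>y. f y + g y) x = S f x + S g x" if fg: "f \<in> Lp p" "g \<in> Lp p" for f g
      by (rule closure_rel_unique[OF Lp_add[OF p fg] S[OF Lp_add[OF p fg]]])
         (intro closure_rel_add fg S)
    show "AE x in lebesgue. S (\<lambda>y. c * f y) x = c * S f x" if f: "f \<in> Lp p" for c f
      by (rule closure_rel_unique[OF Lp_cmult[OF f] S[OF Lp_cmult[OF f]]])
         (intro closure_rel_cmult S f)
    show "\<exists>B. \<forall>f\<in>Lp p. Lp_norm p (S f) \<le> B * Lp_norm p f"
      by (intro exI[of _ B] ballI closure_rel_bound S)
  qed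
  moreover have "AE x in lebesgue. S f x = T f x" if f: "f \<in> test_functions" for f
    by (rule closure_rel_unique[OF test_Lp[OF p f] S[OF test_Lp[OF p f]] closure_rel_test[OF f]])
  ultimately show ?thesis unfolding extends_multiplier_op_def by blast
qed

text \<open>Proved for every extension, since \<open>Mp_norm\<close> evaluates one picked by
  \<open>SOME\<close>. Density reduces it to test functions; the constant \<open>A\<close> that
  comes with \<open>S\<close> only controls the small remainder.\<close>

lemma extension_bound:
  assumes S: "extends_multiplier_op p m S" and f: "f \<in> Lp p"
  shows "Lp_norm p (S f) \<le> B * Lp_norm p f"
proof (rule field_le_epsilon)
  fix e :: real assume "0 < e"
  have bS: "bounded_op_Lp p S" and ST: "\<And>\<phi>. \<phi> \<in> test_functions \<Longrightarrow> AE x in lebesgue. S \<phi> x = T \<phi> x"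
    using S by (auto simp: extends_multiplier_op_def)
  have SL: "\<And>f. f \<in> Lp p \<Longrightarrow> S f \<in> Lp p" using bS unfolding bounded_op_Lp_def by blast
  obtain A where A: "\<And>f. f \<in> Lp p \<Longrightarrow> Lp_norm p (S f) \<le> A * Lp_norm p f"
    using bS unfolding bounded_op_Lp_def by blast
  have B: "0 \<le> B" by (rule mult_bound_nonneg[OF mB])
  \<comment> \<open>Budget for an error \<open>B * d\<close> from the approximant and
    \<open>\<bar>A\<bar> * d\<close> from the remainder; the 1 keeps the denominator
    positive.\<close>
  define d where "d = e / (B + \<bar>A\<bar> + 1)"
  have d: "0 < d" "d * (B + \<bar>A\<bar> + 1) = e" using B \<open>0 < e\<close> by (auto simp: d_def)
  obtain \<phi> where \<phi>: "\<phi> \<in> test_functions" "Lp_norm p (\<lambda>x. f x - \<phi> x) < d"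
    by (rule test_dense[OF p f d(1)]) blast
  note \<phi>L = test_Lp[OF p \<phi>(1)]
  let ?r = "\<lambda>x. f x - \<phi> x"
  have r: "?r \<in> Lp p" by (rule Lp_diff[OF p f \<phi>L])
  have "AE x in lebesgue. S (\<lambda>y. \<phi> y + ?r y) x = S \<phi> x + S ?r x"
    by (rule bS[unfolded bounded_op_Lp_def, THEN conjunct2, THEN conjunct1, rule_format, OF \<phi>L r])
  then have "AE x in lebesgue. S f x = T \<phi> x + S ?r x"
    using ST[OF \<phi>(1)] by eventually_elim simp
  then have "Lp_norm p (S f) = Lp_norm p (\<lambda>x. T \<phi> x + S ?r x)"
    by (intro Lp_norm_cong_AE Lp_measurable[of _ p] SL f Lp_add[OF p] mult_bound_Lp[OF mB \<phi>(1)] r)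
  also have "\<dots> \<le> Lp_norm p (T \<phi>) + Lp_norm p (S ?r)"
    by (intro Lp_norm_add[OF p] SL r mult_bound_Lp[OF mB \<phi>(1)])
  also have "\<dots> \<le> B * (Lp_norm p f + d) + \<bar>A\<bar> * d"
  proof (rule add_mono)
    have "Lp_norm p (T \<phi>) \<le> B * Lp_norm p \<phi>" by (rule mult_bound_le[OF mB \<phi>(1)])
    also have "\<dots> \<le> B * (Lp_norm p f + d)"
      using Lp_norm_le_add_diff[OF p \<phi>L f] \<phi>(2) Lp_norm_minus_commute[of p f \<phi>]
      by (intro mult_left_mono B) simp
    finally show "Lp_norm p (T \<phi>) \<le> B * (Lp_norm p f + d)" .
    have "Lp_norm p (S ?r) \<le> A * Lp_norm p ?r" by (rule A[OF r])
    also have "\<dots> \<le> \<bar>A\<bar> * d" using \<phi>(2) by (intro mult_mono) auto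
    finally show "Lp_norm p (S ?r) \<le> \<bar>A\<bar> * d" .
  qed
  also have "\<dots> \<le> B * Lp_norm p f + e" using d by (simp add: algebra_simps)
  finally show "Lp_norm p (S f) \<le> B * Lp_norm p f + e" .
qed

lemma mult_bound_imp_Mp: "m \<in> Mp p"
  using adm mult_bound_extends by (simp add: Mp_def admissible_def)

lemma Mp_norm_le: "Mp_norm p m \<le> B"
proof -
  have "extends_multiplier_op p m (SOME S. extends_multiplier_op p m S)"
    by (rule someI_ex[OF mult_bound_extends])
  from extension_bound[OF this] show ?thesis
    unfolding Mp_norm_def Lp_op_norm_def
    by (intro cInf_lower bdd_belowI[of _ 0]) (auto intro: mult_bound_nonneg[OF mB])
qed

end

text \<open>The infimum in the operator norm is itself an admissible constant: for \<open>f\<close>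
  of positive norm every competitor is at least the quotient of the norms, and for \<open>f\<close>
  of norm 0 any one competitor forces the image to have norm 0.\<close>

lemma Mp_mult_bound:
  fixes m :: "real ^ 'n \<Rightarrow> complex"
  assumes m: "m \<in> Mp p"
  shows "mult_bound p m (Mp_norm p m)"
proof -
  have adm: "admissible m" using m by (auto simp: Mp_def admissible_def)
  define S where "S = (SOME S. extends_multiplier_op p m S)"
  have "\<exists>S. extends_multiplier_op p m S" using m by (simp add: Mp_def)
  then have ext: "extends_multiplier_op p m S" unfolding S_def by (rule someI_ex)
  have bS: "bounded_op_Lp p S" using ext unfolding extends_multiplier_op_def by (rule conjunct1)
  have ST: "AE x in lebesgue. S \<phi> x = multiplier_op m \<phi> x" if "\<phi> \<in> test_functions" for \<phi>
    using ext that unfolding extends_multiplier_op_def by simp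
  define N where "N = {B. 0 \<le> B \<and> (\<forall>f\<in>Lp p. Lp_norm p (S f) \<le> B * Lp_norm p f)}"
  obtain A where A: "\<And>f. f \<in> Lp p \<Longrightarrow> Lp_norm p (S f) \<le> A * Lp_norm p f"
    using bS unfolding bounded_op_Lp_def by blast
  have "Lp_norm p (S f) \<le> \<bar>A\<bar> * Lp_norm p f" if "f \<in> Lp p" for f
    using A[OF that] mult_right_mono[OF abs_ge_self Lp_norm_nonneg[of p f], of A] by linarith
  then have "\<bar>A\<bar> \<in> N" by (simp add: N_def)
  then have ne: "N \<noteq> {}" by blast
  have norm_eq: "Mp_norm p m = Inf N" by (simp add: Mp_norm_def Lp_op_norm_def N_def S_def)
  have nonneg: "0 \<le> Inf N" using ne by (intro cInf_greatest) (auto simp: N_def)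
  have le: "Lp_norm p (S f) \<le> Inf N * Lp_norm p f" if f: "f \<in> Lp p" for f
  proof (cases "Lp_norm p f = 0")
    case True
    then show ?thesis using A[OF f] by simp
  next
    case False
    then have pos: "0 < Lp_norm p f" using Lp_norm_nonneg[of p f] by linarith
    have "Lp_norm p (S f) / Lp_norm p f \<le> Inf N"
      using ne f pos by (intro cInf_greatest) (auto simp: N_def pos_divide_le_eq)
    then show ?thesis using pos by (simp add: pos_divide_le_eq)
  qed
  show ?thesis unfolding mult_bound_def norm_eq
  proof (intro conjI ballI adm nonneg)
    fix f :: "real ^ 'n \<Rightarrow> complex" assume f: "f \<in> test_functions"
    have fL: "f \<in> Lp p" by (rule test_Lp[OF p f])
    have SL: "S f \<in> Lp p" using bS fL unfolding bounded_op_Lp_def by blast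
    have meas: "multiplier_op m f \<in> borel_measurable lebesgue"
      by (intro smooth_lebesgue_measurable multiplier_op_smooth adm f)
    show "multiplier_op m f \<in> Lp p" by (rule Lp_cong_AE[OF SL ST[OF f] meas])
    show "Lp_norm p (multiplier_op m f) \<le> Inf N * Lp_norm p f"
      using le[OF fL] Lp_norm_cong_AE[OF Lp_measurable[OF SL] meas ST[OF f]] by simp
  qed
qed

end

section \<open>Exponentials of multipliers\<close>

text \<open>\<open>le_exp\<close> serves twice: with \<open>A\<close> it bounds the partial sums as
  operators, and with the supremum bound \<open>M\<close> as symbols, which is the uniform bound
  that \<open>mult_bound_limit\<close> asks for.\<close>

lemma mult_bound_exp:
  fixes m :: "real ^ 'n \<Rightarrow> complex"
  assumes p: "1 \<le> p" and m: "mult_bound p m A"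
  shows "mult_bound p (\<lambda>\<xi>. exp (z * m \<xi>)) (exp (norm z * A))"
proof -
  have A: "0 \<le> A" by (rule mult_bound_nonneg[OF m])
  obtain M where M: "0 \<le> M" "\<And>\<xi>. norm (m \<xi>) \<le> M"
    by (rule admissibleE[OF mult_bound_admissible[OF m]]) blast
  define c where "c j = of_real (inverse (fact j)) * z ^ j" for j :: nat
  define s where "s k \<xi> = (\<Sum>j<k. c j * m \<xi> ^ j)" for k \<xi>
  have nc: "norm (c j) * x ^ j = (norm z * x) ^ j /\<^sub>R fact j" for j and x :: real
    by (simp add: c_def norm_mult norm_power norm_inverse power_mult_distrib)
  have le_exp: "(\<Sum>j<k. norm (c j) * x ^ j) \<le> exp (norm z * x)" if "0 \<le> x" for k x
    unfolding nc exp_def using that by (intro sum_le_suminf summable_exp_generic) auto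
  have s: "mult_bound p (s k) (exp (norm z * A))" for k
    unfolding s_def[abs_def]
    by (rule mult_bound_mono[OF mult_bound_sum[OF p _ mult_bound_cmult[OF p mult_bound_power[OF p m]]] le_exp[OF A]]) simp
  show ?thesis
  proof (rule mult_bound_limit[OF p s])
    fix k \<xi>
    have "norm (s k \<xi>) \<le> (\<Sum>j<k. norm (c j * m \<xi> ^ j))" unfolding s_def by (rule norm_sum)
    also have "\<dots> \<le> (\<Sum>j<k. norm (c j) * M ^ j)"
      using M by (intro sum_mono) (auto simp: norm_mult norm_power intro!: mult_left_mono power_mono)
    also have "\<dots> \<le> exp (norm z * M)" by (rule le_exp[OF M(1)])
    finally show "norm (s k \<xi>) \<le> exp (norm z * M)" .
    have "(\<lambda>j. c j * m \<xi> ^ j) sums exp (z * m \<xi>)"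
      using exp_converges[of "z * m \<xi>"]
      by (simp add: c_def scaleR_conv_of_real power_mult_distrib mult.assoc)
    then show "(\<lambda>k. s k \<xi>) \<longlonglongrightarrow> exp (z * m \<xi>)" unfolding s_def sums_def .
  qed
qed

text \<open>The discrete Cauchy formula on the unit circle extracts the linear Taylor coefficient.\<close>

definition root_sum :: "nat \<Rightarrow> complex \<Rightarrow> complex" where
  "root_sum N x = (\<Sum>j<N. (1 / of_nat N * cis (- (2 * pi * real j / N))) * exp (cis (2 * pi * real j / N) * x))"

text \<open>A geometric sum: its ratio \<open>q\<close> is an N-th root of unity that equals 1 only
  if \<open>N\<close> divides \<open>k - 1\<close>. For \<open>2 \<le> N\<close> and
  \<open>k \<le> N\<close> the absolute value of \<open>k - 1\<close> stays below \<open>N\<close>,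
  which leaves \<open>k = 1\<close>.\<close>

lemma root_average:
  fixes k :: nat
  assumes N: "2 \<le> N" and k: "k \<le> N"
  shows "(\<Sum>j<N. 1 / of_nat N * cis (- (2 * pi * real j / N)) * cis (2 * pi * real j / N) ^ k) = (if k = 1 then 1 else 0)"
proof -
  define q where "q = cis (2 * pi * (real k - 1) / N)"
  have "cis (- (2 * pi * real j / N)) * cis (2 * pi * real j / N) ^ k = q ^ j" for j :: nat
    using N by (simp add: q_def Complex.DeMoivre cis_mult field_simps)
  then have "(\<Sum>j<N. 1 / of_nat N * cis (- (2 * pi * real j / N)) * cis (2 * pi * real j / N) ^ k) = 1 / of_nat N * (\<Sum>j<N. q ^ j)"
    by (simp add: sum_distrib_left mult.assoc)
  also have "\<dots> = (if k = 1 then 1 else 0)"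
  proof (cases "k = 1")
    case True
    then show ?thesis using N by (simp add: q_def)
  next
    case False
    have "q \<noteq> 1"
    proof
      assume "q = 1"
      then have "cos (2 * pi * (real k - 1) / N) = 1" by (simp add: q_def complex_eq_iff)
      then obtain i :: int where "2 * pi * (real k - 1) / N = of_int i * 2 * pi"
        unfolding cos_one_2pi_int by blast
      then have "(2 * pi) * ((real k - 1) / N) = (2 * pi) * of_int i" by (simp add: mult_ac)
      then have "(real k - 1) / N = of_int i" by (simp only: mult_cancel_left) simp
      then have "real k - 1 = of_int i * N" using N by (simp add: divide_eq_eq)
      \<comment> \<open>Integers are used because \<open>k - 1\<close> is negative for
        \<open>k = 0\<close>.\<close>
      then have "real_of_int (int k - 1) = real_of_int (i * int N)" by simp
      then have i: "int k - 1 = i * int N" by (simp only: of_int_eq_iff)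
      have "\<bar>int k - 1\<bar> < int N" using N k False by auto
      moreover have "int N \<le> \<bar>i * int N\<bar>" if "i \<noteq> 0"
        using that mult_right_mono[of 1 "\<bar>i\<bar>" "int N"] by (simp add: abs_mult)
      ultimately have "i = 0" unfolding i by linarith
      then show False using i False by simp
    qed
    moreover have "q ^ N = 1"
    proof -
      have "q ^ N = cis (2 * pi * of_int (int k - 1))"
        using N by (simp add: q_def Complex.DeMoivre)
      then show ?thesis by (simp only: cis_multiple_2pi Ints_of_int)
    qed
    ultimately show ?thesis using False by (simp add: geometric_sum)
  qed
  finally show ?thesis .
qed

text \<open>Averaging the exponential series termwise gives coefficients \<open>a N k\<close> of
  modulus at most 1 that pick out the linear term among all \<open>k \<le> N\<close>. The aliased
  terms, from \<open>k = N + 1\<close> on, move off to infinity, and Tannery's theorem exchanges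
  limit and sum.\<close>

lemma root_sum_tendsto: "(\<lambda>N. root_sum N x) \<longlonglongrightarrow> x"
proof -
  define a where "a N k = (\<Sum>j<N. 1 / of_nat N * cis (- (2 * pi * real j / N)) * cis (2 * pi * real j / N) ^ k)" for N k :: nat
  have a_le: "norm (a N k) \<le> 1" for N k
  proof -
    have "norm (a N k) \<le> (\<Sum>j<N. norm (1 / of_nat N * cis (- (2 * pi * real j / N)) * cis (2 * pi * real j / N) ^ k))"
      unfolding a_def by (rule norm_sum)
    also have "\<dots> \<le> 1" by (simp add: norm_mult norm_power norm_divide)
    finally show ?thesis .
  qed
  have a_eq: "a N k = (if k = 1 then 1 else 0)" if "2 \<le> N" "k \<le> N" for N k
    unfolding a_def by (rule root_average[OF that])
  have sums: "(\<lambda>k. a N k * (x ^ k /\<^sub>R fact k)) sums root_sum N x" for N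
  proof -
    have "(\<lambda>k. \<Sum>j<N. (1 / of_nat N * cis (- (2 * pi * real j / N))) * ((cis (2 * pi * real j / N) * x) ^ k /\<^sub>R fact k)) sums root_sum N x"
      unfolding root_sum_def by (intro sums_sum sums_mult exp_converges)
    moreover have "(\<Sum>j<N. (1 / of_nat N * cis (- (2 * pi * real j / N))) * ((cis (2 * pi * real j / N) * x) ^ k /\<^sub>R fact k)) =
        a N k * (x ^ k /\<^sub>R fact k)" for k
      unfolding a_def sum_distrib_right by (intro sum.cong refl) (simp add: power_mult_distrib)
    ultimately show ?thesis by simp
  qed
  have "(\<lambda>N. \<Sum>k. a N k * (x ^ k /\<^sub>R fact k)) \<longlonglongrightarrow> (\<Sum>k. if k = 1 then x else 0)"
  proof (rule tannerys_theorem[where M="\<lambda>k. norm (x ^ k /\<^sub>R fact k)", THEN conjunct2, THEN conjunct2])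
    show "((\<lambda>N. a N k * (x ^ k /\<^sub>R fact k)) \<longlongrightarrow> (if k = 1 then x else 0)) sequentially" for k
    proof (rule tendsto_eventually)
      show "\<forall>\<^sub>F N in sequentially. a N k * (x ^ k /\<^sub>R fact k) = (if k = 1 then x else 0)"
        using eventually_ge_at_top[of "max 2 k"]
        by eventually_elim (simp add: a_eq)
    qed
    show "\<forall>\<^sub>F (k, N) in at_top \<times>\<^sub>F sequentially. norm (a N k * (x ^ k /\<^sub>R fact k)) \<le> norm (x ^ k /\<^sub>R fact k)"
    proof (intro always_eventually allI, clarify)
      show "norm (a N k * (x ^ k /\<^sub>R fact k)) \<le> norm (x ^ k /\<^sub>R fact k)" for k N
        using mult_right_mono[OF a_le[of N k], of "norm (x ^ k /\<^sub>R fact k)"] by (simp add: norm_mult)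
    qed
    show "summable (\<lambda>k. norm (x ^ k /\<^sub>R fact k))" by (rule summable_norm_exp)
  qed simp
  moreover have "(\<Sum>k. if k = 1 then x else 0) = x"
    using sums_single[of 1 "\<lambda>_. x"] by (simp add: sums_iff)
  ultimately show ?thesis using sums by (simp add: sums_iff)
qed

text \<open>The weights of the average have absolute values summing to 1, so neither the operator
  bound \<open>D\<close> nor the symbol bound \<open>exp M\<close> grows with the number of
  nodes.\<close>

lemma mult_bound_of_circle:
  fixes m :: "real ^ 'n \<Rightarrow> complex"
  assumes p: "1 \<le> p" and m: "\<And>\<xi>. norm (m \<xi>) \<le> M"
    and D: "\<And>\<theta>. mult_bound p (\<lambda>\<xi>. exp (cis \<theta> * m \<xi>)) D"
  shows "mult_bound p m D"
proof (rule mult_bound_limit[OF p])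
  \<comment> \<open>\<open>Suc N\<close> avoids the empty average.\<close>
  show "(\<lambda>N. root_sum (Suc N) (m \<xi>)) \<longlonglongrightarrow> m \<xi>" for \<xi>
    using root_sum_tendsto by (rule LIMSEQ_Suc)
  fix N
  let ?w = "\<lambda>j::nat. 1 / of_nat (Suc N) * cis (- (2 * pi * j / Suc N))"
  have w: "(\<Sum>j<Suc N. norm (?w j) * E) = E" for E :: real
    by (simp add: norm_mult norm_divide del: of_nat_Suc)
  have "mult_bound p (\<lambda>\<xi>. root_sum (Suc N) (m \<xi>))
      (\<Sum>j<Suc N. norm (?w j) * D)"
    unfolding root_sum_def by (intro mult_bound_sum[OF p] mult_bound_cmult[OF p] D) simp
  then show "mult_bound p (\<lambda>\<xi>. root_sum (Suc N) (m \<xi>)) D" unfolding w .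
  fix \<xi>
  have "norm (root_sum (Suc N) (m \<xi>)) \<le>
      (\<Sum>j<Suc N. norm ((?w j) * exp (cis (2 * pi * j / Suc N) * m \<xi>)))"
    unfolding root_sum_def by (rule norm_sum)
  also have "\<dots> \<le> (\<Sum>j<Suc N. norm (?w j) * exp M)"
  proof (intro sum_mono, subst norm_mult, intro mult_left_mono)
    fix j
    have "norm (exp (cis (2 * pi * real j / Suc N) * m \<xi>)) \<le> exp (norm (cis (2 * pi * real j / Suc N) * m \<xi>))"
      by (rule norm_exp)
    also have "\<dots> \<le> exp M" using m by (simp add: norm_mult)
    finally show "norm (exp (cis (2 * pi * real j / Suc N) * m \<xi>)) \<le> exp M" .
  qed simp
  finally show "norm (root_sum (Suc N) (m \<xi>)) \<le> exp M" unfolding w .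
qed

text \<open>The rays \<open>\<plusminus> e^{\<plusminus> i \<phi>}\<close> span the plane over the reals, and the product of two multipliers is
  a multiplier, so control on the four rays yields control on the whole unit circle.\<close>

lemma mult_bound_of_rays:
  fixes m :: "real ^ 'n \<Rightarrow> real"
  assumes m: "\<And>\<xi>. \<bar>m \<xi>\<bar> \<le> M" and p: "1 \<le> p" and \<phi>: "0 < \<phi>" "\<phi> < pi / 2"
    and c: "0 < c" "0 < C"
    and pos: "\<And>z. \<bar>Arg z\<bar> = \<phi> \<Longrightarrow> mult_bound p (\<lambda>\<xi>. exp (z * of_real (m \<xi>))) (C * exp (c * norm z))"
    and neg: "\<And>z. \<bar>Arg z\<bar> = \<phi> \<Longrightarrow> mult_bound p (\<lambda>\<xi>. exp (- z * of_real (m \<xi>))) (C * exp (c * norm z))"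
  shows "\<exists>D. mult_bound p (\<lambda>\<xi>. of_real (m \<xi>)) D"
proof -
  have trig: "0 < cos \<phi>" "0 < sin \<phi>" using \<phi> by (auto intro: cos_gt_zero sin_gt_zero)
  \<comment> \<open>Bounds the coefficients \<open>a\<close> and \<open>b\<close> below, which are
    half the sum and half the difference of \<open>cos \<theta> / cos \<phi>\<close> and
    \<open>sin \<theta> / sin \<phi>\<close>.\<close>
  define r where "r = 1 / cos \<phi> + 1 / sin \<phi>"
  \<comment> \<open>The summand 1 covers a zero coefficient: \<open>Arg 0 = 0\<close> puts
    \<open>z = 0\<close> outside the hypotheses, but the exponential is then the constant 1, with
    bound 1.\<close>
  define E where "E = 1 + C * exp (c * r)"
  have ray: "mult_bound p (\<lambda>\<xi>. exp (of_real a * cis t * of_real (m \<xi>))) E"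
    if t: "t = \<phi> \<or> t = - \<phi>" and a: "\<bar>a\<bar> \<le> r" for a t
  proof -
    have Arg: "\<bar>Arg (of_real b * cis t)\<bar> = \<phi>" if "0 < b" for b
    proof -
      have "Arg (of_real b * cis t) = Arg (cis t)" using that by (rule Arg_times_of_real)
      also have "Arg (cis t) = t" using t \<phi> by (intro cis_Arg_unique) (auto simp: sgn_div_norm)
      finally show ?thesis using t \<phi> by auto
    qed
    have le: "C * exp (c * norm (of_real \<bar>a\<bar> * cis t)) \<le> E"
      using a c by (simp add: E_def norm_mult add_increasing)
    consider "0 < a" | "a = 0" | "a < 0" by linarith
    then show ?thesis
    proof cases
      case 1
      then show ?thesis using mult_bound_mono[OF pos[OF Arg[of "\<bar>a\<bar>"]] le] by simp
    next
      case 2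
      have "1 \<le> E" using c by (simp add: E_def)
      then show ?thesis using mult_bound_mono[OF mult_bound_one[OF p]] 2 by simp
    next
      case 3
      then show ?thesis using mult_bound_mono[OF neg[OF Arg[of "\<bar>a\<bar>"]] le] by simp
    qed
  qed
  have "mult_bound p (\<lambda>\<xi>. exp (cis \<theta> * of_real (m \<xi>))) (E * E)" for \<theta>
  proof -
    \<comment> \<open>These solve \<open>(a + b) * cos \<phi> = cos \<theta>\<close> and
      \<open>(a - b) * sin \<phi> = sin \<theta>\<close>, the real and imaginary parts of the
      decomposition of \<open>cis \<theta>\<close>; the range of \<open>\<phi>\<close> makes both
      divisors positive.\<close>
    define a where "a = (cos \<theta> / cos \<phi> + sin \<theta> / sin \<phi>) / 2"
    define b where "b = (cos \<theta> / cos \<phi> - sin \<theta> / sin \<phi>) / 2"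
    have "\<bar>cos \<theta> / cos \<phi>\<bar> \<le> 1 / cos \<phi>" "\<bar>sin \<theta> / sin \<phi>\<bar> \<le> 1 / sin \<phi>"
      using trig by (simp_all add: divide_right_mono)
    moreover have "0 < 1 / cos \<phi>" "0 < 1 / sin \<phi>" using trig by simp_all
    moreover have "\<bar>(u + v) / 2\<bar> \<le> x + y \<and> \<bar>(u - v) / 2\<bar> \<le> x + y"
      if "\<bar>u\<bar> \<le> x" "\<bar>v\<bar> \<le> y" "0 < x" "0 < y" for u v x y :: real
      using that by auto
    ultimately have ab: "\<bar>a\<bar> \<le> r" "\<bar>b\<bar> \<le> r" unfolding a_def b_def r_def by blast+
    have ab_sum: "(a + b) * cos \<phi> = cos \<theta>" "(a - b) * sin \<phi> = sin \<theta>"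
      using trig by (simp_all add: a_def b_def field_simps)
    have "of_real a * cis \<phi> + of_real b * cis (- \<phi>) = cis \<theta>"
      using ab_sum by (simp add: complex_eq_iff algebra_simps)
    then have "exp (cis \<theta> * of_real (m \<xi>)) =
        exp (of_real a * cis \<phi> * of_real (m \<xi>)) * exp (of_real b * cis (- \<phi>) * of_real (m \<xi>))" for \<xi>
      by (metis distrib_right exp_add)
    then show ?thesis using mult_bound_mult[OF p ray[OF _ ab(1), of \<phi>] ray[OF _ ab(2), of "- \<phi>"]] by simp
  qed
  note circle = this
  have "norm (complex_of_real (m \<xi>)) \<le> M" for \<xi> using m by simp
  from mult_bound_of_circle[OF p this circle] show ?thesis by (rule exI)
qed

theorem theorem1p1:
  fixes m :: "real ^ 'n \<Rightarrow> real" and p \<phi> :: real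
  assumes "m \<in> borel_measurable lebesgue"
    and "bounded (range m)"
    and "1 \<le> p"
    and "0 < \<phi>" and "\<phi> < pi / 2"
  shows "(\<lambda>\<xi>. complex_of_real (m \<xi>)) \<in> Mp p \<longleftrightarrow>
    (\<exists>c C :: real. 0 < c \<and> 0 < C \<and>
      (\<forall>z :: complex. \<bar>Arg z\<bar> = \<phi> \<longrightarrow>
        (\<lambda>\<xi>. exp (z * complex_of_real (m \<xi>))) \<in> Mp p \<and>
        (\<lambda>\<xi>. exp (- z * complex_of_real (m \<xi>))) \<in> Mp p \<and>
        Mp_norm p (\<lambda>\<xi>. exp (z * complex_of_real (m \<xi>))) \<le> C * exp (c * norm z) \<and>
        Mp_norm p (\<lambda>\<xi>. exp (- z * complex_of_real (m \<xi>))) \<le> C * exp (c * norm z)))"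
    (is "?i \<longleftrightarrow> ?ii")
proof
  note p = assms(3)
  let ?m = "\<lambda>\<xi>. complex_of_real (m \<xi>)"
  assume ?i
  define A where "A = Mp_norm p ?m"
  have m: "mult_bound p ?m A" unfolding A_def by (rule Mp_mult_bound[OF p \<open>?i\<close>])
  have A: "0 \<le> A" by (rule mult_bound_nonneg[OF m])
  \<comment> \<open>The constants are \<open>C = 1\<close> and \<open>c = A + 1\<close>; the added 1
    makes \<open>c\<close> positive even when the multiplier norm \<open>A\<close> is 0.\<close>
  have exp: "mult_bound p (\<lambda>\<xi>. exp (z * ?m \<xi>)) (1 * exp ((A + 1) * norm z))" for z
    by (rule mult_bound_mono[OF mult_bound_exp[OF p m]]) (simp add: algebra_simps)
  have exp': "mult_bound p (\<lambda>\<xi>. exp (- z * ?m \<xi>)) (1 * exp ((A + 1) * norm z))" for z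
    using exp[of "- z"] by (simp only: norm_minus_cancel)
  show ?ii
    by (rule exI[of _ "A + 1"], rule exI[of _ 1])
       (intro conjI allI impI mult_bound_imp_Mp[OF p exp] mult_bound_imp_Mp[OF p exp']
         Mp_norm_le[OF p exp] Mp_norm_le[OF p exp'], use A in simp_all)
next
  note p = assms(3)
  assume ?ii
  then obtain c C where c: "0 < c" "0 < C" and z: "\<And>z. \<bar>Arg z\<bar> = \<phi> \<Longrightarrow>
        (\<lambda>\<xi>. exp (z * complex_of_real (m \<xi>))) \<in> Mp p \<and>
        (\<lambda>\<xi>. exp (- z * complex_of_real (m \<xi>))) \<in> Mp p \<and>
        Mp_norm p (\<lambda>\<xi>. exp (z * complex_of_real (m \<xi>))) \<le> C * exp (c * norm z) \<and>
        Mp_norm p (\<lambda>\<xi>. exp (- z * complex_of_real (m \<xi>))) \<le> C * exp (c * norm z)"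
    by blast
  obtain M where M: "\<And>\<xi>. \<bar>m \<xi>\<bar> \<le> M" using assms(2) by (auto simp: bounded_iff)
  have "\<exists>D. mult_bound p (\<lambda>\<xi>. complex_of_real (m \<xi>)) D"
    by (rule mult_bound_of_rays[OF M p assms(4,5) c])
       (use z mult_bound_mono[OF Mp_mult_bound[OF p]] in blast)+
  then show ?i using mult_bound_imp_Mp[OF p] by blast
qed

end
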